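(* Consider oriented link diagrams in the plane, modulo planar isotopy. Let $\mathcal{R}_2$ denote the set of the four oriented Reidemeister moves of type 2, and let $\mathcal{R}_3=\{a,b,c,d,A,B,C,D\}$ denote the set of the eight oriented Reidemeister moves of type 3. Then for any single move $m\in\mathcal{R}_3$, each of the other seven moves in $\mathcal{R}_3$ can be realized as a finite sequence of planar isotopies, moves from $\mathcal{R}_2$ (and their inverses), and the move $m$ (and its inverse). In particular, no Reidemeister move of type 1 is needed.
   Context: An oriented Reidemeister move of type 3 replaces a triangular region of the diagram, bounded by three strand segments that pairwise cross at the three vertices, by the configuration in which the triangle is "turned upside down". Orient the boundary segments and order them as follows: the first segment is the one passing over at both of its crossings (up-up), the second passes over at one and under at the other (up-down), the third passes under at both (down-down). Rotate locally so that the first segment is horizontal and the triangle has the shape $\Delta$ (apex up), with the second and third segments being the remaining sides. Encode the configuration by three arrows giving the directions of the first, second and third segments. The sixteen possible configurations are named: $a^\uparrow=(\rightarrow,\nearrow,\nwarrow)$, $a^\downarrow=(\leftarrow,\swarrow,\searrow)$; $b^\uparrow=(\rightarrow,\nwarrow,\nearrow)$, $b^\downarrow=(\leftarrow,\searrow,\swarrow)$; $c^\uparrow=(\rightarrow,\swarrow,\nwarrow)$, $c^\downarrow=(\leftarrow,\nearrow,\searrow)$; $d^\uparrow=(\rightarrow,\searrow,\nearrow)$, $d^\downarrow=(\leftarrow,\nwarrow,\swarrow)$; $A^\uparrow=(\rightarrow,\searrow,\swarrow)$, $A^\downarrow=(\leftarrow,\nwarrow,\nearrow)$; $B^\uparrow=(\rightarrow,\nearrow,\searrow)$,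 $B^\downarrow=(\leftarrow,\swarrow,\nwarrow)$; $C^\uparrow=(\rightarrow,\nwarrow,\swarrow)$, $C^\downarrow=(\leftarrow,\searrow,\nearrow)$; $D^\uparrow=(\rightarrow,\swarrow,\searrow)$, $D^\downarrow=(\leftarrow,\nearrow,\nwarrow)$. For $x\in\{a,b,c,d,A,B,C,D\}$, the oriented type-3 move $x$ is the passage from configuration $x^\uparrow$ to configuration $x^\downarrow$ (or its inverse). *)

theory Defs
  imports Main
begin

text \<open>
  A diagram is encoded by its crossings (natural-number names), its crossingless
  circle components (natural-number names), the cyclic order of passages along the
  oriented link components, the handedness of each crossing, and a labelling of the
  sides of edges by regions (components of the complement of the diagram).
  A passage (v, True) is the over-passage through crossing v, (v, False) the
  under-passage.  psucc maps a passage to the next passage along the orientation.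
  The edge named Pas p is the arc of the diagram starting at passage p and ending at
  passage psucc p; Circ k is a crossingless circle.  A side (e, True) is the left
  side of the oriented edge e, (e, False) its right side (plane with its standard
  counterclockwise orientation).  Region label 0 is the unbounded region.
\<close>

type_synonym pas = "nat \<times> bool"

datatype eid = Pas pas | Circ nat

type_synonym side = "eid \<times> bool"

record diag =
  crs   :: "nat set"
  circs :: "nat set"
  psucc :: "pas \<Rightarrow> pas"
  hand  :: "nat \<Rightarrow> bool"
  reg   :: "side \<Rightarrow> nat"

definition passages :: "diag \<Rightarrow> pas set" where
  "passages D = crs D \<times> UNIV"

definition edges :: "diag \<Rightarrow> eid set" where
  "edges D = Pas ` passages D \<union> Circ ` circs D"

definition sides :: "diag \<Rightarrow> side set" where
  "sides D = edges D \<times> UNIV"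

definition regions :: "diag \<Rightarrow> nat set" where
  "regions D = reg D ` sides D"

definition ppred :: "diag \<Rightarrow> pas \<Rightarrow> pas" where
  "ppred D = inv_into (passages D) (psucc D)"

text \<open>The four half-edge positions at a crossing: over-in, over-out, under-in, under-out.
  If hand v holds, the under strand passes from the right to the left of the over strand;
  counterclockwise the positions are then OutO, OutU, InO, InU.  Otherwise they are
  OutO, InU, InO, OutU.  cw gives the clockwise neighbour of a position.\<close>

datatype pos = InO | OutO | InU | OutU

fun cw :: "bool \<Rightarrow> pos \<Rightarrow> pos" where
  "cw True OutO = InU" | "cw True InU = InO" | "cw True InO = OutU" | "cw True OutU = OutO"
| "cw False OutO = OutU" | "cw False OutU = InO" | "cw False InO = InU" | "cw False InU = OutO"

text \<open>Leaving crossing w along position q, keeping the region on the left.\<close>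

definition leave :: "diag \<Rightarrow> nat \<Rightarrow> pos \<Rightarrow> side" where
  "leave D w q = (case q of
      OutO \<Rightarrow> (Pas (w, True), True)
    | OutU \<Rightarrow> (Pas (w, False), True)
    | InO \<Rightarrow> (Pas (ppred D (w, True)), False)
    | InU \<Rightarrow> (Pas (ppred D (w, False)), False))"

text \<open>Face-boundary successor: a left side is traversed forwards, a right side backwards,
  always keeping the region on the left.\<close>

fun nxt :: "diag \<Rightarrow> side \<Rightarrow> side" where
  "nxt D (Circ k, b) = (Circ k, b)"
| "nxt D (Pas x, True) =
     (let y = psucc D x in leave D (fst y) (cw (hand D (fst y)) (if snd y then InO else InU)))"
| "nxt D (Pas x, False) =
     leave D (fst x) (cw (hand D (fst x)) (if snd x then OutO else OutU))"

definition cyc :: "diag \<Rightarrow> side \<Rightarrow> side set" where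
  "cyc D s = range (\<lambda>n. (nxt D ^^ n) s)"

definition ncyc :: "diag \<Rightarrow> nat \<Rightarrow> nat" where
  "ncyc D R = card {cyc D s | s. s \<in> sides D \<and> reg D s = R}"

text \<open>Euler characteristic of the closed surface obtained by gluing to the 4-valent
  graph (plus circles) one sphere-with-holes per region.\<close>

definition euler :: "diag \<Rightarrow> int" where
  "euler D = int (card (crs D)) - 2 * int (card (crs D))
             + (\<Sum>R\<in>regions D. 2 - int (ncyc D R))"

definition adj :: "diag \<Rightarrow> side \<Rightarrow> side \<Rightarrow> bool" where
  "adj D s s' \<longleftrightarrow> s \<in> sides D \<and> s' \<in> sides D \<and>
     (s' = nxt D s \<or> s = nxt D s' \<or> fst s = fst s' \<or> reg D s = reg D s')"

text \<open>Validity: the data describe an oriented link diagram in the plane (the glued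
  surface is a connected closed surface of Euler characteristic 2, i.e. a sphere, with
  the unbounded region labelled 0).\<close>

definition valid :: "diag \<Rightarrow> bool" where
  "valid D \<longleftrightarrow> finite (crs D) \<and> finite (circs D)
     \<and> bij_betw (psucc D) (passages D) (passages D)
     \<and> (\<forall>s\<in>sides D. reg D (nxt D s) = reg D s)
     \<and> (sides D \<noteq> {} \<longrightarrow>
          0 \<in> regions D \<and> euler D = 2
          \<and> (\<forall>s\<in>sides D. \<forall>s'\<in>sides D. (adj D)\<^sup>*\<^sup>* s s'))"

fun mpas :: "(nat \<Rightarrow> nat) \<Rightarrow> pas \<Rightarrow> pas" where
  "mpas f (v, ov) = (f v, ov)"

fun meid :: "(nat \<Rightarrow> nat) \<Rightarrow> (nat \<Rightarrow> nat) \<Rightarrow> eid \<Rightarrow> eid" where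
  "meid f g (Pas x) = Pas (mpas f x)"
| "meid f g (Circ k) = Circ (g k)"

definition iso :: "diag \<Rightarrow> diag \<Rightarrow> bool" where
  "iso D D' \<longleftrightarrow> valid D \<and> valid D' \<and>
     (\<exists>f g h. bij_betw f (crs D) (crs D') \<and> bij_betw g (circs D) (circs D')
        \<and> inj_on h (regions D) \<and> h 0 = 0
        \<and> (\<forall>v\<in>crs D. hand D' (f v) = hand D v)
        \<and> (\<forall>x\<in>passages D. psucc D' (mpas f x) = mpas f (psucc D x))
        \<and> (\<forall>e b. (e, b) \<in> sides D \<longrightarrow> reg D' (meid f g e, b) = h (reg D (e, b))))"

definition skip :: "(pas \<Rightarrow> pas) \<Rightarrow> pas set \<Rightarrow> pas \<Rightarrow> pas" where
  "skip f N p = (f ^^ (LEAST n. 0 < n \<and> (f ^^ n) p \<notin> N)) p"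

text \<open>r2 D D': D' is obtained from D by an R2 move creating the two crossings c1, c2
  (a bigon face bounded by the over strand piece from c1 to c2 and an under strand
  piece); reading r2 backwards gives the inverse move.  par assigns to each edge of D'
  the edge of D of which it is a piece.  Regions not touched keep their labels; the
  region in which the move happens may be split, one part receiving the fresh label R'.\<close>

definition r2 :: "diag \<Rightarrow> diag \<Rightarrow> bool" where
  "r2 D D' \<longleftrightarrow> valid D \<and> valid D' \<and>
    (\<exists>c1 c2 oB bA bB par R R'.
       let N = {c1, c2} \<times> UNIV;
           eA = Pas (c1, True);
           eB = Pas (if oB then (c1, False) else (c2, False))
       in c1 \<noteq> c2 \<and> c1 \<notin> crs D \<and> c2 \<notin> crs D
        \<and> crs D' = insert c1 (insert c2 (crs D)) \<and> circs D' \<subseteq> circs D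
        \<and> (\<forall>v\<in>crs D. hand D' v = hand D v)
        \<and> psucc D' (c1, True) = (c2, True)
        \<and> (if oB then psucc D' (c1, False) = (c2, False) else psucc D' (c2, False) = (c1, False))
        \<and> (\<forall>p\<in>passages D. psucc D p = skip (psucc D') N p)
        \<and> (\<forall>p\<in>passages D. par (Pas p) = Pas p)
        \<and> (\<forall>k\<in>circs D'. par (Circ k) = Circ k)
        \<and> (\<forall>x\<in>N. par (Pas x) = par (Pas (ppred D' x)) \<and> par (Pas x) \<in> edges D)
        \<and> (\<forall>x\<in>N. (\<forall>n. (psucc D' ^^ n) x \<in> N) \<longrightarrow> par (Pas x) \<in> Circ ` (circs D - circs D'))
        \<and> (\<forall>k\<in>circs D - circs D'. \<exists>x\<in>N. par (Pas x) = Circ k)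
        \<and> (\<forall>x\<in>N. \<forall>y\<in>N. par (Pas x) = par (Pas y) \<longrightarrow> (\<exists>n. (psucc D' ^^ n) x = y))
        \<and> R' \<notin> regions D \<and> R' \<noteq> 0
        \<and> (\<forall>e b. (e, b) \<in> sides D' \<longrightarrow> e \<noteq> eA \<longrightarrow> e \<noteq> eB \<longrightarrow>
              reg D' (e, b) = reg D (par e, b) \<or> (reg D (par e, b) = R \<and> reg D' (e, b) = R'))
        \<and> reg D' (eA, bA) \<noteq> 0
        \<and> {s \<in> sides D'. reg D' s = reg D' (eA, bA)} = {(eA, bA), (eB, bB)})"

datatype r3move = Ma | Mb | Mc | Md | MA | MB | MC | MD

text \<open>For a triangle in position \<Delta> (first strand horizontal, oriented to the right):
  l = the second strand is the left side of the triangle, u2/u3 = the second/third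
  strand is oriented upwards (from the base towards the apex).\<close>

fun r3tbl :: "bool \<Rightarrow> bool \<Rightarrow> bool \<Rightarrow> r3move" where
  "r3tbl True  True  True  = Ma"
| "r3tbl False True  True  = Mb"
| "r3tbl True  False True  = Mc"
| "r3tbl False False True  = Md"
| "r3tbl False False False = MA"
| "r3tbl True  True  False = MB"
| "r3tbl False True  False = MC"
| "r3tbl True  False False = MD"

text \<open>Swap of the two passages along each of the three strands of the triangle with
  vertices u (strand 1 over strand 2), v (strand 1 over strand 3), w (strand 2 over 3).\<close>

definition tswap :: "nat \<Rightarrow> nat \<Rightarrow> nat \<Rightarrow> pas \<Rightarrow> pas" where
  "tswap u v w y =
     (if y = (u, True) then (v, True) else if y = (v, True) then (u, True)
      else if y = (u, False) then (w, True) else if y = (w, True) then (u, False)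
      else if y = (v, False) then (w, False) else if y = (w, False) then (v, False)
      else y)"

fun ren3 :: "nat \<Rightarrow> nat \<Rightarrow> nat \<Rightarrow> eid \<Rightarrow> eid" where
  "ren3 u v w (Pas y) = Pas (tswap u v w y)"
| "ren3 u v w (Circ k) = Circ k"

text \<open>r3 x D D': D' arises from D by the oriented Reidemeister-3 move x (in either
  direction x-up to x-down or x-down to x-up).  The triangle edges are t1 (strand 1,
  from u to v if o1, else from v to u), t2 (strand 2, u to w if o2), t3 (strand 3,
  v to w if o3); the bounded triangular face consists of their sides b1, b2, b3.
  The triangle lies on the left of strand 1 iff b1; in that case the configuration is
  x-up, otherwise (after rotating by 180 degrees) x-down, whose arrows are all reversed.\<close>

definition r3 :: "r3move \<Rightarrow> diag \<Rightarrow> diag \<Rightarrow> bool" where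
  "r3 x D D' \<longleftrightarrow> valid D \<and> valid D' \<and>
    (\<exists>u v w o1 o2 o3 b1 b2 b3.
       let t1 = (if o1 then (u, True) else (v, True));
           t2 = (if o2 then (u, False) else (w, True));
           t3 = (if o3 then (v, False) else (w, False))
       in u \<noteq> v \<and> u \<noteq> w \<and> v \<noteq> w \<and> u \<in> crs D \<and> v \<in> crs D \<and> w \<in> crs D
        \<and> psucc D t1 = (if o1 then (v, True) else (u, True))
        \<and> psucc D t2 = (if o2 then (w, True) else (u, False))
        \<and> psucc D t3 = (if o3 then (w, False) else (v, False))
        \<and> reg D (Pas t1, b1) \<noteq> 0
        \<and> {s \<in> sides D. reg D s = reg D (Pas t1, b1)} = {(Pas t1, b1), (Pas t2, b2), (Pas t3, b3)}
        \<and> x = (if b1 then r3tbl o1 o2 o3 else r3tbl (\<not> o1) (\<not> o2) (\<not> o3))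
        \<and> crs D' = crs D \<and> circs D' = circs D
        \<and> (\<forall>c\<in>crs D. hand D' c = hand D c)
        \<and> (\<forall>y\<in>passages D. psucc D' y = tswap u v w (psucc D (tswap u v w y)))
        \<and> (\<forall>e b. (e, b) \<in> sides D \<longrightarrow> e \<notin> {Pas t1, Pas t2, Pas t3} \<longrightarrow>
              reg D' (ren3 u v w e, b) = reg D (e, b)))"

definition mstep :: "r3move \<Rightarrow> diag \<Rightarrow> diag \<Rightarrow> bool" where
  "mstep m D D' \<longleftrightarrow> iso D D' \<or> r2 D D' \<or> r2 D' D \<or> r3 m D D' \<or> r3 m D' D"

end

theory Submission
  imports Defs
begin

text \<open>
  Let a strand x meet two further strands y and z in a triangle whose third vertex is c.
  Beyond x the strands y and z diverge into a common region.  An R2 move there makes them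
  cross twice more, at P (near x) and Q, with the same strand on top as at c.  Then x, y, z
  bound a new triangle with third vertex P on the other side of x.  Pushing x across P by an
  R3 move turns the old triangle into a bigon with corners c and P, and a second R2 move
  removes it; the remaining crossing Q plays the role of c in the result of the original R3
  move.  The auxiliary R3 move has the same over/under data and the opposite cyclic order of
  the strands, and exactly the direction of x is reversed relative to the boundary of the
  triangle.  The three choices of x therefore join every type of R3 move with the given
  cyclic order to three of the four types with the opposite order, and the resulting graph
  on the eight types (a cube) is connected.

  The last two steps are obtained from the inverse R2 move: the same construction applied to
  the result of the R3 move, with c renamed to Q and the new crossings called P and c,
  gives the diagram reached after the auxiliary R3 move.  Thus validity only has to be
  checked for the R2 construction.
\<close>

section \<open>Darts and validity\<close>

text \<open>Two demands shape the proof: every intermediate diagram must be \<open>valid\<close>,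
  and \<open>r3\<close> asks for literal equality of names and labels away from the triangle. The
  labels are therefore planned ahead. After the first R2 move \<open>tau\<close> labels the old
  triangle ABc, \<open>R'\<close> the triangle ABP and \<open>L\<close> the bigon PQ. After the
  auxiliary R3 move \<open>R'\<close> is again the pushed triangle, while \<open>tau\<close> has
  become the bigon with corners c and P, and \<open>L\<close> the triangle ABQ. So the second R2
  construction has to start from the target with c renamed to Q and its triangle relabelled
  \<open>L\<close>; an \<open>iso\<close> undoes this. The definition of \<open>r3\<close> leaves
  open the labels on the sides of the turned triangle. That this face has a label of its own is
  forced by counting: on a sphere the number of regions is determined by the numbers of crossings,
  circles and face cycles. Face cycles are orbits of \<open>phi\<close> and are counted through
  first-return maps, so that it does not matter which of the faces around a move happen to
  coincide.\<close>

text \<open>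
  A dart is a half-edge: (p, True) is the edge leaving the passage p, (p, False) the edge
  arriving there.  The map alpha goes to the other end of the edge, crot turns clockwise at
  the crossing, and sd d is the left side of the edge when leaving along d, so phi
  corresponds to nxt.  In these terms no proof has to distinguish strand orientations.
\<close>

type_synonym dart = "pas \<times> bool"

definition darts :: "diag \<Rightarrow> dart set" where
  "darts D = passages D \<times> UNIV"

abbreviation vtx :: "dart \<Rightarrow> nat" where
  "vtx d \<equiv> fst (fst d)"

definition alpha :: "diag \<Rightarrow> dart \<Rightarrow> dart" where
  "alpha D d = (if snd d then (psucc D (fst d), False) else (ppred D (fst d), True))"

text \<open>Closed form of \<open>cw\<close>: over and under alternate around a crossing, and
  leaving turns into arriving, or conversely, exactly when the over/under flag of \<open>d\<close>
  equals the handedness.\<close>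

definition crot :: "(nat \<Rightarrow> bool) \<Rightarrow> dart \<Rightarrow> dart" where
  "crot h d = ((vtx d, \<not> snd (fst d)), snd d \<noteq> (snd (fst d) = h (vtx d)))"

definition phi :: "diag \<Rightarrow> dart \<Rightarrow> dart" where
  "phi D d = crot (hand D) (alpha D d)"

definition sd :: "diag \<Rightarrow> dart \<Rightarrow> side" where
  "sd D d = (Pas (if snd d then fst d else ppred D (fst d)), snd d)"

definition rho :: "diag \<Rightarrow> dart \<Rightarrow> nat" where
  "rho D d = reg D (sd D d)"

definition orb :: "('a \<Rightarrow> 'a) \<Rightarrow> 'a \<Rightarrow> 'a set" where
  "orb f x = range (\<lambda>n. (f ^^ n) x)"

lemma dart_in: "d \<in> darts D \<longleftrightarrow> vtx d \<in> crs D"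
  by (cases d) (auto simp: darts_def passages_def)

lemma crot_eq: "crot h ((v, b), o') = ((v, \<not> b), o' \<noteq> (b = h v))"
  by (simp add: crot_def)

lemma vtx_crot [simp]: "vtx (crot h d) = vtx d"
  by (simp add: crot_def)

lemma crot_4: "crot h (crot h (crot h (crot h d))) = d"
  by (cases d; cases "fst d") (auto simp: crot_def)

lemma inj_crot: "inj (crot h)"
  by (rule inj_on_inverseI[of _ "\<lambda>d. crot h (crot h (crot h d))"]) (simp add: crot_4)

lemma darts_at_vtx:
  assumes "vtx d = vtx e"
  shows "e = d \<or> e = crot h d \<or> e = crot h (crot h d) \<or> e = crot h (crot h (crot h d))"
  using assms by (cases d; cases "fst d"; cases e; cases "fst e") (auto simp: crot_def)

text \<open>The combinatorial part of \<open>valid\<close> alone, so that the dart calculus is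
  available for a constructed diagram while its validity is still to be shown.\<close>

locale pdiag =
  fixes D :: diag
  assumes bij: "bij_betw (psucc D) (passages D) (passages D)"
    and fin: "finite (crs D)" and finc: "finite (circs D)"
begin

lemma psucc_in: "p \<in> passages D \<Longrightarrow> psucc D p \<in> passages D"
  using bij by (auto simp: bij_betw_def)

lemma ppred_in: "p \<in> passages D \<Longrightarrow> ppred D p \<in> passages D"
  using bij by (metis bij_betw_def inv_into_into ppred_def)

lemma ppred_psucc: "p \<in> passages D \<Longrightarrow> ppred D (psucc D p) = p"
  using bij by (simp add: bij_betw_def ppred_def)

lemma psucc_ppred: "p \<in> passages D \<Longrightarrow> psucc D (ppred D p) = p"
  using bij by (metis bij_betw_def f_inv_into_f ppred_def)

lemma alpha_in: "d \<in> darts D \<Longrightarrow> alpha D d \<in> darts D"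
  by (auto simp: alpha_def darts_def psucc_in ppred_in)

lemma alpha_alpha: "d \<in> darts D \<Longrightarrow> alpha D (alpha D d) = d"
  by (auto simp: alpha_def darts_def psucc_ppred ppred_psucc)

lemma phi_in: "d \<in> darts D \<Longrightarrow> phi D d \<in> darts D"
  using alpha_in[of d] by (simp add: phi_def dart_in)

lemma phi_alpha: "d \<in> darts D \<Longrightarrow> phi D (alpha D d) = crot (hand D) d"
  by (simp add: phi_def alpha_alpha)

lemma inj_phi: "inj_on (phi D) (darts D)"
  by (rule inj_onI) (metis alpha_alpha phi_def inj_crot injD)

lemma fin_passages: "finite (passages D)"
  using fin by (simp add: passages_def)

lemma fin_darts: "finite (darts D)"
  by (simp add: darts_def fin_passages)

lemma fin_sides: "finite (sides D)"
  using finc by (simp add: sides_def edges_def fin_passages)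

lemma fin_regions: "finite (regions D)"
  by (simp add: regions_def fin_sides)

lemma sides_eq: "sides D = sd D ` darts D \<union> Circ ` circs D \<times> UNIV"
proof -
  have "Pas ` passages D \<times> UNIV \<subseteq> sd D ` darts D"
  proof
    fix s :: side assume "s \<in> Pas ` passages D \<times> UNIV"
    then obtain p b where s: "s = (Pas p, b)" "p \<in> passages D" by auto
    show "s \<in> sd D ` darts D"
    proof (cases b)
      case True
      then show ?thesis using s by (intro image_eqI[of _ _ "(p, True)"]) (auto simp: sd_def darts_def)
    next
      case False
      then show ?thesis using s
        by (intro image_eqI[of _ _ "(psucc D p, False)"])
           (auto simp: sd_def darts_def ppred_psucc psucc_in)
    qed
  qed
  moreover have "sd D ` darts D \<subseteq> Pas ` passages D \<times> UNIV"
    by (auto simp: sd_def darts_def ppred_in)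
  ultimately show ?thesis by (auto simp: sides_def edges_def)
qed

lemma sd_in: "d \<in> darts D \<Longrightarrow> sd D d \<in> sides D"
  by (auto simp: sides_eq)

lemma inj_sd: "inj_on (sd D) (darts D)"
  by (rule inj_on_inverseI[of _ "\<lambda>s. case fst s of Pas p \<Rightarrow> if snd s then (p, True) else (psucc D p, False)"])
     (auto simp: sd_def darts_def psucc_ppred)

lemma ppred_eq_iff: "p \<in> passages D \<Longrightarrow> q \<in> passages D \<Longrightarrow> ppred D p = ppred D q \<longleftrightarrow> p = q"
  by (metis psucc_ppred)

lemma fst_sd_alpha: "d \<in> darts D \<Longrightarrow> fst (sd D (alpha D d)) = fst (sd D d)"
  by (auto simp: alpha_def sd_def darts_def ppred_psucc)

lemma fst_sd_eq:
  assumes "d \<in> darts D" "e \<in> darts D" "fst (sd D d) = fst (sd D e)"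
  shows "e = d \<or> e = alpha D d"
  using assms
  by (cases d; cases e) (auto simp: alpha_def sd_def darts_def psucc_ppred ppred_psucc ppred_eq_iff
      split: if_splits)

lemma nxt_sd:
  assumes "d \<in> darts D" shows "nxt D (sd D d) = sd D (phi D d)"
proof -
  obtain v b o' where a: "alpha D d = ((v, b), o')" by (metis surj_pair)
  show ?thesis
  proof (cases "snd d")
    case True
    then have "psucc D (fst d) = (v, b)" "\<not> o'" using a by (auto simp: alpha_def)
    then show ?thesis using True a
      by (cases b; cases "hand D v") (auto simp: sd_def phi_def crot_def leave_def Let_def)
  next
    case False
    then have "ppred D (fst d) = (v, b)" "o'" using a by (auto simp: alpha_def)
    then show ?thesis using False a
      by (cases b; cases "hand D v") (auto simp: sd_def phi_def crot_def leave_def Let_def)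
  qed
qed

lemma nxt_pow_sd: "d \<in> darts D \<Longrightarrow> (nxt D ^^ n) (sd D d) = sd D ((phi D ^^ n) d) \<and> (phi D ^^ n) d \<in> darts D"
  by (induction n) (auto simp: nxt_sd phi_in)

lemma cyc_sd: "d \<in> darts D \<Longrightarrow> cyc D (sd D d) = sd D ` orb (phi D) d"
  by (auto simp: cyc_def orb_def nxt_pow_sd)

lemma orb_in: "d \<in> darts D \<Longrightarrow> orb (phi D) d \<subseteq> darts D"
  by (auto simp: orb_def nxt_pow_sd)

lemma cyc_circ: "cyc D (Circ k, b) = {(Circ k, b)}"
proof -
  have "(nxt D ^^ n) (Circ k, b) = (Circ k, b)" for n by (induction n) auto
  then show ?thesis by (simp add: cyc_def)
qed

text \<open>Both sides of a crossingless circle are fixed by \<open>nxt\<close>, so a circle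
  contributes two face cycles; all others are orbits of \<open>phi\<close>.\<close>

lemma card_cycles:
  "card (cyc D ` sides D) = card (orb (phi D) ` darts D) + 2 * card (circs D)"
proof -
  let ?C = "(Circ ` circs D \<times> (UNIV :: bool set))"
  have 1: "cyc D ` sd D ` darts D = image (sd D) ` (orb (phi D) ` darts D)"
    by (simp add: image_image cyc_sd cong: image_cong)
  have "inj_on (image (sd D)) (orb (phi D) ` darts D)"
    by (rule inj_onI) (metis (no_types, lifting) image_iff inj_on_image_eq_iff inj_sd orb_in)
  then have c1: "card (cyc D ` sd D ` darts D) = card (orb (phi D) ` darts D)"
    using 1 card_image by metis
  have "cyc D ` ?C = (\<lambda>s. {s}) ` ?C" by (auto simp: cyc_circ image_iff)
  then have "card (cyc D ` ?C) = card ?C" by (simp add: card_image)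
  also have "\<dots> = 2 * card (circs D)"
    by (simp add: card_cartesian_product card_image inj_on_def)
  finally have c2: "card (cyc D ` ?C) = 2 * card (circs D)" .
  have "cyc D ` sd D ` darts D \<inter> cyc D ` ?C = {}"
  proof -
    have False if "d \<in> darts D" "cyc D (sd D d) = cyc D (Circ k, b)" for d k b
    proof -
      have "sd D d \<in> cyc D (sd D d)" unfolding cyc_def by (rule image_eqI[of _ _ 0]) auto
      with that show False by (auto simp: cyc_circ sd_def)
    qed
    then show ?thesis by fastforce
  qed
  then show ?thesis
    using c1 c2 fin_darts finc by (simp add: sides_eq image_Un card_Un_disjoint)
qed

end

section \<open>Validity as label invariance, a face count and a colouring condition\<close>

definition dreg :: "diag \<Rightarrow> bool" where
  "dreg D \<longleftrightarrow> (\<forall>d\<in>darts D. rho D (phi D d) = rho D d)"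

text \<open>The Euler characteristic with \<open>ncyc\<close> summed out: every region contributes
  2, every face cycle -1, and a crossing, having two outgoing edges, 1 - 2 = -1.\<close>

definition echar :: "diag \<Rightarrow> int" where
  "echar D = 2 * int (card (regions D)) - int (card (crs D))
     - int (card (orb (phi D) ` darts D)) - 2 * int (card (circs D))"

text \<open>Connectivity in the form: an incidence-compatible two-colouring of crossings (V),
  circles (K) and regions (W) is constant.\<close>

definition dconn :: "diag \<Rightarrow> bool" where
  "dconn D \<longleftrightarrow> (\<forall>V K W :: nat \<Rightarrow> bool.
     (\<forall>d\<in>darts D. V (vtx d) = W (rho D d)) \<longrightarrow>
     (\<forall>k\<in>circs D. \<forall>b. K k = W (reg D (Circ k, b))) \<longrightarrow>
     (\<forall>r\<in>regions D. \<forall>r'\<in>regions D. W r = W r'))"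

context pdiag begin

lemma regions_eq: "regions D = rho D ` darts D \<union> reg D ` (Circ ` circs D \<times> UNIV)"
  by (simp add: regions_def sides_eq image_Un image_image rho_def)

lemma dreg_iff: "(\<forall>s\<in>sides D. reg D (nxt D s) = reg D s) \<longleftrightarrow> dreg D"
proof -
  have "(\<forall>s\<in>sides D. reg D (nxt D s) = reg D s) \<longleftrightarrow> (\<forall>s\<in>sd D ` darts D. reg D (nxt D s) = reg D s)"
    unfolding sides_eq by auto
  also have "\<dots> \<longleftrightarrow> dreg D"
    unfolding dreg_def rho_def ball_simps using nxt_sd by simp
  finally show ?thesis .
qed

text \<open>Labels are constant along \<open>nxt\<close>, so each face cycle belongs to a single
  region and the sum of \<open>ncyc\<close> counts every cycle once.\<close>

lemma euler_eq:
  assumes "dreg D" shows "euler D = echar D"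
proof -
  have inv: "reg D (nxt D s) = reg D s" if "s \<in> sides D" for s using assms dreg_iff that by blast
  have nin: "nxt D s \<in> sides D" if "s \<in> sides D" for s
    using that by (auto simp: sides_eq nxt_sd phi_in)
  have pw: "(nxt D ^^ n) s \<in> sides D \<and> reg D ((nxt D ^^ n) s) = reg D s" if "s \<in> sides D" for s n
    by (induction n) (auto simp: that inv nin)
  have cr: "reg D s = reg D s'" if "cyc D s = cyc D s'" "s \<in> sides D" "s' \<in> sides D" for s s'
  proof -
    have "s \<in> cyc D s" unfolding cyc_def by (rule image_eqI[of _ _ 0]) auto
    then have "s \<in> cyc D s'" using that(1) by simp
    then obtain n where "s = (nxt D ^^ n) s'" unfolding cyc_def by (rule rangeE)
    then show ?thesis using pw that by metis
  qed
  have fc: "finite {cyc D s | s. s \<in> sides D \<and> reg D s = R}" for R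
    by (rule finite_subset[of _ "cyc D ` sides D"]) (use fin_sides in blast)+
  have dj: "{cyc D s | s. s \<in> sides D \<and> reg D s = R} \<inter> {cyc D s | s. s \<in> sides D \<and> reg D s = R'} = {}"
    if "R \<noteq> R'" for R R'
    using cr that by blast
  have "(\<Sum>R\<in>regions D. ncyc D R) = card (\<Union>R\<in>regions D. {cyc D s | s. s \<in> sides D \<and> reg D s = R})"
    unfolding ncyc_def
    by (subst card_UN_disjoint) (use fin_regions fc dj in blast)+
  also have "(\<Union>R\<in>regions D. {cyc D s | s. s \<in> sides D \<and> reg D s = R}) = cyc D ` sides D"
    by (auto simp: regions_def)
  finally have "(\<Sum>R\<in>regions D. int (ncyc D R)) = int (card (cyc D ` sides D))"
    by (metis of_nat_sum)
  then show ?thesis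
    by (simp add: euler_def echar_def sum_subtractf card_cycles)
qed

text \<open>A compatible colouring is constant along \<open>adj\<close>; conversely, reachability
  from a fixed side is itself a compatible colouring.\<close>

lemma dconn_iff:
  assumes "dreg D"
  shows "(\<forall>s\<in>sides D. \<forall>s'\<in>sides D. (adj D)\<^sup>*\<^sup>* s s') \<longleftrightarrow> dconn D"
proof
  assume conn: "\<forall>s\<in>sides D. \<forall>s'\<in>sides D. (adj D)\<^sup>*\<^sup>* s s'"
  have inv: "reg D (nxt D s) = reg D s" if "s \<in> sides D" for s using assms dreg_iff that by blast
  show "dconn D"
    unfolding dconn_def
  proof (intro allI impI ballI)
    fix V K W :: "nat \<Rightarrow> bool" and r r'
    assume V: "\<forall>d\<in>darts D. V (vtx d) = W (rho D d)"
      and K: "\<forall>k\<in>circs D. \<forall>b. K k = W (reg D (Circ k, b))"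
      and "r \<in> regions D" "r' \<in> regions D"
    then obtain s s' where s: "s \<in> sides D" "s' \<in> sides D" "r = reg D s" "r' = reg D s'"
      by (auto simp: regions_def)
    \<comment> \<open>Both sides of an edge border the crossing at its far end, whose colour they
      share.\<close>
    have al: "W (rho D (alpha D d)) = W (rho D d)" if d: "d \<in> darts D" for d
    proof -
      have "W (rho D (alpha D d)) = V (vtx (phi D d))"
        using V alpha_in[OF d] by (simp add: phi_def)
      also have "\<dots> = W (rho D d)" using V phi_in[OF d] assms d by (simp add: dreg_def)
      finally show ?thesis .
    qed
    have "W (reg D t) = W (reg D t')" if "adj D t t'" for t t'
    proof -
      have t: "t \<in> sides D" "t' \<in> sides D" using that by (auto simp: adj_def)
      have "W (reg D t) = W (reg D t')" if e: "fst t = fst t'"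
      proof (cases "fst t")
        case (Pas p)
        then obtain d d' where d: "d \<in> darts D" "d' \<in> darts D" "t = sd D d" "t' = sd D d'"
          using t e by (auto simp: sides_eq)
        then have "d' = d \<or> d' = alpha D d" using fst_sd_eq e by blast
        then show ?thesis using al[OF d(1)] d(3,4) by (auto simp: rho_def simp del: split_paired_All)
      next
        case (Circ k)
        then obtain b b' where b: "t = (Circ k, b)" "t' = (Circ k, b')"
          using e by (metis prod.collapse)
        then have "k \<in> circs D" using t by (auto simp: sides_eq sd_def)
        then show ?thesis using K b by metis
      qed
      then show ?thesis using that inv[of t] inv[of t'] t unfolding adj_def by metis
    qed
    note adjW = this
    have "(adj D)\<^sup>*\<^sup>* s s'" using conn s by blast
    then have "W (reg D s) = W (reg D s')"
      by (induction rule: rtranclp_induct) (simp_all add: adjW)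
    then show "W r = W r'" using s by simp
  qed
next
  assume dc: "dconn D"
  show "\<forall>s\<in>sides D. \<forall>s'\<in>sides D. (adj D)\<^sup>*\<^sup>* s s'"
  proof (intro ballI)
    fix s s' assume s: "s \<in> sides D" "s' \<in> sides D"
    let ?c = "\<lambda>t. (adj D)\<^sup>*\<^sup>* s t"
    have rg: "?c t \<longleftrightarrow> ?c t'" if "t \<in> sides D" "t' \<in> sides D" "reg D t = reg D t'" for t t'
      using that by (metis adj_def rtranclp.rtrancl_into_rtrancl)
    have ed: "?c t \<longleftrightarrow> ?c t'" if "t \<in> sides D" "t' \<in> sides D" "fst t = fst t'" for t t'
      using that by (metis adj_def rtranclp.rtrancl_into_rtrancl)
    \<comment> \<open>Turning at a crossing amounts to changing to the other side of the edge and
      then following the face, since \<open>crot\<close> is \<open>phi\<close> after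
      \<open>alpha\<close>. Hence all sides at a crossing are connected.\<close>
    have cr: "?c (sd D (crot (hand D) d)) = ?c (sd D d)" if d: "d \<in> darts D" for d
    proof -
      have "rho D (crot (hand D) d) = rho D (alpha D d)"
        using assms alpha_in[OF d] by (metis d dreg_def phi_alpha)
      moreover have "crot (hand D) d \<in> darts D" using d by (simp add: dart_in)
      ultimately have "?c (sd D (crot (hand D) d)) = ?c (sd D (alpha D d))"
        using rg alpha_in[OF d] by (simp add: rho_def sd_in)
      also have "\<dots> = ?c (sd D d)"
        using ed sd_in alpha_in d fst_sd_alpha by presburger
      finally show ?thesis .
    qed
    have vt: "?c (sd D d) = ?c (sd D e)" if d: "d \<in> darts D" "e \<in> darts D" "vtx d = vtx e" for d e
    proof -
      have "crot (hand D) d \<in> darts D" "crot (hand D) (crot (hand D) d) \<in> darts D"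
        using d by (simp_all add: dart_in)
      then show ?thesis using darts_at_vtx[OF d(3), of "hand D"] cr d(1) by metis
    qed
    \<comment> \<open>Regions, crossings and circles are coloured by whether they can be reached
      from \<open>s\<close>.\<close>
    define W where "W r \<longleftrightarrow> (\<exists>t\<in>sides D. reg D t = r \<and> ?c t)" for r
    define V where "V v \<longleftrightarrow> (\<exists>d\<in>darts D. vtx d = v \<and> ?c (sd D d))" for v
    define K where "K k \<longleftrightarrow> ?c (Circ k, True)" for k
    have W: "W (reg D t) = ?c t" if "t \<in> sides D" for t
      using rg that unfolding W_def by metis
    have "\<forall>d\<in>darts D. V (vtx d) = W (rho D d)"
      unfolding rho_def using W sd_in vt V_def by metis
    moreover have "\<forall>k\<in>circs D. \<forall>b. K k = W (reg D (Circ k, b))"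
    proof (intro ballI allI)
      fix k b assume "k \<in> circs D"
      then have i: "(Circ k, c) \<in> sides D" for c by (simp add: sides_eq)
      show "K k = W (reg D (Circ k, b))" using ed[OF i i] W[OF i] by (simp add: K_def)
    qed
    ultimately have "W (reg D s) = W (reg D s')"
      using dc s unfolding dconn_def regions_def by blast
    then show "?c s'" using W s by simp
  qed
qed

lemma valid_iff:
  "valid D \<longleftrightarrow> dreg D \<and> (regions D \<noteq> {} \<longrightarrow> 0 \<in> regions D \<and> echar D = 2 \<and> dconn D)"
proof -
  have "sides D = {} \<longleftrightarrow> regions D = {}" by (simp add: regions_def)
  then show ?thesis
    unfolding valid_def using bij fin finc dreg_iff euler_eq dconn_iff by auto
qed

end

lemma valid_pdiag: "valid D \<Longrightarrow> pdiag D"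
  by (simp add: valid_def pdiag_def)

section \<open>Diagrams built from an involution on darts\<close>

text \<open>The right side of an edge is the side seen from its far end, which explains the label
  \<open>r (a (p, True))\<close>.\<close>

definition mkd :: "nat set \<Rightarrow> nat set \<Rightarrow> (dart \<Rightarrow> dart) \<Rightarrow> (nat \<Rightarrow> bool) \<Rightarrow> (dart \<Rightarrow> nat) \<Rightarrow> (nat \<times> bool \<Rightarrow> nat) \<Rightarrow> diag" where
  "mkd C K a h r q = \<lparr>crs = C, circs = K, psucc = (\<lambda>p. fst (a (p, True))), hand = h,
     reg = (\<lambda>s. case fst s of Pas p \<Rightarrow> r (if snd s then (p, True) else a (p, True))
                            | Circ k \<Rightarrow> q (k, snd s))\<rparr>"

lemma mkd_simps [simp]:
  "crs (mkd C K a h r q) = C" "circs (mkd C K a h r q) = K" "hand (mkd C K a h r q) = h"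
  "reg (mkd C K a h r q) (Circ k, b) = q (k, b)"
  "psucc (mkd C K a h r q) p = fst (a (p, True))"
  by (simp_all add: mkd_def)

text \<open>The condition on \<open>snd\<close> means that leaving darts are glued to arriving ones.
  Hence \<open>psucc\<close> is inverted by following \<open>a\<close> from the arriving
  darts.\<close>

lemma mkd_darts:
  fixes C K a h r q
  defines "D \<equiv> mkd C K a h r q"
  assumes fin: "finite C" "finite K"
    and a: "\<And>d. vtx d \<in> C \<Longrightarrow> vtx (a d) \<in> C \<and> a (a d) = d \<and> snd (a d) \<noteq> snd d"
  shows "pdiag D" and "\<And>d. vtx d \<in> C \<Longrightarrow> alpha D d = a d" and "\<And>d. vtx d \<in> C \<Longrightarrow> rho D d = r d"
proof -
  have in_C: "p \<in> passages D \<longleftrightarrow> fst p \<in> C" for p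
    by (simp add: D_def passages_def mem_Times_iff)
  have fl: "(fst (a (p, b)), \<not> b) = a (p, b)" if "fst p \<in> C" for p b
    using a[of "(p, b)"] that by (simp add: prod_eq_iff)
  have bij: "bij_betw (psucc D) (passages D) (passages D)"
  proof (rule bij_betw_byWitness[of _ "\<lambda>p. fst (a (p, False))"])
    show "\<forall>p\<in>passages D. fst (a (psucc D p, False)) = p"
    proof
      fix p assume "p \<in> passages D"
      then have "fst p \<in> C" by (simp add: in_C)
      then show "fst (a (psucc D p, False)) = p" using fl[of p True] a[of "(p, True)"] by (simp add: D_def)
    qed
    show "\<forall>p\<in>passages D. psucc D (fst (a (p, False))) = p"
    proof
      fix p assume "p \<in> passages D"
      then have "fst p \<in> C" by (simp add: in_C)
      then show "psucc D (fst (a (p, False))) = p" using fl[of p False] a[of "(p, False)"] by (simp add: D_def)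
    qed
    show "psucc D ` passages D \<subseteq> passages D"
    proof
      fix q assume "q \<in> psucc D ` passages D"
      then obtain p where "fst p \<in> C" "q = psucc D p" by (auto simp: in_C)
      then show "q \<in> passages D" using a[of "(p, True)"] by (simp add: in_C) (simp add: D_def)
    qed
    show "(\<lambda>p. fst (a (p, False))) ` passages D \<subseteq> passages D"
    proof
      fix q assume "q \<in> (\<lambda>p. fst (a (p, False))) ` passages D"
      then obtain p where "fst p \<in> C" "q = fst (a (p, False))" by (auto simp: in_C)
      then show "q \<in> passages D" using a[of "(p, False)"] by (simp add: in_C)
    qed
  qed
  show p: "pdiag D" using fin bij by unfold_locales (simp_all add: D_def)
  then interpret pdiag D .
  show al: "alpha D d = a d" if d: "vtx d \<in> C" for d
  proof (cases "snd d")
    case True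
    then have "d = (fst d, True)" by (metis prod.collapse)
    then have "snd (a d) = False" "psucc D (fst d) = fst (a d)"
      using a[OF d] True by (auto simp: D_def)
    then show ?thesis using True by (simp add: alpha_def prod_eq_iff)
  next
    case False
    then have 1: "snd (a d)" "a (a d) = d" "vtx (a d) \<in> C" using a[OF d] by auto
    then have "a d = (fst (a d), True)" by (metis prod.collapse)
    then have "psucc D (fst (a d)) = fst d" using 1 by (simp add: D_def)
    moreover have "fst (a d) \<in> passages D" using 1 by (cases "a d") (auto simp: passages_def D_def mem_Times_iff)
    ultimately have "ppred D (fst d) = fst (a d)" using ppred_psucc by metis
    then show ?thesis using False 1 by (simp add: alpha_def prod_eq_iff)
  qed
  show "rho D d = r d" if d: "vtx d \<in> C" for d
  proof (cases "snd d")
    case True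
    then show ?thesis by (auto simp: rho_def sd_def D_def mkd_def) (metis prod.collapse)
  next
    case False
    have "fst (alpha D d) = ppred D (fst d)" using False by (simp add: alpha_def)
    moreover have "snd (a d)" "a (a d) = d" using a[OF d] False by auto
    ultimately have "a (ppred D (fst d), True) = d" using al[OF d] by (metis (full_types) prod.collapse)
    then show ?thesis using False by (simp add: rho_def sd_def) (simp add: D_def mkd_def)
  qed
qed

section \<open>Orbits and return maps\<close>

text \<open>First return: the count starts at \<open>Suc\<close>, so a point of \<open>X\<close> is
  not its own return point unless its orbit really comes back to it.\<close>

definition hit :: "('a \<Rightarrow> 'a) \<Rightarrow> 'a set \<Rightarrow> 'a \<Rightarrow> 'a \<Rightarrow> bool" where
  "hit f X a b \<longleftrightarrow> (\<exists>n. (f ^^ Suc n) a = b \<and> b \<in> X \<and> (\<forall>i<n. (f ^^ Suc i) a \<notin> X))"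

lemma hit_here: "f a = b \<Longrightarrow> b \<in> X \<Longrightarrow> hit f X a b"
  unfolding hit_def by (rule exI[of _ 0]) simp

lemma hit_step:
  assumes "hit f X c b" "f a = c" "c \<notin> X"
  shows "hit f X a b"
proof -
  have assms: "f a \<notin> X" "hit f X (f a) b" using assms by simp_all
  from assms(2) obtain n where n: "(f ^^ Suc n) (f a) = b" "b \<in> X" "\<forall>i<n. (f ^^ Suc i) (f a) \<notin> X"
    unfolding hit_def by blast
  have "(f ^^ Suc i) a \<notin> X" if "i < Suc n" for i
    using that assms(1) n(3) by (cases i) (simp_all add: funpow_swap1)
  moreover have "(f ^^ Suc (Suc n)) a = b" using n(1) by (simp add: funpow_swap1)
  ultimately show ?thesis unfolding hit_def using n(2) by blast
qed

lemma hit_orb: "hit f X a b \<Longrightarrow> b \<in> orb f a"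
  unfolding hit_def orb_def by (metis rangeI)

lemma hit_in: "hit f X a b \<Longrightarrow> b \<in> X"
  unfolding hit_def by blast

lemma orb_refl: "a \<in> orb f a"
  unfolding orb_def by (rule image_eqI[of _ _ 0]) simp_all

lemma orb_sub: "b \<in> orb f a \<Longrightarrow> orb f b \<subseteq> orb f a"
proof
  fix c assume "b \<in> orb f a" "c \<in> orb f b"
  then obtain m n where "b = (f ^^ m) a" "c = (f ^^ n) b" by (auto simp: orb_def)
  then have "c = (f ^^ (n + m)) a" by (simp add: funpow_add)
  then show "c \<in> orb f a" by (simp add: orb_def)
qed

lemma funpow_in: "f ` S \<subseteq> S \<Longrightarrow> a \<in> S \<Longrightarrow> (f ^^ n) a \<in> S"
  by (induction n) auto

lemma orb_subset: "f ` S \<subseteq> S \<Longrightarrow> a \<in> S \<Longrightarrow> orb f a \<subseteq> S"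
  by (auto simp: orb_def funpow_in)

text \<open>On a finite set an injective self-map is a permutation: two iterates of \<open>a\<close>
  agree by the pigeonhole principle, and cancelling the earlier one gives a period. Thus forward
  orbits are cycles.\<close>

lemma orb_sym:
  assumes "finite S" "inj_on f S" "f ` S \<subseteq> S" "a \<in> S" "b \<in> orb f a"
  shows "a \<in> orb f b"
proof -
  obtain m where m: "b = (f ^^ m) a" using assms(5) by (auto simp: orb_def)
  have inj: "inj_on (f ^^ k) S" for k
  proof (induction k)
    case (Suc k)
    have "inj_on (f \<circ> (f ^^ k)) S"
      by (rule comp_inj_on[OF Suc]) (meson assms(2,3) funpow_in image_subsetI inj_on_subset)
    then show ?case by (simp add: comp_def)
  qed simp
  have "\<not> inj (\<lambda>n. (f ^^ n) a)"
    using assms(1,3,4) finite_subset[of "range (\<lambda>n. (f ^^ n) a)" S] funpow_in[of f S a]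
    by (meson finite_imageD image_subsetI infinite_UNIV_nat)
  then obtain i j where ij: "i < j" "(f ^^ i) a = (f ^^ j) a"
    unfolding inj_def by (metis linorder_neqE_nat)
  have "(f ^^ i) ((f ^^ (j - i)) a) = (f ^^ i) a"
    using ij by (metis funpow_add le_add_diff_inverse less_imp_le comp_apply)
  then have per: "(f ^^ (j - i)) a = a"
    using inj[of i] assms(3,4) by (meson funpow_in inj_onD)
  \<comment> \<open>A whole number of periods that is at least \<open>m\<close> completes the way
    from \<open>b\<close> back to \<open>a\<close>.\<close>
  have "(f ^^ ((j - i) * k)) a = a" for k
    by (induction k) (simp_all add: funpow_add per)
  moreover have "m \<le> (j - i) * m" using ij(1) by (simp add: Suc_le_eq)
  ultimately have "(f ^^ ((j - i) * m - m)) b = a"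
    unfolding m by (metis comp_apply funpow_add le_add_diff_inverse2)
  then show ?thesis unfolding orb_def by (metis rangeI)
qed

lemma orb_eq:
  assumes "finite S" "inj_on f S" "f ` S \<subseteq> S" "a \<in> S" "b \<in> orb f a"
  shows "orb f b = orb f a"
  by (rule subset_antisym[OF orb_sub[OF assms(5)] orb_sub[OF orb_sym[OF assms]]])

lemma orb_inter_return:
  assumes g: "\<And>s. s \<in> G \<Longrightarrow> g s \<in> G \<and> hit f (j ` G) (j s) (j (g s))" and s: "s \<in> G"
  shows "orb f (j s) \<inter> j ` G = j ` orb g s"
proof
  show "j ` orb g s \<subseteq> orb f (j s) \<inter> j ` G"
  proof -
    have "j ((g ^^ n) s) \<in> orb f (j s) \<and> (g ^^ n) s \<in> G" for n
    proof (induction n)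
      case 0 then show ?case using s orb_refl by simp
    next
      case (Suc n)
      then show ?case using g[of "(g ^^ n) s"] hit_orb orb_sub by fastforce
    qed
    then show ?thesis by (auto simp: orb_def)
  qed
  have "(f ^^ m) (j s) \<in> j ` G \<Longrightarrow> (f ^^ m) (j s) \<in> j ` orb g s" if "s \<in> G" for m s
    using that
  proof (induction m arbitrary: s rule: less_induct)
    case (less m)
    show ?case
    proof (cases m)
      case 0 then show ?thesis using orb_refl by fastforce
    next
      case (Suc m')
      obtain n where n: "(f ^^ Suc n) (j s) = j (g s)" "\<forall>i<n. (f ^^ Suc i) (j s) \<notin> j ` G"
        using g[OF less.prems(2)] unfolding hit_def by blast
      have "n \<le> m'" using n(2) less.prems(1) Suc by (meson leI)
      then have e: "(f ^^ m) (j s) = (f ^^ (m' - n)) (j (g s))"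
        using n(1) Suc by (metis Suc_le_mono add.commute diff_Suc_Suc funpow_add le_add_diff_inverse comp_apply)
      then have "(f ^^ m) (j s) \<in> j ` orb g (g s)"
        using less.IH[of "m' - n" "g s"] less.prems g[OF less.prems(2)] Suc by auto
      moreover have "g s \<in> orb g s" unfolding orb_def by (rule image_eqI[of _ _ 1]) simp_all
      ultimately show ?thesis using orb_sub by fast
    qed
  qed
  then show "orb f (j s) \<inter> j ` G \<subseteq> j ` orb g s" using s by (auto simp: orb_def)
qed

text \<open>Here g is the first-return map of f to G (embedded by j), and Z is the union of the
  cycles of f that miss G.\<close>

lemma card_orbs_return:
  assumes fin: "finite S" and inj: "inj_on f S" and f: "f ` S \<subseteq> S"
    and G: "j ` G \<subseteq> S" "inj_on j G"
    and g: "\<And>s. s \<in> G \<Longrightarrow> g s \<in> G \<and> hit f (j ` G) (j s) (j (g s))"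
    and Z: "Z \<subseteq> S" "f ` Z \<subseteq> Z" "Z \<inter> j ` G = {}"
    and S: "\<And>x. x \<in> S \<Longrightarrow> x \<in> Z \<or> orb f x \<inter> j ` G \<noteq> {}"
  shows "card (orb f ` S) = card (orb g ` G) + card (orb f ` Z)"
proof -
  have "orb f ` S = orb f ` j ` G \<union> orb f ` Z"
  proof
    show "orb f ` S \<subseteq> orb f ` j ` G \<union> orb f ` Z"
    proof
      fix X assume "X \<in> orb f ` S"
      then obtain x where x: "x \<in> S" "X = orb f x" by blast
      show "X \<in> orb f ` j ` G \<union> orb f ` Z"
      proof (cases "x \<in> Z")
        case False
        then obtain y where "y \<in> orb f x" "y \<in> j ` G" using S x by blast
        then show ?thesis using orb_eq[OF fin inj f x(1)] x(2) by blast
      qed (use x in blast)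
    qed
  qed (use G Z in blast)
  moreover have "orb f ` j ` G \<inter> orb f ` Z = {}"
    using orb_subset[OF Z(2)] orb_refl[of _ f] Z(3) by blast
  moreover have "card (orb f ` j ` G) = card (orb g ` G)"
  proof -
    have cl: "g ` G \<subseteq> G" using g by blast
    have "bij_betw (\<lambda>X. {y \<in> G. j y \<in> X}) (orb f ` j ` G) (orb g ` G)"
    proof (rule bij_betw_imageI)
      have e: "{y \<in> G. j y \<in> orb f (j s)} = orb g s" if "s \<in> G" for s
      proof -
        have "j ` {y \<in> G. j y \<in> X} = X \<inter> j ` G" for X by blast
        then have "j ` {y \<in> G. j y \<in> orb f (j s)} = j ` orb g s"
          using orb_inter_return[of G g f j, OF g that] by simp
        then show ?thesis
          using inj_on_image_eq_iff[OF G(2), of "{y \<in> G. j y \<in> orb f (j s)}" "orb g s"]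
            orb_subset[OF cl that] by blast
      qed
      show "inj_on (\<lambda>X. {y \<in> G. j y \<in> X}) (orb f ` j ` G)"
      proof (rule inj_onI)
        fix X Y assume "X \<in> orb f ` j ` G" "Y \<in> orb f ` j ` G"
          and eq: "{y \<in> G. j y \<in> X} = {y \<in> G. j y \<in> Y}"
        then obtain s t where st: "s \<in> G" "t \<in> G" "X = orb f (j s)" "Y = orb f (j t)" by blast
        then have "j s \<in> orb f (j t)" using eq orb_refl by fast
        then show "X = Y" using orb_eq[OF fin inj f] st G by blast
      qed
      show "(\<lambda>X. {y \<in> G. j y \<in> X}) ` orb f ` j ` G = orb g ` G"
        unfolding image_image by (rule image_cong[OF refl e])
    qed
    then show ?thesis by (rule bij_betw_same_card)
  qed
  moreover have "finite (orb f ` j ` G)" "finite (orb f ` Z)"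
    using fin G(1) Z(1) by (auto intro: finite_subset)
  ultimately show ?thesis by (simp add: card_Un_disjoint)
qed

lemma orb_3:
  assumes "f a = b" "f b = c" "f c = a"
  shows "orb f a = {a, b, c}"
proof -
  have "orb f a \<subseteq> {a, b, c}" by (rule orb_subset) (use assms in auto)
  moreover have "b \<in> orb f a" "c \<in> orb f a"
    unfolding orb_def using assms by (auto simp: image_iff intro: exI[of _ 1] exI[of _ "Suc 1"])
  ultimately show ?thesis using orb_refl by fast
qed

lemma orb_2:
  assumes "f a = b" "f b = a"
  shows "orb f a = {a, b}"
proof -
  have "orb f a \<subseteq> {a, b}" by (rule orb_subset) (use assms in auto)
  moreover have "b \<in> orb f a"
    unfolding orb_def using assms by (auto simp: image_iff intro: exI[of _ 1])
  ultimately show ?thesis using orb_refl by fast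
qed

section \<open>The R2 move at a corner\<close>

text \<open>
  The side AB of x has the region to be cut on its right when traversed from A to B; the
  darts yA and zB leave A and B along this region.  The R2 move puts P and Q on both edges;
  R' labels the new triangle ABP and L the bigon PQ.  The Boolean k tells whether y is on top.
\<close>

locale corner =
  fixes D :: diag and A B P Q :: nat and i j k ox oy oz :: bool and R' L :: nat
  assumes val: "valid D"
    and AB: "A \<noteq> B" "A \<in> crs D" "B \<in> crs D"
    and PQ: "P \<notin> crs D" "Q \<notin> crs D" "P \<noteq> Q"
    and alpha_x: "alpha D ((A, i), ox) = ((B, j), \<not> ox)"
    and rot_A: "crot (hand D) ((A, \<not> i), \<not> oy) = ((A, i), ox)"
    and rot_B: "crot (hand D) ((B, j), \<not> ox) = ((B, \<not> j), \<not> oz)"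
    and lab: "R' \<notin> regions D" "R' \<noteq> 0" "L \<notin> regions D" "L \<noteq> 0" "L \<noteq> R'"
begin

sublocale pdiag D using val by (rule valid_pdiag)

abbreviation "yA \<equiv> ((A, \<not> i), oy)"
abbreviation "zB \<equiv> ((B, \<not> j), oz)"
abbreviation "xB \<equiv> ((B, j), \<not> ox)"
abbreviation "xA \<equiv> ((A, i), ox)"
abbreviation "xA' \<equiv> ((A, i), \<not> ox)"

text \<open>As in every R2 move the two crossings have opposite handedness; the values are those
  that produce the planar cyclic orders listed in \<open>rot1_new\<close>.\<close>

definition hand1 :: "nat \<Rightarrow> bool" where
  "hand1 = (hand D)(P := (k = (oy \<noteq> oz)), Q := (k \<noteq> (oy \<noteq> oz)))"

text \<open>The involution stub exchanges yA and zB with the outer darts at Q of their subdivided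
  edges.  Conjugating alpha by it is also right if yA and zB are the ends of one edge.\<close>

definition stub :: "dart \<Rightarrow> dart" where
  "stub d = (if d = yA then ((Q, k), oy) else if d = ((Q, k), oy) then yA
     else if d = zB then ((Q, \<not> k), oz) else if d = ((Q, \<not> k), oz) then zB else d)"

text \<open>From A the strand y runs through P to Q, and so does z from B. The two pieces of each
  are glued explicitly; only what lies beyond Q is inherited from \<open>D\<close>.\<close>

definition alpha1 :: "dart \<Rightarrow> dart" where
  "alpha1 d = (if d = yA then ((P, k), \<not> oy) else if d = ((P, k), \<not> oy) then yA
     else if d = ((P, k), oy) then ((Q, k), \<not> oy) else if d = ((Q, k), \<not> oy) then ((P, k), oy)
     else if d = zB then ((P, \<not> k), \<not> oz) else if d = ((P, \<not> k), \<not> oz) then zB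
     else if d = ((P, \<not> k), oz) then ((Q, \<not> k), \<not> oz)
     else if d = ((Q, \<not> k), \<not> oz) then ((P, \<not> k), oz)
     else stub (alpha D (stub d)))"

text \<open>The part of the cut region beyond Q keeps the old label, so that 0 survives even if the
  unbounded region is cut. Between P and Q each strand borders the region that lay behind the other
  one.\<close>

definition rho1 :: "dart \<Rightarrow> nat" where
  "rho1 d = (if d = xB \<or> d = yA \<or> d = ((P, \<not> k), \<not> oz) then R'
     else if d = ((P, \<not> k), oz) \<or> d = ((Q, k), \<not> oy) then L
     else if d = ((Q, k), oy) then rho D yA
     else if d = ((P, k), \<not> oy) \<or> d = ((Q, \<not> k), \<not> oz) then rho D xA'
     else if d = ((P, k), oy) \<or> d = ((Q, \<not> k), oz) then rho D zB
     else rho D d)"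

definition D1 :: diag where
  "D1 = mkd (insert P (insert Q (crs D))) (circs D) alpha1 hand1 rho1 (\<lambda>s. reg D (Circ (fst s), snd s))"

lemma D1_simps [simp]:
  "crs D1 = insert P (insert Q (crs D))" "circs D1 = circs D" "hand D1 = hand1"
  "reg D1 (Circ n, b) = reg D (Circ n, b)"
  by (simp_all add: D1_def)

lemma neq [simp]: "A \<noteq> P" "A \<noteq> Q" "B \<noteq> P" "B \<noteq> Q" "P \<noteq> A" "Q \<noteq> A" "P \<noteq> B" "Q \<noteq> B"
  "A \<noteq> B" "B \<noteq> A" "P \<noteq> Q" "Q \<noteq> P"
  using AB PQ by auto

lemma dart_mem [simp]: "((A, b), c) \<in> darts D" "((B, b), c) \<in> darts D"
  "((P, b), c) \<notin> darts D" "((Q, b), c) \<notin> darts D"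
  using AB PQ by (auto simp: dart_in)

lemma snd_alpha: "snd (alpha D d) = (\<not> snd d)"
  by (simp add: alpha_def)

lemma stub_simps:
  "stub yA = ((Q, k), oy)" "stub ((Q, k), oy) = yA"
  "stub zB = ((Q, \<not> k), oz)" "stub ((Q, \<not> k), oz) = zB"
  by (simp_all add: stub_def)

lemma stub_other: "d \<in> darts D \<Longrightarrow> d \<noteq> yA \<Longrightarrow> d \<noteq> zB \<Longrightarrow> stub d = d"
  using dart_mem(4) unfolding stub_def by metis

lemma stub_stub: "stub (stub d) = d"
  by (simp add: stub_def)

lemma snd_stub: "snd (stub d) = snd d"
  by (simp add: stub_def)

lemma rho1_simps:
  "rho1 xB = R'" "rho1 yA = R'" "rho1 ((P, \<not> k), \<not> oz) = R'"
  "rho1 ((P, \<not> k), oz) = L" "rho1 ((Q, k), \<not> oy) = L"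
  "rho1 ((Q, k), oy) = rho D yA"
  "rho1 ((P, k), \<not> oy) = rho D xA'" "rho1 ((Q, \<not> k), \<not> oz) = rho D xA'"
  "rho1 ((P, k), oy) = rho D zB" "rho1 ((Q, \<not> k), oz) = rho D zB"
  by (simp_all add: rho1_def)

lemma rho1_old: "d \<in> darts D \<Longrightarrow> d \<noteq> xB \<Longrightarrow> d \<noteq> yA \<Longrightarrow> rho1 d = rho D d"
proof -
  assume d: "d \<in> darts D" "d \<noteq> xB" "d \<noteq> yA"
  then have "d \<noteq> ((P, b), c)" "d \<noteq> ((Q, b), c)" for b c using dart_mem(3,4) by blast+
  then show ?thesis using d by (simp add: rho1_def)
qed

lemma alpha1_internal:
  "alpha1 yA = ((P, k), \<not> oy)" "alpha1 ((P, k), \<not> oy) = yA"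
  "alpha1 ((P, k), oy) = ((Q, k), \<not> oy)" "alpha1 ((Q, k), \<not> oy) = ((P, k), oy)"
  "alpha1 zB = ((P, \<not> k), \<not> oz)" "alpha1 ((P, \<not> k), \<not> oz) = zB"
  "alpha1 ((P, \<not> k), oz) = ((Q, \<not> k), \<not> oz)" "alpha1 ((Q, \<not> k), \<not> oz) = ((P, \<not> k), oz)"
  by (auto simp: alpha1_def)

definition internal :: "dart set" where
  "internal = {yA, ((P, k), \<not> oy), ((P, k), oy), ((Q, k), \<not> oy),
     zB, ((P, \<not> k), \<not> oz), ((P, \<not> k), oz), ((Q, \<not> k), \<not> oz)}"

lemma alpha1_external: "d \<notin> internal \<Longrightarrow> alpha1 d = stub (alpha D (stub d))"
  by (auto simp: alpha1_def internal_def)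

lemma darts1: "darts D1 = darts D \<union> {d. vtx d = P \<or> vtx d = Q}"
  by (auto simp: dart_in)

lemma darts1_split:
  assumes "d \<in> darts D1"
  obtains "d \<in> darts D" | "d = ((P, k), oy)" | "d = ((P, k), \<not> oy)"
    | "d = ((P, \<not> k), oz)" | "d = ((P, \<not> k), \<not> oz)"
    | "d = ((Q, k), oy)" | "d = ((Q, k), \<not> oy)"
    | "d = ((Q, \<not> k), oz)" | "d = ((Q, \<not> k), \<not> oz)"
proof -
  have "d = ((v, k), oy) \<or> d = ((v, k), \<not> oy) \<or> d = ((v, \<not> k), oz) \<or> d = ((v, \<not> k), \<not> oz)"
    if "vtx d = v" for v
    using that by (cases d; cases "fst d"; cases "snd (fst d) = k"; cases "snd d = oy"; cases "snd d = oz") simp_all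
  then show ?thesis using assms that unfolding darts1 by blast
qed

text \<open>Together with \<open>stub_old\<close> this identifies the darts of \<open>D\<close> with
  the external darts of \<open>D1\<close>. Case distinctions over \<open>D1\<close> thus reduce to
  eight internal darts and one generic \<open>stub e\<close>.\<close>

lemma stub_external:
  assumes "d \<in> darts D1" "d \<notin> internal"
  shows "stub d \<in> darts D"
proof -
  have "d \<in> darts D \<or> d = ((Q, k), oy) \<or> d = ((Q, \<not> k), oz)"
    using assms(1) by (cases rule: darts1_split) (use assms(2) in \<open>simp_all add: internal_def\<close>)
  then show ?thesis
  proof (elim disjE)
    assume "d \<in> darts D"
    moreover from this have "stub d = d"
      using assms(2) by (intro stub_other) (auto simp: internal_def)
    ultimately show ?thesis by simp
  qed (simp_all add: stub_simps)
qed

lemma stub_old: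
  assumes "d \<in> darts D"
  shows "stub d \<in> darts D1" "stub d \<notin> internal"
proof -
  consider "d = yA" | "d = zB" | "d \<noteq> yA" "d \<noteq> zB" by blast
  then have "stub d \<in> darts D1 \<and> stub d \<notin> internal"
  proof cases
    case 3
    then have "stub d = d" "d \<notin> internal"
      using assms stub_other dart_mem(3,4) unfolding internal_def by blast+
    then show ?thesis using assms by (simp add: darts1)
  qed (simp_all add: stub_simps internal_def darts1)
  then show "stub d \<in> darts D1" "stub d \<notin> internal" by blast+
qed

lemma alpha1_inv:
  assumes "d \<in> darts D1"
  shows "alpha1 d \<in> darts D1 \<and> alpha1 (alpha1 d) = d \<and> snd (alpha1 d) \<noteq> snd d"
proof (cases "d \<in> internal")
  case True
  then show ?thesis
    unfolding internal_def by (elim insertE emptyE) (simp_all add: alpha1_internal darts1)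
next
  case False
  have i: "stub d \<in> darts D" using stub_external[OF assms False] .
  then have "alpha D (stub d) \<in> darts D" by (rule alpha_in)
  then show ?thesis
    using stub_old[of "alpha D (stub d)"] i
    by (simp add: alpha1_external False stub_stub alpha_alpha snd_stub snd_alpha)
qed

lemma D1_facts:
  shows "pdiag D1" and "\<And>d. d \<in> darts D1 \<Longrightarrow> alpha D1 d = alpha1 d"
    and "\<And>d. d \<in> darts D1 \<Longrightarrow> rho D1 d = rho1 d"
proof -
  have a: "vtx (alpha1 d) \<in> insert P (insert Q (crs D)) \<and> alpha1 (alpha1 d) = d \<and> snd (alpha1 d) \<noteq> snd d"
    if "vtx d \<in> insert P (insert Q (crs D))" for d
    using alpha1_inv[of d] that by (simp add: dart_in)
  have f: "finite (insert P (insert Q (crs D)))" using fin by simp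
  note m = mkd_darts[OF f finc a, where h = hand1 and r = rho1 and q = "\<lambda>s. reg D (Circ (fst s), snd s)",
      folded D1_def]
  show "pdiag D1" using m(1) by blast
  show "alpha D1 d = alpha1 d" if "d \<in> darts D1" for d using m(2)[of d] that by (simp add: dart_in)
  show "rho D1 d = rho1 d" if "d \<in> darts D1" for d using m(3)[of d] that by (simp add: dart_in)
qed

sublocale n: pdiag D1 by (rule D1_facts)

lemma rot_old:
  "crot (hand D) xA = yA" "crot (hand D) yA = xA'" "crot (hand D) zB = xB"
  using rot_A rot_B by (auto simp: crot_def)

lemma rot1_old: "d \<in> darts D \<Longrightarrow> crot hand1 d = crot (hand D) d"
  using PQ by (auto simp: crot_def hand1_def dart_in)

lemma rot1_new:
  "crot hand1 ((P, k), \<not> oy) = ((P, \<not> k), \<not> oz)" "crot hand1 ((P, \<not> k), \<not> oz) = ((P, k), oy)"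
  "crot hand1 ((P, k), oy) = ((P, \<not> k), oz)" "crot hand1 ((P, \<not> k), oz) = ((P, k), \<not> oy)"
  "crot hand1 ((Q, \<not> k), \<not> oz) = ((Q, k), \<not> oy)" "crot hand1 ((Q, k), \<not> oy) = ((Q, \<not> k), oz)"
  "crot hand1 ((Q, \<not> k), oz) = ((Q, k), oy)" "crot hand1 ((Q, k), oy) = ((Q, \<not> k), \<not> oz)"
  by (auto simp: crot_def hand1_def)

lemma phi_x: "phi D xB = yA"
  using alpha_alpha[of xA] rot_old by (simp add: phi_def alpha_x)

lemma phi1_new:
  "phi D1 xB = yA" "phi D1 yA = ((P, \<not> k), \<not> oz)" "phi D1 ((P, \<not> k), \<not> oz) = xB"
  "phi D1 ((P, \<not> k), oz) = ((Q, k), \<not> oy)" "phi D1 ((Q, k), \<not> oy) = ((P, \<not> k), oz)"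
  "phi D1 ((Q, \<not> k), \<not> oz) = ((P, k), \<not> oy)" "phi D1 ((P, k), \<not> oy) = xA'"
  "phi D1 zB = ((P, k), oy)" "phi D1 ((P, k), oy) = ((Q, \<not> k), oz)"
proof -
  have "alpha1 xB = xA"
    using alpha_alpha[of xA] by (simp add: alpha1_def stub_def alpha_x)
  then show "phi D1 xB = yA"
    by (simp add: phi_def D1_facts darts1 rot1_old rot_old)
qed (simp_all add: phi_def D1_facts darts1 alpha1_internal rot1_old rot_old rot1_new)

text \<open>A face that arrives from outside along y or z now turns at Q, where it used to turn at A
  or B; all other turns are as in \<open>D\<close>.\<close>

lemma phi1_stub:
  assumes d: "d \<in> darts D"
  shows "phi D1 (stub d) = (if alpha D d = yA then ((Q, \<not> k), \<not> oz)
    else if alpha D d = zB then ((Q, k), oy) else phi D d)"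
proof -
  have "phi D1 (stub d) = crot hand1 (stub (alpha D d))"
    using stub_old[OF d] by (simp add: phi_def D1_facts alpha1_external stub_stub)
  moreover have "stub (alpha D d) = (if alpha D d = yA then ((Q, k), oy)
      else if alpha D d = zB then ((Q, \<not> k), oz) else alpha D d)"
    using alpha_in[OF d] stub_other by (simp add: stub_simps)
  ultimately show ?thesis
    using rot1_old[OF alpha_in[OF d]] by (auto simp: rot1_new phi_def)
qed

lemma dreg_D: "dreg D" using val valid_iff by blast

lemma rho_phi: "d \<in> darts D \<Longrightarrow> rho D (phi D d) = rho D d"
  using dreg_D by (simp add: dreg_def)

lemma rho_alpha: "d \<in> darts D \<Longrightarrow> rho D (alpha D d) = rho D (crot (hand D) d)"
  by (metis alpha_alpha alpha_in phi_def rho_phi)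

lemma rho_xB: "rho D xB = rho D yA"
  using rho_phi[of xB] phi_x by simp

lemma rho1_stub: "d \<in> darts D \<Longrightarrow> d \<noteq> xB \<Longrightarrow> rho1 (stub d) = rho D d"
  by (cases "d = yA"; cases "d = zB") (simp_all add: stub_simps stub_other rho1_simps rho1_old)

lemma darts1_cases:
  assumes "d \<in> darts D1"
  obtains "d \<in> internal" | e where "e \<in> darts D" "d = stub e"
  using assms stub_external stub_stub by metis

lemma dreg_D1: "dreg D1"
  unfolding dreg_def
proof
  fix d assume d: "d \<in> darts D1"
  have "rho1 (phi D1 d) = rho1 d"
    using d
  proof (cases rule: darts1_cases)
    case 1
    then show ?thesis
      unfolding internal_def by (elim insertE emptyE) (simp_all add: phi1_new rho1_simps rho1_old)
  next
    case (2 e)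
    show ?thesis
    proof (cases "e = xB")
      case True
      then have "d = xB" using 2 by (simp add: stub_def)
      then show ?thesis by (simp add: phi1_new rho1_simps)
    next
      case False
      then have r: "rho1 d = rho D e" using rho1_stub 2 by simp
      consider "alpha D e = yA" | "alpha D e = zB" | "alpha D e \<noteq> yA" "alpha D e \<noteq> zB" by blast
      then show ?thesis
      proof cases
        case 1
        then have "rho D e = rho D xA'" using rho_phi[OF 2(1)] by (simp add: phi_def rot_old)
        then show ?thesis using 1 2 r by (simp add: phi1_stub rho1_simps)
      next
        case 22: 2
        then have "rho D e = rho D xB" using rho_phi[OF 2(1)] by (simp add: phi_def rot_old)
        then show ?thesis using 22 2 r by (simp add: phi1_stub rho_xB rho1_simps)
      next
        case 3
        then have "phi D1 d = phi D e" using 2 by (simp add: phi1_stub)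
        moreover have "phi D e \<noteq> xB"
          using 3 rot_old(3) injD[OF inj_crot[of "hand D"], of _ zB] by (metis phi_def)
        moreover have "phi D e \<noteq> yA"
          using inj_phi phi_x False 2(1) by (metis dart_mem(2) inj_onD)
        moreover have "phi D e \<in> darts D" using phi_in 2 by blast
        ultimately have "rho1 (phi D1 d) = rho D (phi D e)" by (simp add: rho1_old)
        then show ?thesis using r rho_phi 2 by simp
      qed
    qed
  qed
  then show "rho D1 (phi D1 d) = rho D1 d"
    using d n.phi_in by (simp add: D1_facts)
qed

lemma rho_in_regions: "d \<in> darts D \<Longrightarrow> rho D d \<in> regions D"
  by (auto simp: regions_eq)

lemma regions_D1: "regions D1 = insert R' (insert L (regions D))"
proof -
  have "rho D1 ` darts D1 = rho1 ` darts D1" by (simp add: D1_facts cong: image_cong)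
  also have "\<dots> = insert R' (insert L (rho D ` darts D))"
  proof
    show "rho1 ` darts D1 \<subseteq> insert R' (insert L (rho D ` darts D))"
    proof
      fix r assume "r \<in> rho1 ` darts D1"
      then obtain d where d: "d \<in> darts D1" "r = rho1 d" by blast
      then show "r \<in> insert R' (insert L (rho D ` darts D))"
      proof (cases rule: darts1_cases)
        case 1
        then show ?thesis
          unfolding internal_def d(2) by (elim insertE emptyE) (simp_all add: rho1_simps rho1_old)
      next
        case (2 e)
        then have "e = xB \<Longrightarrow> d = xB" using stub_other[of xB] by simp
        then show ?thesis using 2 d(2) rho1_stub[of e] rho1_simps(1) by blast
      qed
    qed
    have "yA \<in> darts D1" "((Q, k), \<not> oy) \<in> darts D1" by (simp_all add: darts1)
    then have "R' \<in> rho1 ` darts D1" "L \<in> rho1 ` darts D1"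
      using rho1_simps(2,5) by (metis imageI)+
    moreover have "rho D d \<in> rho1 ` darts D1" if d: "d \<in> darts D" for d
    proof (cases "d = xB")
      case True
      then show ?thesis using rho_xB rho1_stub[of yA] stub_old[of yA] by (metis dart_mem(1) image_eqI neq(9) prod.inject)
    next
      case False
      then show ?thesis using rho1_stub[of d] stub_old[of d] d by (metis image_eqI)
    qed
    ultimately show "insert R' (insert L (rho D ` darts D)) \<subseteq> rho1 ` darts D1" by blast
  qed
  finally have "rho D1 ` darts D1 = insert R' (insert L (rho D ` darts D))" .
  moreover have "reg D1 ` (Circ ` circs D1 \<times> UNIV) = reg D ` (Circ ` circs D \<times> UNIV)"
    by (rule image_cong) auto
  ultimately show ?thesis unfolding regions_eq n.regions_eq by simp
qed

text \<open>The two additional cycles are the triangle ABP and the bigon PQ. The remaining ones are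
  matched with those of \<open>D\<close> through a common first-return map.\<close>

lemma card_orbs_D1: "card (orb (phi D1) ` darts D1) = card (orb (phi D) ` darts D) + 2"
proof -
  \<comment> \<open>In \<open>D1\<close> both \<open>xB\<close> and \<open>yA\<close> lie on the new
    triangle. The cut face passed through them consecutively, so it suffices to bypass
    \<open>xB\<close> and to let the outer dart of y at Q stand for \<open>yA\<close>; the latter is
    done by \<open>?j\<close>.\<close>
  define G where "G = darts D - {xB}"
  define g where "g d = (if phi D d = xB then yA else phi D d)" for d
  define Z where "Z = {xB, yA, ((P, \<not> k), \<not> oz), ((P, \<not> k), oz), ((Q, k), \<not> oy)}"
  let ?j = "\<lambda>d. if d = yA then ((Q, k), oy) else d"
  have gG: "g d \<in> G" if "d \<in> G" for d using that by (auto simp: g_def G_def phi_in)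
  have phi_im: "phi D ` darts D \<subseteq> darts D" "phi D1 ` darts D1 \<subseteq> darts D1" 
    using phi_in n.phi_in by blast+
  have old: "card (orb (phi D) ` darts D) = card (orb g ` G) + card (orb (phi D) ` ({} :: dart set))"
  proof (rule card_orbs_return[where j = "\<lambda>d. d", OF fin_darts inj_phi phi_im(1)])
    fix d assume d: "d \<in> G"
    have "hit (phi D) G d (g d)"
    proof (cases "phi D d = xB")
      case True
      have "hit (phi D) G xB yA" by (rule hit_here) (auto simp: phi_x G_def)
      from hit_step[OF this True] show ?thesis using True by (simp add: g_def G_def)
    next
      case False
      then show ?thesis using gG[OF d] by (auto simp: g_def intro: hit_here)
    qed
    then show "g d \<in> G \<and> hit (phi D) ((\<lambda>d. d) ` G) d (g d)" using gG d by simp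
  next
    fix x assume x: "x \<in> darts D"
    have "yA \<in> orb (phi D) xB" unfolding orb_def by (rule image_eqI[of _ _ 1]) (simp_all add: phi_x)
    then show "x \<in> {} \<or> orb (phi D) x \<inter> (\<lambda>d. d) ` G \<noteq> {}"
      using x orb_refl[of x] by (cases "x = xB") (auto simp: G_def)
  qed (auto simp: G_def)
  have jG: "?j ` G = insert ((Q, k), oy) (G - {yA})" by (auto simp: G_def)
  define H where "H = ?j ` G"
  have jG: "x \<in> H \<longleftrightarrow> x = ((Q, k), oy) \<or> x \<in> G \<and> x \<noteq> yA" for x
    unfolding H_def jG by blast
  have exit: "hit (phi D1) H (stub d) (?j (g d))" if d: "d \<in> darts D" "d \<noteq> xB" for d
  proof -
    consider "alpha D d = yA" | "alpha D d = zB" | "alpha D d \<noteq> yA" "alpha D d \<noteq> zB" by blast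
    then show ?thesis
    proof cases
      case 1
      then have g: "?j (g d) = xA'" by (auto simp: g_def phi_def rot_old)
      have "hit (phi D1) H ((P, k), \<not> oy) xA'"
        by (rule hit_here) (simp_all add: phi1_new jG G_def)
      then have "hit (phi D1) H ((Q, \<not> k), \<not> oz) xA'"
        by (rule hit_step) (simp_all add: phi1_new jG G_def)
      then show ?thesis unfolding g
        by (rule hit_step) (simp_all add: 1 d phi1_stub jG G_def)
    next
      case 2
      then have "?j (g d) = ((Q, k), oy)" by (simp add: g_def phi_def rot_old)
      then show ?thesis using 2 d by (intro hit_here) (simp_all add: phi1_stub jG)
    next
      case 3
      then have "phi D d \<noteq> xB"
        using rot_old(3) injD[OF inj_crot[of "hand D"], of _ zB] by (metis phi_def)
      moreover have "phi D d \<noteq> yA"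
        using inj_phi phi_x d by (metis dart_mem(2) inj_onD)
      ultimately show ?thesis
        using 3 d phi_in[of d] by (intro hit_here) (simp_all add: g_def phi1_stub jG G_def)
    qed
  qed
  have zB: "hit (phi D1) H ((P, k), oy) (?j (g zB))"
    by (rule hit_step[OF exit[of zB]]) (simp_all add: phi1_new stub_simps jG G_def)
  have "card (orb (phi D1) ` darts D1) = card (orb g ` G) + card (orb (phi D1) ` Z)"
  proof (rule card_orbs_return[where j = ?j and G = G, OF n.fin_darts n.inj_phi phi_im(2), folded H_def])
    show "H \<subseteq> darts D1" by (auto simp: jG G_def darts1)
    show "inj_on ?j G" by (auto simp: inj_on_def G_def)
    show "g d \<in> G \<and> hit (phi D1) H (?j d) (?j (g d))" if d: "d \<in> G" for d
    proof (cases "d = zB")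
      case True
      have "hit (phi D1) H zB (?j (g zB))"
        using zB by (rule hit_step) (simp_all add: phi1_new jG G_def)
      then show ?thesis using True gG[OF d] by (auto split: if_splits)
    next
      case False
      then have "stub d = ?j d" using d stub_other[of d] by (simp add: stub_simps G_def)
      then show ?thesis using exit[of d] d gG[OF d] by (simp add: G_def)
    qed
    show "Z \<subseteq> darts D1" by (auto simp: Z_def darts1)
    show "phi D1 ` Z \<subseteq> Z" by (simp add: Z_def phi1_new)
    show "Z \<inter> H = {}" by (auto simp: Z_def jG G_def)
    fix x assume "x \<in> darts D1"
    then consider "x \<in> Z" | "x \<in> H" | "x = ((Q, \<not> k), \<not> oz)" | "x = ((P, k), \<not> oy)"
      | "x = ((P, k), oy)" | "x = ((Q, \<not> k), oz)"
    proof (cases rule: darts1_split)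
      case 1
      then have "x \<in> Z \<or> x \<in> H" by (auto simp only: Z_def jG G_def insert_iff Diff_iff empty_iff)
      then show ?thesis using that by blast
    qed (use that in \<open>simp_all add: Z_def jG\<close>)
    then show "x \<in> Z \<or> orb (phi D1) x \<inter> H \<noteq> {}"
    proof cases
      case 2 then show ?thesis using orb_refl by fast
    next
      case 3
      have "hit (phi D1) H ((P, k), \<not> oy) xA'"
        by (rule hit_here) (simp_all add: phi1_new jG G_def)
      then have "hit (phi D1) H x xA'"
        unfolding 3 by (rule hit_step) (simp_all add: phi1_new jG G_def)
      then show ?thesis using hit_orb hit_in by fast
    next
      case 4
      have "hit (phi D1) H x xA'"
        unfolding 4 by (rule hit_here) (simp_all add: phi1_new jG G_def)
      then show ?thesis using hit_orb hit_in by fast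
    next
      case 5
      then show ?thesis using hit_orb[OF zB] hit_in[OF zB] by fast
    next
      case 6
      then have "x = stub zB" by (simp add: stub_simps)
      then show ?thesis using exit[of zB] hit_orb hit_in by fastforce
    qed simp
  qed
  moreover have "orb (phi D1) ` Z = {{xB, yA, ((P, \<not> k), \<not> oz)}, {((P, \<not> k), oz), ((Q, k), \<not> oy)}}"
  proof -
    have rotate: "{b, c, a} = {a, b, c}" "{c, a, b} = {a, b, c}" "{b, a} = {a, b}" for a b c :: dart
      by blast+
    show ?thesis
      unfolding Z_def image_insert image_empty
        orb_3[OF phi1_new(1-3)]
        orb_3[OF phi1_new(2,3,1), unfolded rotate(1)[where a = xB]]
        orb_3[OF phi1_new(3,1,2), unfolded rotate(2)[where a = xB]]
        orb_2[OF phi1_new(4,5)]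
        orb_2[OF phi1_new(5,4), unfolded rotate(3)[where a = "((P, \<not> k), oz)"]]
      by simp
  qed
  moreover have "{xB, yA, ((P, \<not> k), \<not> oz)} \<noteq> {((P, \<not> k), oz), ((Q, k), \<not> oy)}"
  proof -
    have "xB \<notin> {((P, \<not> k), oz), ((Q, k), \<not> oy)}" by simp
    then show ?thesis by (rule contrapos_nn) (erule subst, rule insertI1)
  qed
  then have "card {{xB, yA, ((P, \<not> k), \<not> oz)}, {((P, \<not> k), oz), ((Q, k), \<not> oy)}} = 2"
    by (rule card_2_iff[THEN iffD2, OF exI, OF exI, OF conjI[OF refl]])
  ultimately have "card (orb (phi D1) ` darts D1) = card (orb g ` G) + 2" by (simp only:)
  then show ?thesis using old by simp
qed

lemma valid_D1: "valid D1"
proof -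
  have ne: "regions D \<noteq> {}" using rho_in_regions[of xB] by auto
  then have v: "0 \<in> regions D" "echar D = 2" "dconn D" using val valid_iff by auto
  \<comment> \<open>Two more regions, crossings and face cycles change the characteristic by 2 * 2 -
    2 - 2 = 0.\<close>
  have "echar D1 = 2"
  proof -
    have "card (regions D1) = card (regions D) + 2"
      using lab fin_regions by (simp add: regions_D1)
    moreover have "card (crs D1) = card (crs D) + 2" using PQ fin by simp
    ultimately show ?thesis using v(2) by (simp add: echar_def card_orbs_D1)
  qed
  moreover have "dconn D1"
    unfolding dconn_def
  proof (rule allI impI)+
    fix V K W :: "nat \<Rightarrow> bool"
    assume V: "\<forall>d\<in>darts D1. V (vtx d) = W (rho D1 d)"
      and K: "\<forall>m\<in>circs D1. \<forall>b. K m = W (reg D1 (Circ m, b))"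
    have V1: "V (vtx d) = W (rho1 d)" if "d \<in> darts D1" for d using V that by (simp add: D1_facts)
    \<comment> \<open>The bigon ties P to Q, the triangle ties P to A and B, and Q borders the rest
      of the cut region. So the colour of that region is again that of A and B, which restores the
      conditions at \<open>xB\<close> and \<open>yA\<close>, the only old darts that were
      relabelled.\<close>
    have l: "W L = V P" "W L = V Q" "W R' = V P" "W R' = V A" "W R' = V B" "W (rho D yA) = V Q"
      using V1[of "((P, \<not> k), oz)"] V1[of "((Q, k), \<not> oy)"] V1[of "((P, \<not> k), \<not> oz)"]
        V1[of yA] V1[of xB] V1[of "((Q, k), oy)"] by (simp_all add: darts1 rho1_simps)
    have "V (vtx d) = W (rho D d)" if d: "d \<in> darts D" for d
    proof -
      consider "d = xB" | "d = yA" | "d \<noteq> xB" "d \<noteq> yA" by blast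
      then show ?thesis
      proof cases
        case 3
        then have "rho1 d = rho D d" using d by (simp add: rho1_old)
        then show ?thesis using V1[of d] d by (simp add: darts1)
      qed (use l in \<open>simp_all add: rho_xB\<close>)
    qed
    then have "\<forall>r\<in>regions D. \<forall>r'\<in>regions D. W r = W r'"
      using v(3) K unfolding dconn_def D1_simps by blast
    moreover have "W L = W (rho D yA)" "W R' = W (rho D yA)" "rho D yA \<in> regions D"
      using l rho_in_regions by auto
    ultimately show "\<forall>r\<in>regions D1. \<forall>r'\<in>regions D1. W r = W r'"
      unfolding regions_D1 by blast
  qed
  ultimately show ?thesis using dreg_D1 v(1) by (simp add: n.valid_iff regions_D1)
qed

end

section \<open>The R2 construction satisfies \<open>r2\<close>\<close>

text \<open>The \<open>LEAST\<close> in \<open>skip\<close> is the time of the first return to the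
  complement of \<open>N\<close>.\<close>

lemma skip_hit:
  assumes "hit f (- N) p r" shows "skip f N p = r"
proof -
  obtain n where n: "(f ^^ Suc n) p = r" "r \<notin> N" "\<And>i. i < n \<Longrightarrow> (f ^^ Suc i) p \<in> N"
    using assms unfolding hit_def by auto
  have "(LEAST m. 0 < m \<and> (f ^^ m) p \<notin> N) = Suc n"
  proof (rule Least_equality)
    show "0 < Suc n \<and> (f ^^ Suc n) p \<notin> N" using n by simp
    show "Suc n \<le> m" if "0 < m \<and> (f ^^ m) p \<notin> N" for m
      using that n(3)[of "m - 1"] by (cases m) (simp_all, meson not_less)
  qed
  then show ?thesis using n(1) by (simp add: skip_def)
qed

context corner begin

lemma rho1_fresh:
  assumes "d \<in> darts D1"
  shows "rho1 d = L \<longleftrightarrow> d = ((P, \<not> k), oz) \<or> d = ((Q, k), \<not> oy)" (is ?L)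
    and "rho1 d = R' \<longleftrightarrow> d = xB \<or> d = yA \<or> d = ((P, \<not> k), \<not> oz)" (is ?R)
proof -
  have old: "rho D e \<noteq> L" "rho D e \<noteq> R'" if "e \<in> darts D" for e
    using lab rho_in_regions[OF that] by auto
  note old' = old[of yA] old[of xA'] old[of zB]
  have "?L \<and> ?R"
    using assms
  proof (cases rule: darts1_split)
    case 1
    then have ne: "d \<noteq> ((P, b), c)" "d \<noteq> ((Q, b), c)" for b c using dart_mem(3,4) by blast+
    consider "d = xB" | "d = yA" | "d \<noteq> xB" "d \<noteq> yA" by blast
    then show ?thesis
      by cases (use lab old[OF 1] ne 1 in \<open>simp_all add: rho1_simps rho1_old\<close>)
  qed (use lab old' in \<open>simp_all add: rho1_simps\<close>)
  then show ?L ?R by blast+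
qed

text \<open>The edge of D that contains the edge of D1 at the dart d.\<close>

definition home :: "dart \<Rightarrow> eid" where
  "home d = (if vtx d = P \<or> vtx d = Q then fst (sd D (if snd (fst d) = k then yA else zB))
     else fst (sd D d))"

lemma home_new:
  "home ((P, k), c) = fst (sd D yA)" "home ((Q, k), c) = fst (sd D yA)"
  "home ((P, \<not> k), c) = fst (sd D zB)" "home ((Q, \<not> k), c) = fst (sd D zB)"
  by (simp_all add: home_def)

lemma home_old: "d \<in> darts D \<Longrightarrow> home d = fst (sd D d)"
  using PQ by (auto simp: home_def dart_in)

lemma home_stub: "d \<in> darts D \<Longrightarrow> home (stub d) = fst (sd D d)"
  by (cases "d = yA"; cases "d = zB") (simp_all add: stub_simps stub_other home_new home_old)

lemma home_alpha1:
  assumes "d \<in> darts D1" shows "home (alpha1 d) = home d"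
  using assms
proof (cases rule: darts1_cases)
  case 1
  then show ?thesis
    unfolding internal_def by (elim insertE emptyE) (simp_all add: alpha1_internal home_new home_old)
next
  case (2 e)
  then show ?thesis
    using stub_old[OF 2(1)] alpha_in[OF 2(1)]
    by (simp add: alpha1_external stub_stub home_stub fst_sd_alpha)
qed

lemma alpha1_psucc: "d \<in> darts D1 \<Longrightarrow> snd d \<Longrightarrow> psucc D1 (fst d) = fst (alpha1 d)"
  by (metis D1_facts(2) alpha_def fst_conv)

lemma alpha1_ppred: "d \<in> darts D1 \<Longrightarrow> \<not> snd d \<Longrightarrow> ppred D1 (fst d) = fst (alpha1 d)"
  by (metis D1_facts(2) alpha_def fst_conv)

lemma alpha1_out: "alpha1 ((Q, k), oy) = stub (alpha D yA)" "alpha1 ((Q, \<not> k), oz) = stub (alpha D zB)"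
  using stub_old[of yA] stub_old[of zB] by (simp_all add: alpha1_external stub_simps)

lemma dart1_mem:
  "((P, b), c) \<in> darts D1" "((Q, b), c) \<in> darts D1" "((A, b), c) \<in> darts D1" "((B, b), c) \<in> darts D1"
  by (simp_all add: darts1)

lemmas psucc1_y =
  alpha1_psucc[OF dart1_mem(2)[of k oy], unfolded alpha1_out fst_conv snd_conv]
  alpha1_psucc[OF dart1_mem(1)[of k oy], unfolded alpha1_internal fst_conv snd_conv]
  alpha1_psucc[OF dart1_mem(3)[of "\<not> i" oy], unfolded alpha1_internal fst_conv snd_conv]
  alpha1_psucc[OF dart1_mem(1)[of k "\<not> oy"], unfolded alpha1_internal fst_conv snd_conv]
  alpha1_psucc[OF dart1_mem(2)[of k "\<not> oy"], unfolded alpha1_internal fst_conv snd_conv]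

lemmas psucc1_z =
  alpha1_psucc[OF dart1_mem(2)[of "\<not> k" oz], unfolded alpha1_out fst_conv snd_conv]
  alpha1_psucc[OF dart1_mem(1)[of "\<not> k" oz], unfolded alpha1_internal fst_conv snd_conv]
  alpha1_psucc[OF dart1_mem(4)[of "\<not> j" oz], unfolded alpha1_internal fst_conv snd_conv]
  alpha1_psucc[OF dart1_mem(1)[of "\<not> k" "\<not> oz"], unfolded alpha1_internal fst_conv snd_conv]
  alpha1_psucc[OF dart1_mem(2)[of "\<not> k" "\<not> oz"], unfolded alpha1_internal fst_conv snd_conv]

lemma orb_alpha1:
  assumes "d \<in> darts D1"
  shows "orb (psucc D1) (fst (alpha1 d)) = orb (psucc D1) (fst d)"
proof -
  have o: "orb (psucc D1) (psucc D1 p) = orb (psucc D1) p" if "p \<in> passages D1" for p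
  proof (rule orb_eq[OF n.fin_passages _ _ that])
    show "inj_on (psucc D1) (passages D1)" "psucc D1 ` passages D1 \<subseteq> passages D1"
      using n.bij by (auto simp: bij_betw_def)
    show "psucc D1 p \<in> orb (psucc D1) p" unfolding orb_def by (rule image_eqI[of _ _ 1]) simp_all
  qed
  have p: "fst d \<in> passages D1" using assms by (cases d) (simp add: darts_def)
  show ?thesis
  proof (cases "snd d")
    case True
    then show ?thesis using o[OF p] alpha1_psucc[OF assms] by simp
  next
    case False
    then show ?thesis
      using o[OF n.ppred_in[OF p]] n.psucc_ppred[OF p] alpha1_ppred[OF assms] by simp
  qed
qed

abbreviation "N \<equiv> {P, Q} \<times> (UNIV :: bool set)"

text \<open>If y is oriented towards A, the strand runs from Q through P to A; likewise z towards
  B.\<close>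

lemma exit_in:
  shows "\<not> oy \<Longrightarrow> hit (psucc D1) (- N) (P, k) (A, \<not> i)"
    and "\<not> oy \<Longrightarrow> hit (psucc D1) (- N) (Q, k) (A, \<not> i)"
    and "\<not> oz \<Longrightarrow> hit (psucc D1) (- N) (P, \<not> k) (B, \<not> j)"
    and "\<not> oz \<Longrightarrow> hit (psucc D1) (- N) (Q, \<not> k) (B, \<not> j)"
proof -
  have m: "(A, \<not> i) \<in> - N" "(B, \<not> j) \<in> - N" "(P, b) \<notin> - N" for b by auto
  show 1: "hit (psucc D1) (- N) (P, k) (A, \<not> i)" if "\<not> oy"
    by (rule hit_here[where f = "psucc D1" and X = "- N", OF psucc1_y(4)[OF that] m(1)])
  show "hit (psucc D1) (- N) (Q, k) (A, \<not> i)" if "\<not> oy"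
    by (rule hit_step[OF 1[OF that] psucc1_y(5)[OF that] m(3)])
  show 2: "hit (psucc D1) (- N) (P, \<not> k) (B, \<not> j)" if "\<not> oz"
    by (rule hit_here[where f = "psucc D1" and X = "- N", OF psucc1_z(4)[OF that] m(2)])
  show "hit (psucc D1) (- N) (Q, \<not> k) (B, \<not> j)" if "\<not> oz"
    by (rule hit_step[OF 2[OF that] psucc1_z(5)[OF that] m(3)])
qed

text \<open>An old edge that ends in one of the subdivided ones enters at Q and leaves the new
  crossings at A or B. The successor \<open>q\<close> may itself be a new passage, which covers the
  case that \<open>yA\<close> and \<open>zB\<close> are the two ends of a single edge.\<close>

lemma exit_old:
  assumes d: "d \<in> darts D" "snd d" and q: "psucc D1 q = fst (stub (alpha D d))"
  shows "hit (psucc D1) (- N) q (fst (alpha D d))"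
proof -
  have a: "alpha D d \<in> darts D" "\<not> snd (alpha D d)" using d by (simp_all add: alpha_in snd_alpha)
  consider "alpha D d = yA" | "alpha D d = zB" | "alpha D d \<noteq> yA" "alpha D d \<noteq> zB" by blast
  then show ?thesis
  proof cases
    case 1
    have o: "\<not> oy" using a(2) unfolding 1 by simp
    have "psucc D1 q = (Q, k)" using q unfolding 1 stub_simps by simp
    then show ?thesis unfolding 1 fst_conv by (rule hit_step[OF exit_in(2)[OF o]]) simp
  next
    case 2
    have o: "\<not> oz" using a(2) unfolding 2 by simp
    have "psucc D1 q = (Q, \<not> k)" using q unfolding 2 stub_simps by simp
    then show ?thesis unfolding 2 fst_conv by (rule hit_step[OF exit_in(4)[OF o]]) simp
  next
    case 3
    then have "psucc D1 q = fst (alpha D d)" using q stub_other[OF a(1)] by simp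
    moreover have "fst (alpha D d) \<notin> N"
      using a(1) PQ by (cases "alpha D d"; cases "fst (alpha D d)") (auto simp: dart_in)
    ultimately show ?thesis by (intro hit_here) (simp_all only: Compl_iff not_False_eq_True)
  qed
qed

lemma exit_out:
  shows "oy \<Longrightarrow> hit (psucc D1) (- N) (Q, k) (fst (alpha D yA))"
    and "oy \<Longrightarrow> hit (psucc D1) (- N) (P, k) (fst (alpha D yA))"
    and "oz \<Longrightarrow> hit (psucc D1) (- N) (Q, \<not> k) (fst (alpha D zB))"
    and "oz \<Longrightarrow> hit (psucc D1) (- N) (P, \<not> k) (fst (alpha D zB))"
proof -
  have m: "(Q, b) \<notin> - N" for b by auto
  show 1: "hit (psucc D1) (- N) (Q, k) (fst (alpha D yA))" if oy
    by (rule exit_old[OF dart_mem(1) _ psucc1_y(1)[OF that]]) (simp only: snd_conv that)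
  show "hit (psucc D1) (- N) (P, k) (fst (alpha D yA))" if oy
    by (rule hit_step[OF 1[OF that] psucc1_y(2)[OF that] m])
  show 2: "hit (psucc D1) (- N) (Q, \<not> k) (fst (alpha D zB))" if oz
    by (rule exit_old[OF dart_mem(2) _ psucc1_z(1)[OF that]]) (simp only: snd_conv that)
  show "hit (psucc D1) (- N) (P, \<not> k) (fst (alpha D zB))" if oz
    by (rule hit_step[OF 2[OF that] psucc1_z(2)[OF that] m])
qed

text \<open>Only edges between old crossings are subdivided, so no component consists of new
  passages alone; this settles the clause of \<open>r2\<close> about consumed circles.\<close>

lemma exit_N: "x \<in> N \<Longrightarrow> \<exists>n. (psucc D1 ^^ n) x \<notin> N"
proof -
  assume "x \<in> N"
  then consider "x = (P, k)" | "x = (Q, k)" | "x = (P, \<not> k)" | "x = (Q, \<not> k)"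
    by (cases x) auto
  then have "\<exists>r. hit (psucc D1) (- N) x r"
    by cases (use exit_in exit_out in blast)+
  then show ?thesis unfolding hit_def by blast
qed

lemma skip_N:
  assumes p: "p \<in> passages D"
  shows "skip (psucc D1) N p = psucc D p"
proof (rule skip_hit)
  let ?d = "(p, True)"
  have d: "?d \<in> darts D" using p by (simp add: darts_def)
  have ps: "psucc D p = fst (alpha D ?d)" by (simp add: alpha_def)
  consider "?d = yA" | "?d = zB" | "?d \<noteq> yA" "?d \<noteq> zB" by blast
  then show "hit (psucc D1) (- N) p (psucc D p)"
  proof cases
    case 1
    then have oy: oy and p: "p = (A, \<not> i)" by auto
    show ?thesis
      unfolding ps 1 unfolding p
      by (rule hit_step[OF exit_out(2)[OF oy] psucc1_y(3)[OF oy]]) simp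
  next
    case 2
    then have oz: oz and p: "p = (B, \<not> j)" by auto
    show ?thesis
      unfolding ps 2 unfolding p
      by (rule hit_step[OF exit_out(4)[OF oz] psucc1_z(3)[OF oz]]) simp
  next
    case 3
    then have "stub ?d = ?d" using stub_other[OF d] by simp
    then have "psucc D1 p = fst (stub (alpha D ?d))"
      using stub_old[OF d] alpha1_psucc[of ?d] by (simp add: alpha1_external)
    then show ?thesis using exit_old[OF d] ps by simp
  qed
qed

lemma r2_D1: "r2 D D1"
proof -
  \<comment> \<open>The over strand is y if \<open>k\<close> holds and z otherwise, and
    \<open>?f\<close> says whether it meets P before Q. The under strand runs in the same direction
    exactly if \<open>oy = oz\<close>.\<close>
  let ?f = "if k then oy else oz"
  define c1 where "c1 = (if ?f then P else Q)"
  define c2 where "c2 = (if ?f then Q else P)"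
  define oB where "oB \<longleftrightarrow> oy = oz"
  \<comment> \<open>The two darts of the bigon: \<open>dA\<close> on the over strand,
    \<open>dB\<close> on the under strand.\<close>
  define dA where "dA = (if k then ((Q, k), \<not> oy) else ((P, \<not> k), oz))"
  define dB where "dB = (if k then ((P, \<not> k), oz) else ((Q, k), \<not> oy))"
  define eA where "eA = Pas (c1, True)"
  define eB where "eB = Pas (if oB then (c1, False) else (c2, False))"
  \<comment> \<open>An edge carries the name of the passage at which it starts, hence the leaving
    dart.\<close>
  define par where "par e = (case e of Pas x \<Rightarrow> home (x, True) | Circ m \<Rightarrow> Circ m)" for e
  have N: "{c1, c2} \<times> (UNIV :: bool set) = N" by (auto simp: c1_def c2_def)
  note ps = psucc1_y(2) and ps' = psucc1_y(5) and pz = psucc1_z(2) and pz' = psucc1_z(5)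
  have inN: "(P, c) \<in> passages D1" "(Q, c) \<in> passages D1" for c by (simp_all add: passages_def)
  have pp: "ppred D1 (Q, k) = (P, k)" if oy using n.ppred_psucc[OF inN(1)] ps[OF that] by metis
  have pp': "ppred D1 (P, k) = (Q, k)" if "\<not> oy" using n.ppred_psucc[OF inN(2)] ps'[OF that] by metis
  have pq: "ppred D1 (Q, \<not> k) = (P, \<not> k)" if oz using n.ppred_psucc[OF inN(1)] pz[OF that] by metis
  have pq': "ppred D1 (P, \<not> k) = (Q, \<not> k)" if "\<not> oz" using n.ppred_psucc[OF inN(2)] pz'[OF that] by metis
  have sdY: "fst (sd D1 ((P, k), oy)) = Pas (if oy then P else Q, k)"
    "fst (sd D1 ((Q, k), \<not> oy)) = Pas (if oy then P else Q, k)"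
    unfolding sd_def fst_conv snd_conv using pp pp' by presburger+
  have sdZ: "fst (sd D1 ((P, \<not> k), oz)) = Pas (if oz then P else Q, \<not> k)"
    "fst (sd D1 ((Q, \<not> k), \<not> oz)) = Pas (if oz then P else Q, \<not> k)"
    unfolding sd_def fst_conv snd_conv using pq pq' by presburger+
  have eAY: "k \<Longrightarrow> eA = Pas (if oy then P else Q, k)" "\<not> k \<Longrightarrow> eB = Pas (if oy then P else Q, k)"
    and eAZ: "\<not> k \<Longrightarrow> eA = Pas (if oz then P else Q, \<not> k)" "k \<Longrightarrow> eB = Pas (if oz then P else Q, \<not> k)"
    by (auto simp: eA_def eB_def c1_def c2_def oB_def)
  have "fst (sd D1 dA) = eA" "fst (sd D1 dB) = eB"
    unfolding dA_def dB_def using sdY sdZ eAY eAZ by presburger+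
  then have eA: "sd D1 dA = (eA, snd dA)" and eB: "sd D1 dB = (eB, snd dB)"
    by (simp_all add: sd_def)
  have mid: "d = ((P, k), oy) \<or> d = ((Q, k), \<not> oy) \<or> d = ((P, \<not> k), oz) \<or> d = ((Q, \<not> k), \<not> oz)
      \<Longrightarrow> fst (sd D1 d) = eA \<or> fst (sd D1 d) = eB" for d
    using sdY sdZ eAY eAZ by metis
  have AB_in: "dA \<in> darts D1" "dB \<in> darts D1" by (auto simp: dA_def dB_def darts1)
  have par_sd: "par (fst (sd D1 d)) = home d" if d: "d \<in> darts D1" for d
  proof (cases "snd d")
    case True
    then show ?thesis by (cases d) (simp add: sd_def par_def)
  next
    case False
    have "par (fst (sd D1 d)) = home (fst (alpha1 d), True)"
      using False alpha1_ppred[OF d] by (simp add: sd_def par_def)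
    also have "\<dots> = home (alpha1 d)"
      using alpha1_inv[OF d] False by (metis (full_types) prod.collapse)
    finally show ?thesis using home_alpha1[OF d] by simp
  qed
  have home_edges: "home d \<in> edges D" if "d \<in> darts D1" for d
  proof -
    have "fst (sd D e) \<in> edges D" if "e \<in> darts D" for e
      using sd_in[OF that] by (auto simp: sides_def)
    note e = this this[of yA] this[of zB]
    from that show ?thesis
      by (cases rule: darts1_split) (use e in \<open>simp_all add: home_new home_old\<close>)
  qed
  have D1_par: "par (Pas x) = par (Pas (ppred D1 x))" "par (Pas x) \<in> edges D" if "x \<in> N" for x
  proof -
    have d: "(x, True) \<in> darts D1" "(x, False) \<in> darts D1" using that by (auto simp: darts1)
    show "par (Pas x) = par (Pas (ppred D1 x))"
      using par_sd[OF d(1)] par_sd[OF d(2)] that by (cases x) (auto simp: sd_def home_def)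
    show "par (Pas x) \<in> edges D"
      using par_sd[OF d(1)] home_edges[OF d(1)] by (simp add: sd_def)
  qed
  have comp: "\<exists>n. (psucc D1 ^^ n) x = y" if x: "x \<in> N" and y: "y \<in> N" and e: "par (Pas x) = par (Pas y)" for x y
  proof -
    let ?o = "orb (psucc D1)"
    have oP: "?o (P, k) = ?o (Q, k)" "?o (P, \<not> k) = ?o (Q, \<not> k)"
      using orb_alpha1[of "((P, k), oy)"] orb_alpha1[of "((P, \<not> k), oz)"]
      by (simp_all add: darts1 alpha1_internal)
    \<comment> \<open>If both subdivided edges are one edge of \<open>D\<close>, its middle part
      joins the two passages at Q.\<close>
    have oQ: "?o (Q, k) = ?o (Q, \<not> k)" if "fst (sd D yA) = fst (sd D zB)"
    proof -
      have "alpha D yA = zB" using fst_sd_eq[of yA zB] that by auto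
      then have "alpha1 ((Q, k), oy) = ((Q, \<not> k), oz)"
        using stub_old[of yA] by (simp add: alpha1_external stub_simps)
      then show ?thesis using orb_alpha1[of "((Q, k), oy)"] by (simp add: darts1)
    qed
    have xs: "x = (P, k) \<or> x = (Q, k) \<or> x = (P, \<not> k) \<or> x = (Q, \<not> k)" using x by (cases x) auto
    have ys: "y = (P, k) \<or> y = (Q, k) \<or> y = (P, \<not> k) \<or> y = (Q, \<not> k)" using y by (cases y) auto
    have "?o x = ?o y"
      using xs ys e oP oQ by (elim disjE) (simp_all add: par_def home_new)
    then have "y \<in> ?o x" using orb_refl by metis
    then show ?thesis unfolding orb_def by auto
  qed
  have sd_pair: "reg D (fst (sd D d), snd d) = rho D d" for d by (simp add: rho_def sd_def)
  have sd_pair': "reg D (fst (sd D d), \<not> snd d) = rho D (alpha D d)" if "d \<in> darts D" for d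
    using sd_pair[of "alpha D d"] fst_sd_alpha[OF that] by (simp add: snd_alpha)
  have yreg: "reg D (fst (sd D yA), oy) = rho D yA" "reg D (fst (sd D yA), \<not> oy) = rho D xA'"
    using sd_pair[of yA] sd_pair'[of yA] rho_alpha[of yA] by (simp_all add: rot_old)
  have zreg: "reg D (fst (sd D zB), oz) = rho D zB" "reg D (fst (sd D zB), \<not> oz) = rho D yA"
    using sd_pair[of zB] sd_pair'[of zB] rho_alpha[of zB] by (simp_all add: rot_old rho_xB)
  have region: "reg D1 (e, b) = reg D (par e, b) \<or> (reg D (par e, b) = rho D yA \<and> reg D1 (e, b) = R')"
    if s: "(e, b) \<in> sides D1" and ne: "e \<noteq> eA" "e \<noteq> eB" for e b
  proof (cases e)
    case (Circ m)
    then show ?thesis by (simp add: par_def)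
  next
    case (Pas p)
    then obtain d where d: "d \<in> darts D1" "(e, b) = sd D1 d" using s by (auto simp: n.sides_eq)
    then have b: "b = snd d" and e: "e = fst (sd D1 d)" by (auto simp: sd_def)
    have r: "reg D1 (e, b) = rho1 d" using d D1_facts(3)[of d] by (simp add: rho_def)
    have h: "reg D (par e, b) = reg D (home d, snd d)" using par_sd[OF d(1)] b e by simp
    consider "d \<in> darts D" | "d = ((P, k), \<not> oy)" | "d = ((Q, k), oy)" | "d = ((P, \<not> k), \<not> oz)"
      | "d = ((Q, \<not> k), oz)"
      | "d = ((P, k), oy) \<or> d = ((Q, k), \<not> oy) \<or> d = ((P, \<not> k), oz) \<or> d = ((Q, \<not> k), \<not> oz)"
      using d(1) by (cases d; cases "fst d") (auto simp: darts1)
    then show ?thesis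
    proof cases
      case 1
      then have h: "reg D (par e, b) = rho D d" using h sd_pair by (simp add: home_old)
      consider "d = xB" | "d = yA" | "d \<noteq> xB" "d \<noteq> yA" by blast
      then show ?thesis by cases (use h r 1 in \<open>simp_all add: rho1_simps rho1_old rho_xB\<close>)
    next
      case 6
      then show ?thesis using mid ne e by blast
    qed (use h r in \<open>simp_all add: home_new rho1_simps yreg zreg\<close>)
  qed
  have L: "reg D1 (eA, snd dA) = L"
  proof -
    have "reg D1 (eA, snd dA) = rho1 dA" using eA D1_facts(3)[OF AB_in(1)] by (simp add: rho_def)
    also have "rho1 dA = L" unfolding dA_def using rho1_simps(4,5) by presburger
    finally show ?thesis .
  qed
  have Ls: "{s \<in> sides D1. reg D1 s = L} = {(eA, snd dA), (eB, snd dB)}"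
  proof -
    have c: "reg D1 s \<noteq> L" if "s \<in> Circ ` circs D1 \<times> UNIV" for s
    proof -
      have "reg D1 s = reg D s" "s \<in> sides D" using that by (auto simp: sides_eq)
      then show ?thesis using lab(3) by (auto simp: regions_def)
    qed
    have "{s \<in> sides D1. reg D1 s = L} = sd D1 ` {d \<in> darts D1. rho1 d = L}"
      using c D1_facts(3) unfolding n.sides_eq by (auto simp: rho_def simp del: split_paired_All split_paired_Ex)
    also have "{d \<in> darts D1. rho1 d = L} = {dA, dB}"
      using rho1_fresh(1) AB_in by (auto simp: dA_def dB_def darts1 simp del: split_paired_All split_paired_Ex split: if_splits)
    finally show ?thesis using eA eB by simp
  qed
  have hand: "\<forall>v\<in>crs D. hand D1 v = hand D v" using PQ by (auto simp: hand1_def)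
  have parold: "\<forall>p\<in>passages D. par (Pas p) = Pas p"
    using PQ by (auto simp: par_def home_def passages_def sd_def)
  define F where "F = psucc D1"
  note psF = ps[folded F_def] ps'[folded F_def] pz[folded F_def] pz'[folded F_def]
  have psA: "psucc D1 (c1, True) = (c2, True)"
    unfolding c1_def c2_def F_def[symmetric] using psF by (cases k; cases oy; cases oz) simp_all
  have psB: "if oB then psucc D1 (c1, False) = (c2, False) else psucc D1 (c2, False) = (c1, False)"
    unfolding c1_def c2_def oB_def F_def[symmetric] using psF by (cases k; cases oy; cases oz) simp_all
  have c12: "c1 \<noteq> c2" "c1 \<notin> crs D" "c2 \<notin> crs D" "crs D1 = insert c1 (insert c2 (crs D))"
    using PQ by (auto simp: c1_def c2_def)
  show ?thesis
    unfolding r2_def Let_def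
    apply (intro conjI val valid_D1)
    apply (rule exI[of _ c1], rule exI[of _ c2], rule exI[of _ oB], rule exI[of _ "snd dA"],
        rule exI[of _ "snd dB"], rule exI[of _ par], rule exI[of _ "rho D yA"], rule exI[of _ R'])
    unfolding N eA_def[symmetric] eB_def[symmetric] L
    using c12 hand psA psB skip_N parold D1_par exit_N comp lab region Ls
    by (intro conjI) (simp_all add: par_def)
qed

end

section \<open>Renaming and triangles\<close>

text \<open>A transposition instead of a replacement of c by q: it is its own inverse, so the
  renamed diagram is a conjugate of the old one.\<close>

definition vswap :: "nat \<Rightarrow> nat \<Rightarrow> dart \<Rightarrow> dart" where
  "vswap c q d = ((if vtx d = c then q else if vtx d = q then c else vtx d, snd (fst d)), snd d)"

locale renaming =
  fixes D :: diag and c q :: nat and h :: "nat \<Rightarrow> nat"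
  assumes val: "valid D" and c: "c \<in> crs D" and q: "q \<notin> crs D"
    and h: "inj_on h (regions D)" "h 0 = 0"
begin

sublocale pdiag D using val by (rule valid_pdiag)

abbreviation "f \<equiv> vswap c q"

definition E :: diag where
  "E = mkd (insert q (crs D - {c})) (circs D) (\<lambda>d. f (alpha D (f d)))
     (\<lambda>v. hand D (vtx (f ((v, True), True)))) (\<lambda>d. h (rho D (f d))) (\<lambda>s. h (reg D (Circ (fst s), snd s)))"

lemma E_simps [simp]:
  "crs E = insert q (crs D - {c})" "circs E = circs D"
  "hand E v = hand D (if v = c then q else if v = q then c else v)"
  "reg E (Circ m, b) = h (reg D (Circ m, b))"
  by (simp_all add: E_def vswap_def)

lemma f_f [simp]: "f (f d) = d"
  by (cases d; cases "fst d") (auto simp: vswap_def)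

lemma snd_f: "snd (f d) = snd d"
  by (simp add: vswap_def)

lemma f_E: "f d \<in> darts E \<longleftrightarrow> d \<in> darts D"
  using c q by (auto simp: dart_in vswap_def)

lemma f_D: "d \<in> darts E \<longleftrightarrow> f d \<in> darts D"
  using f_E[of "f d"] by simp

lemma snd_alpha: "snd (alpha D d) = (\<not> snd d)"
  by (simp add: alpha_def)

lemma E_facts:
  shows "pdiag E" and "\<And>d. d \<in> darts E \<Longrightarrow> alpha E d = f (alpha D (f d))"
    and "\<And>d. d \<in> darts E \<Longrightarrow> rho E d = h (rho D (f d))"
proof -
  let ?C = "insert q (crs D - {c})" and ?a = "\<lambda>d. f (alpha D (f d))"
  have e: "vtx d \<in> ?C \<longleftrightarrow> f d \<in> darts D" for d using f_D[of d] by (simp add: dart_in)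
  have a: "vtx (?a d) \<in> ?C \<and> ?a (?a d) = d \<and> snd (?a d) \<noteq> snd d" if "vtx d \<in> ?C" for d
    using that alpha_in[of "f d"] alpha_alpha[of "f d"] unfolding e
    by (simp add: snd_f snd_alpha)
  have f: "finite ?C" using fin by simp
  note m = mkd_darts[OF f finc a, where h = "\<lambda>v. hand D (vtx (f ((v, True), True)))"
      and r = "\<lambda>d. h (rho D (f d))" and q = "\<lambda>s. h (reg D (Circ (fst s), snd s))", folded E_def]
  show "pdiag E" using m(1) by blast
  show "alpha E d = f (alpha D (f d))" if "d \<in> darts E" for d using m(2)[of d] that by (simp add: dart_in)
  show "rho E d = h (rho D (f d))" if "d \<in> darts E" for d using m(3)[of d] that by (simp add: dart_in)
qed

sublocale n: pdiag E by (rule E_facts)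

lemma crot_f: "crot (hand E) (f d) = f (crot (hand D) d)"
  using c q by (cases d; cases "fst d") (auto simp: crot_def vswap_def)

lemma phi_f: "d \<in> darts D \<Longrightarrow> phi E (f d) = f (phi D d)"
  using crot_f by (simp add: phi_def E_facts f_E)

lemma darts_E: "darts E = f ` darts D"
proof
  show "darts E \<subseteq> f ` darts D"
  proof
    fix d assume "d \<in> darts E"
    then show "d \<in> f ` darts D" using f_D by (intro image_eqI[of _ _ "f d"]) simp_all
  qed
  show "f ` darts D \<subseteq> darts E" using f_E by blast
qed

lemma regions_E: "regions E = h ` regions D"
proof -
  have "rho E ` darts E = h ` rho D ` darts D"
    unfolding darts_E image_image by (rule image_cong) (simp_all add: E_facts f_E)
  moreover have "reg E ` (Circ ` circs E \<times> UNIV) = h ` reg D ` (Circ ` circs D \<times> UNIV)"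
    unfolding image_image by (rule image_cong) auto
  ultimately show ?thesis unfolding n.regions_eq regions_eq image_Un by simp
qed

lemma valid_E:
  assumes z: "0 \<in> regions D" shows "valid E"
proof -
  have v: "dreg D" "echar D = 2" "dconn D" using val valid_iff z by auto
  have "dreg E"
    unfolding dreg_def darts_E using v(1)
    by (auto simp: phi_f E_facts f_E phi_in dreg_def)
  moreover have "echar E = 2"
  proof -
    \<comment> \<open>Conjugate permutations have equally many orbits: the return statement with
      every dart returning at once and no missed cycle.\<close>
    have "card (orb (phi E) ` darts E) = card (orb (phi D) ` darts D) + card (orb (phi E) ` {})"
    proof (rule card_orbs_return[where j = f and G = "darts D", OF n.fin_darts n.inj_phi])
      show "phi E ` darts E \<subseteq> darts E" using n.phi_in by blast
      show "f ` darts D \<subseteq> darts E" by (simp add: darts_E)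
      show "inj_on f (darts D)" by (rule inj_on_inverseI[of _ f]) simp
      show "phi D s \<in> darts D \<and> hit (phi E) (f ` darts D) (f s) (f (phi D s))" if "s \<in> darts D" for s
        using that by (intro conjI hit_here) (simp_all add: phi_in phi_f)
      show "x \<in> {} \<or> orb (phi E) x \<inter> f ` darts D \<noteq> {}" if "x \<in> darts E" for x
        using that orb_refl darts_E by fast
    qed auto
    moreover have "card (regions E) = card (regions D)" by (simp add: regions_E card_image h)
    moreover have "card (crs E) = card (crs D)"
      using card.remove[OF fin c] q fin by simp
    ultimately show ?thesis using v(2) by (simp add: echar_def)
  qed
  moreover have "dconn E"
    unfolding dconn_def
  proof (rule allI impI)+
    fix V K W :: "nat \<Rightarrow> bool"
    assume V: "\<forall>d\<in>darts E. V (vtx d) = W (rho E d)"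
      and K: "\<forall>m\<in>circs E. \<forall>b. K m = W (reg E (Circ m, b))"
    have "\<forall>d\<in>darts D. V (if vtx d = c then q else if vtx d = q then c else vtx d) = W (h (rho D d))"
    proof
      fix d assume "d \<in> darts D"
      then have "f d \<in> darts E" using f_E by blast
      then have "V (vtx (f d)) = W (h (rho D d))" using V E_facts(3)[of "f d"] by (simp del: split_paired_All)
      then show "V (if vtx d = c then q else if vtx d = q then c else vtx d) = W (h (rho D d))"
        by (simp add: vswap_def)
    qed
    moreover have "\<forall>m\<in>circs D. \<forall>b. K m = W (h (reg D (Circ m, b)))" using K by simp
    \<comment> \<open>The colouring of \<open>E\<close> is pulled back to \<open>D\<close> along the
      transposition and \<open>h\<close>.\<close>
    ultimately have "\<forall>r\<in>regions D. \<forall>r'\<in>regions D. W (h r) = W (h r')"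
      by (rule v(3)[unfolded dconn_def,
            THEN spec[where x = "\<lambda>v. V (if v = c then q else if v = q then c else v)"],
            THEN spec[where x = K], THEN spec[where x = "\<lambda>r. W (h r)"], THEN mp, THEN mp])
    then show "\<forall>r\<in>regions E. \<forall>r'\<in>regions E. W r = W r'" unfolding regions_E by blast
  qed
  moreover have "0 \<in> regions E" using z h(2) by (metis image_eqI regions_E)
  ultimately show ?thesis by (simp add: n.valid_iff)
qed

lemma fst_sd: "fst (sd F d) = Pas (fst (if snd d then d else alpha F d))"
  by (simp add: sd_def alpha_def)

lemma iso_E:
  assumes z: "0 \<in> regions D" shows "iso E D"
proof -
  let ?v = "\<lambda>v. if v = c then q else if v = q then c else v"
  \<comment> \<open>The isomorphism runs from \<open>E\<close> back to \<open>D\<close>, so the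
    relabelling has to be inverted.\<close>
  let ?h = "inv_into (regions D) h"
  have hh: "?h (h r) = r" if "r \<in> regions D" for r using h(1) that by (rule inv_into_f_f)
  have mf: "mpas ?v (fst d) = fst (f d)" for d by (cases d; cases "fst d") (auto simp: vswap_def)
  have bij: "bij_betw ?v (crs E) (crs D)"
    by (rule bij_betw_byWitness[of _ ?v]) (use c q in auto)
  have ps: "psucc D (mpas ?v x) = mpas ?v (psucc E x)" if "x \<in> passages E" for x
  proof -
    have d: "(x, True) \<in> darts E" using that by (simp add: darts_def)
    have "f (alpha E (x, True)) = alpha D (f (x, True))" using E_facts(2)[OF d] by simp
    then have "fst (alpha D (f (x, True))) = mpas ?v (fst (alpha E (x, True)))"
      unfolding mf by simp
    moreover have "snd (f (x, True))" by (simp add: vswap_def)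
    moreover have "mpas ?v x = fst (f (x, True))" using mf[of "(x, True)"] by simp
    ultimately show ?thesis by (simp add: alpha_def)
  qed
  have rg: "reg D (meid ?v id e, b) = ?h (reg E (e, b))" if s: "(e, b) \<in> sides E" for e b
  proof (cases e)
    case (Circ m)
    then have "m \<in> circs D" using s by (auto simp: n.sides_eq sd_def)
    then have "reg D (Circ m, b) \<in> regions D" by (auto simp: regions_eq)
    then show ?thesis using hh Circ by simp
  next
    case (Pas p)
    then obtain d where d: "d \<in> darts E" "(e, b) = sd E d" using s by (auto simp: n.sides_eq)
    then have fd: "f d \<in> darts D" using f_D by blast
    have b: "b = snd d" "e = fst (sd E d)" using d(2) by (auto simp: sd_def)
    have fa: "f (alpha E d) = alpha D (f d)" using E_facts(2)[OF d(1)] by simp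
    have sf: "snd (f d) = snd d" by (simp add: vswap_def)
    have "meid ?v id e = fst (sd D (f d))"
      unfolding b(2) fst_sd sf
      by (simp add: mf fa del: mpas.simps)
    then have "(meid ?v id e, b) = sd D (f d)" by (simp add: prod_eq_iff b(1)) (simp add: sd_def sf)
    then have "reg D (meid ?v id e, b) = rho D (f d)" by (simp add: rho_def)
    moreover have "reg E (e, b) = h (rho D (f d))" using E_facts(3)[OF d(1)] d(2) by (simp add: rho_def)
    moreover have "rho D (f d) \<in> regions D" using fd by (auto simp: regions_eq)
    ultimately show ?thesis using hh by simp
  qed
  have "inj_on ?h (regions E)" unfolding regions_E by (rule inj_on_inv_into) simp
  moreover have "?h 0 = 0" using hh[OF z] h(2) by simp
  moreover have "\<forall>v\<in>crs E. hand D (?v v) = hand E v" by simp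
  moreover have "bij_betw id (circs E) (circs D)" by simp
  ultimately show ?thesis
    unfolding iso_def using valid_E[OF z] val bij ps rg by blast
qed

end

section \<open>Triangles and the faces around them\<close>

text \<open>\<open>tswap\<close> on darts, without a fixed ranking of the strands: \<open>i\<close>,
  \<open>j\<close> and \<open>k\<close> record over and under, so the top, middle or bottom strand
  may play the role of x.\<close>

definition tsw :: "nat \<Rightarrow> nat \<Rightarrow> nat \<Rightarrow> bool \<Rightarrow> bool \<Rightarrow> bool \<Rightarrow> dart \<Rightarrow> dart" where
  "tsw A B c i j k d = (if fst d = (A, i) then (B, j) else if fst d = (B, j) then (A, i)
     else if fst d = (A, \<not> i) then (c, k) else if fst d = (c, k) then (A, \<not> i)
     else if fst d = (B, \<not> j) then (c, \<not> k) else if fst d = (c, \<not> k) then (B, \<not> j)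
     else fst d, snd d)"

text \<open>The sides of the triangle are x = AB, z = Bc and y = cA, in counterclockwise order; the
  flags ox, oy, oz say that the strand is oriented from A to B, away from A on leaving the
  triangle along y, and away from B on leaving it along z.\<close>

locale triangle =
  fixes D :: diag and A B c :: nat and i j k ox oy oz :: bool
  assumes val: "valid D"
    and dist: "A \<noteq> B" "A \<noteq> c" "B \<noteq> c"
    and mem: "A \<in> crs D" "B \<in> crs D" "c \<in> crs D"
    and alpha_x: "alpha D ((A, i), ox) = ((B, j), \<not> ox)"
    and alpha_y: "alpha D ((A, \<not> i), \<not> oy) = ((c, k), oy)"
    and alpha_z: "alpha D ((B, \<not> j), \<not> oz) = ((c, \<not> k), oz)"
    and rot_A: "crot (hand D) ((A, \<not> i), \<not> oy) = ((A, i), ox)"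
    and rot_B: "crot (hand D) ((B, j), \<not> ox) = ((B, \<not> j), \<not> oz)"
    and rot_c: "crot (hand D) ((c, \<not> k), oz) = ((c, k), oy)"
begin

sublocale pdiag D using val by (rule valid_pdiag)

lemma neq [simp]: "A \<noteq> B" "A \<noteq> c" "B \<noteq> c" "B \<noteq> A" "c \<noteq> A" "c \<noteq> B"
  using dist by auto

lemma dart_mem [simp]: "((A, a), b) \<in> darts D" "((B, a), b) \<in> darts D" "((c, a), b) \<in> darts D"
  using mem by (simp_all add: dart_in)

definition inner :: "dart set" where
  "inner = {((A, i), ox), ((B, j), \<not> ox), ((A, \<not> i), \<not> oy), ((c, k), oy), ((B, \<not> j), \<not> oz), ((c, \<not> k), oz)}"

lemma alpha_inner:
  "alpha D ((A, i), ox) = ((B, j), \<not> ox)" "alpha D ((B, j), \<not> ox) = ((A, i), ox)"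
  "alpha D ((A, \<not> i), \<not> oy) = ((c, k), oy)" "alpha D ((c, k), oy) = ((A, \<not> i), \<not> oy)"
  "alpha D ((B, \<not> j), \<not> oz) = ((c, \<not> k), oz)" "alpha D ((c, \<not> k), oz) = ((B, \<not> j), \<not> oz)"
  using alpha_x alpha_y alpha_z alpha_alpha[of "((A, i), ox)"] alpha_alpha[of "((A, \<not> i), \<not> oy)"]
    alpha_alpha[of "((B, \<not> j), \<not> oz)"] by simp_all

lemma rot:
  "crot (hand D) ((A, \<not> i), \<not> oy) = ((A, i), ox)" "crot (hand D) ((A, i), ox) = ((A, \<not> i), oy)"
  "crot (hand D) ((A, \<not> i), oy) = ((A, i), \<not> ox)" "crot (hand D) ((A, i), \<not> ox) = ((A, \<not> i), \<not> oy)"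
  "crot (hand D) ((B, j), \<not> ox) = ((B, \<not> j), \<not> oz)" "crot (hand D) ((B, \<not> j), \<not> oz) = ((B, j), ox)"
  "crot (hand D) ((B, j), ox) = ((B, \<not> j), oz)" "crot (hand D) ((B, \<not> j), oz) = ((B, j), \<not> ox)"
  "crot (hand D) ((c, \<not> k), oz) = ((c, k), oy)" "crot (hand D) ((c, k), oy) = ((c, \<not> k), \<not> oz)"
  "crot (hand D) ((c, \<not> k), \<not> oz) = ((c, k), \<not> oy)" "crot (hand D) ((c, k), \<not> oy) = ((c, \<not> k), oz)"
  using rot_A rot_B rot_c by (auto simp: crot_def)

lemma phi_inner:
  "phi D ((A, i), ox) = ((B, \<not> j), \<not> oz)" "phi D ((B, \<not> j), \<not> oz) = ((c, k), oy)"
  "phi D ((c, k), oy) = ((A, i), ox)"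
  "phi D ((B, j), \<not> ox) = ((A, \<not> i), oy)" "phi D ((A, \<not> i), \<not> oy) = ((c, \<not> k), \<not> oz)"
  "phi D ((c, \<not> k), oz) = ((B, j), ox)"
  by (simp_all add: phi_def alpha_inner rot)

lemma rho_phi: "d \<in> darts D \<Longrightarrow> rho D (phi D d) = rho D d"
  using val valid_iff by (auto simp: dreg_def)

lemma rho_inner:
  "rho D ((B, \<not> j), \<not> oz) = rho D ((A, i), ox)" "rho D ((c, k), oy) = rho D ((A, i), ox)"
  "rho D ((B, j), \<not> ox) = rho D ((A, \<not> i), oy)" "rho D ((A, \<not> i), \<not> oy) = rho D ((c, \<not> k), \<not> oz)"
  "rho D ((c, \<not> k), oz) = rho D ((B, j), ox)"
  using rho_phi[of "((A, i), ox)"] rho_phi[of "((B, \<not> j), \<not> oz)"] rho_phi[of "((B, j), \<not> ox)"]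
    rho_phi[of "((A, \<not> i), \<not> oy)"] rho_phi[of "((c, \<not> k), oz)"]
  by (simp_all add: phi_inner)

text \<open>Off the triangle, the faces are described by the first-return map of phi to the darts
  outside the triangle.  Around the triangle it permutes the six outgoing darts in a hexagon
  that looks the same before and after the R3 move.\<close>

definition rim :: "dart set" where "rim = darts D - inner"

lemma tri_darts_cases:
  assumes "d \<in> darts D"
  obtains "vtx d \<noteq> A" "vtx d \<noteq> B" "vtx d \<noteq> c"
    | "d = ((A, i), ox)" | "d = ((A, i), \<not> ox)" | "d = ((A, \<not> i), oy)" | "d = ((A, \<not> i), \<not> oy)"
    | "d = ((B, j), ox)" | "d = ((B, j), \<not> ox)" | "d = ((B, \<not> j), oz)" | "d = ((B, \<not> j), \<not> oz)"
    | "d = ((c, k), oy)" | "d = ((c, k), \<not> oy)" | "d = ((c, \<not> k), oz)" | "d = ((c, \<not> k), \<not> oz)"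
proof -
  have "d = ((v, a), p) \<or> d = ((v, a), \<not> p) \<or> d = ((v, \<not> a), r) \<or> d = ((v, \<not> a), \<not> r)"
    if "vtx d = v" for v a p r
    using that by (cases d; cases "fst d"; cases "snd (fst d) = a"; cases "snd d = p"; cases "snd d = r") simp_all
  note v = this[of A i ox oy] this[of B j ox oz] this[of c k oy oz]
  show ?thesis
  proof (cases "vtx d = A")
    case True
    from v(1)[OF this] show ?thesis by (elim disjE) (erule that)+
  next
    case nA: False
    show ?thesis
    proof (cases "vtx d = B")
      case True
      from v(2)[OF this] show ?thesis by (elim disjE) (erule that)+
    next
      case nB: False
      show ?thesis
      proof (cases "vtx d = c")
        case True
        from v(3)[OF this] show ?thesis by (elim disjE) (erule that)+
      next
        case False
        then show ?thesis using nA nB that(1) by blast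
      qed
    qed
  qed
qed

lemma rim_cases:
  assumes "d \<in> rim"
  obtains "vtx d \<noteq> A" "vtx d \<noteq> B" "vtx d \<noteq> c"
    | "d = ((A, i), \<not> ox)" | "d = ((A, \<not> i), oy)" | "d = ((B, j), ox)"
    | "d = ((B, \<not> j), oz)" | "d = ((c, k), \<not> oy)" | "d = ((c, \<not> k), \<not> oz)"
proof -
  from assms have "d \<in> darts D" by (simp add: rim_def)
  then show ?thesis
    by (cases rule: tri_darts_cases) (use assms that in \<open>simp_all add: rim_def inner_def\<close>)
qed

lemma rim_mem:
  "((A, i), \<not> ox) \<in> rim" "((A, \<not> i), oy) \<in> rim" "((B, j), ox) \<in> rim"
  "((B, \<not> j), oz) \<in> rim" "((c, k), \<not> oy) \<in> rim" "((c, \<not> k), \<not> oz) \<in> rim"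
  by (simp_all add: rim_def inner_def)

lemma rim_other: "d \<in> darts D \<Longrightarrow> vtx d \<noteq> A \<Longrightarrow> vtx d \<noteq> B \<Longrightarrow> vtx d \<noteq> c \<Longrightarrow> d \<in> rim"
  by (auto simp: rim_def inner_def)

lemma alpha_rim: "d \<in> rim \<Longrightarrow> alpha D d \<in> rim"
proof -
  assume d: "d \<in> rim"
  then have i: "d \<in> darts D" by (simp add: rim_def)
  have "alpha D d \<notin> inner"
  proof
    assume "alpha D d \<in> inner"
    then have "alpha D (alpha D d) \<in> inner"
      unfolding inner_def by (elim insertE emptyE) (simp_all add: alpha_inner)
    then show False using d alpha_alpha[OF i] by (simp add: rim_def)
  qed
  then show ?thesis using alpha_in[OF i] by (simp add: rim_def)
qed

text \<open>A face that arrives at A along x, at c along y or at B along z follows one side of the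
  triangle from outside, through a single inner dart, before it leaves; these are the three
  exceptional values. At the other three arrivals one turn leads out.\<close>

definition rnext :: "dart \<Rightarrow> dart" where
  "rnext d = (let e = alpha D d in if e = ((A, i), \<not> ox) then ((c, \<not> k), \<not> oz)
     else if e = ((c, k), \<not> oy) then ((B, j), ox)
     else if e = ((B, \<not> j), oz) then ((A, \<not> i), oy) else crot (hand D) e)"

lemma rnext_alpha:
  "alpha D d = ((A, i), \<not> ox) \<Longrightarrow> rnext d = ((c, \<not> k), \<not> oz)"
  "alpha D d = ((A, \<not> i), oy) \<Longrightarrow> rnext d = ((A, i), \<not> ox)"
  "alpha D d = ((B, j), ox) \<Longrightarrow> rnext d = ((B, \<not> j), oz)"
  "alpha D d = ((B, \<not> j), oz) \<Longrightarrow> rnext d = ((A, \<not> i), oy)"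
  "alpha D d = ((c, k), \<not> oy) \<Longrightarrow> rnext d = ((B, j), ox)"
  "alpha D d = ((c, \<not> k), \<not> oz) \<Longrightarrow> rnext d = ((c, k), \<not> oy)"
  by (simp_all add: rnext_def rot)

lemma rnext_other:
  "vtx (alpha D d) \<noteq> A \<Longrightarrow> vtx (alpha D d) \<noteq> B \<Longrightarrow> vtx (alpha D d) \<noteq> c \<Longrightarrow> rnext d = phi D d"
  by (auto simp: rnext_def phi_def Let_def)

lemma rnext_hit:
  assumes d: "d \<in> rim"
  shows "rnext d \<in> rim \<and> hit (phi D) rim d (rnext d)"
  using alpha_rim[OF d]
proof (cases rule: rim_cases)
  case 1
  have "phi D d \<in> rim"
    using phi_in[of d] d 1 by (intro rim_other) (simp_all add: rim_def phi_def)
  then show ?thesis using rnext_other[OF 1] by (simp add: hit_here)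
next
  case 2
  have "hit (phi D) rim ((A, \<not> i), \<not> oy) ((c, \<not> k), \<not> oz)"
    by (rule hit_here) (simp_all add: phi_inner rim_mem)
  then have "hit (phi D) rim d ((c, \<not> k), \<not> oz)"
    by (rule hit_step) (simp_all add: phi_def 2 rot rim_def inner_def)
  then show ?thesis using rnext_alpha(1)[OF 2] rim_mem by simp
next
  case 3
  then show ?thesis by (simp add: rnext_alpha rim_mem hit_here phi_def rot)
next
  case 4
  then show ?thesis by (simp add: rnext_alpha rim_mem hit_here phi_def rot)
next
  case 5
  have "hit (phi D) rim ((B, j), \<not> ox) ((A, \<not> i), oy)"
    by (rule hit_here) (simp_all add: phi_inner rim_mem)
  then have "hit (phi D) rim d ((A, \<not> i), oy)"
    by (rule hit_step) (simp_all add: phi_def 5 rot rim_def inner_def)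
  then show ?thesis using rnext_alpha(4)[OF 5] rim_mem by simp
next
  case 6
  have "hit (phi D) rim ((c, \<not> k), oz) ((B, j), ox)"
    by (rule hit_here) (simp_all add: phi_inner rim_mem)
  then have "hit (phi D) rim d ((B, j), ox)"
    by (rule hit_step) (simp_all add: phi_def 6 rot rim_def inner_def)
  then show ?thesis using rnext_alpha(5)[OF 6] rim_mem by simp
next
  case 7
  then show ?thesis by (simp add: rnext_alpha rim_mem hit_here phi_def rot)
qed

text \<open>The additional 1 is the triangular face, the only cycle that misses the rim. The
  parametrization \<open>t\<close> allows the rims before and after the move to be compared over one
  set.\<close>

lemma card_orbs_rim:
  assumes t: "inj_on t G" "t ` G = rim" and g: "\<And>s. s \<in> G \<Longrightarrow> g s \<in> G \<and> rnext (t s) = t (g s)"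
  shows "card (orb (phi D) ` darts D) = card (orb g ` G) + 1"
proof -
  let ?Z = "{((A, i), ox), ((B, \<not> j), \<not> oz), ((c, k), oy)}"
  have "card (orb (phi D) ` darts D) = card (orb g ` G) + card (orb (phi D) ` ?Z)"
  proof (rule card_orbs_return[where j = t, OF fin_darts inj_phi])
    show "phi D ` darts D \<subseteq> darts D" using phi_in by blast
    show "t ` G \<subseteq> darts D" using t(2) by (auto simp: rim_def)
    show "inj_on t G" by fact
    show "g s \<in> G \<and> hit (phi D) (t ` G) (t s) (t (g s))" if "s \<in> G" for s
      using g[OF that] rnext_hit[of "t s"] t(2) that by auto
    show "?Z \<subseteq> darts D" by simp
    show "phi D ` ?Z \<subseteq> ?Z" by (simp add: phi_inner)
    show "?Z \<inter> t ` G = {}" unfolding t(2) by (simp add: rim_def inner_def)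
    fix x assume x: "x \<in> darts D"
    have o: "phi D x \<in> rim \<Longrightarrow> orb (phi D) x \<inter> t ` G \<noteq> {}"
      unfolding t(2) using hit_orb[OF hit_here[OF refl], of "phi D" x rim] by blast
    have "x \<in> rim \<or> x \<in> inner" using x by (simp add: rim_def)
    then show "x \<in> ?Z \<or> orb (phi D) x \<inter> t ` G \<noteq> {}"
    proof
      assume "x \<in> rim"
      then show ?thesis unfolding t(2) using orb_refl by fast
    next
      assume "x \<in> inner"
      then show ?thesis unfolding inner_def
        by (elim insertE emptyE) (use o in \<open>simp_all add: phi_inner rim_mem\<close>)
    qed
  qed
  moreover have "orb (phi D) ` ?Z = {?Z}"
  proof -
    have rotate: "{b, c, a} = {a, b, c}" "{c, a, b} = {a, b, c}" for a b c :: dart by blast+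
    show ?thesis
      unfolding image_insert image_empty orb_3[OF phi_inner(1-3)]
        orb_3[OF phi_inner(2,3,1), unfolded rotate(1)[where a = "((A, i), ox)"]]
        orb_3[OF phi_inner(3,1,2), unfolded rotate(2)[where a = "((A, i), ox)"]]
      by simp
  qed
  ultimately show ?thesis by (simp only:) simp
qed

text \<open>The outer side of each triangle edge lies on a face that also has a rim dart, so at most
  the label of the triangle itself is missing from the rim.\<close>

lemma regions_rim:
  "regions D = insert (rho D ((A, i), ox)) (rho D ` rim \<union> reg D ` (Circ ` circs D \<times> UNIV))"
proof -
  have "rho D ` inner \<subseteq> insert (rho D ((A, i), ox)) (rho D ` rim)"
    unfolding inner_def using rim_mem by (auto simp: rho_inner)
  moreover have "((A, i), ox) \<in> darts D" by simp
  moreover have "darts D = rim \<union> inner" by (auto simp: rim_def inner_def)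
  ultimately show ?thesis unfolding regions_eq by blast
qed

end

section \<open>The R3 move\<close>

text \<open>An R3 move of unspecified type. Labels are compared on the rim only, as
  \<open>r3\<close> does not fix those on the sides of the new triangle.\<close>

locale r3t = triangle D A B c i j k ox oy oz
  for D :: diag and A B c :: nat and i j k ox oy oz :: bool +
  fixes D' :: diag
  assumes val': "valid D'"
    and face_nz: "rho D ((A, i), ox) \<noteq> 0"
    and face: "\<And>d. d \<in> darts D \<Longrightarrow> rho D d = rho D ((A, i), ox) \<Longrightarrow>
      d = ((A, i), ox) \<or> d = ((B, \<not> j), \<not> oz) \<or> d = ((c, k), oy)"
    and face_circ: "\<And>m b. m \<in> circs D \<Longrightarrow> reg D (Circ m, b) \<noteq> rho D ((A, i), ox)"
    and crs': "crs D' = crs D" and circs': "circs D' = circs D"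
    and hand': "\<And>v. v \<in> crs D \<Longrightarrow> hand D' v = hand D v"
    and alpha': "\<And>d. d \<in> darts D \<Longrightarrow> alpha D' d = tsw A B c i j k (alpha D (tsw A B c i j k d))"
    and rho': "\<And>d. d \<in> rim \<Longrightarrow> rho D' (tsw A B c i j k d) = rho D d"
    and circ': "\<And>m b. m \<in> circs D \<Longrightarrow> reg D' (Circ m, b) = reg D (Circ m, b)"
begin

abbreviation "T \<equiv> tsw A B c i j k"

lemma T_simps [simp]:
  "T ((A, i), b) = ((B, j), b)" "T ((B, j), b) = ((A, i), b)"
  "T ((A, \<not> i), b) = ((c, k), b)" "T ((c, k), b) = ((A, \<not> i), b)"
  "T ((B, \<not> j), b) = ((c, \<not> k), b)" "T ((c, \<not> k), b) = ((B, \<not> j), b)"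
  by (simp_all add: tsw_def)

lemma T_other: "vtx d \<noteq> A \<Longrightarrow> vtx d \<noteq> B \<Longrightarrow> vtx d \<noteq> c \<Longrightarrow> T d = d"
  by (cases d) (auto simp: tsw_def)

lemma
  assumes "d \<in> darts D"
  shows T_T: "T (T d) = d" and T_in: "T d \<in> darts D"
proof -
  have "T (T d) = d \<and> T d \<in> darts D"
    using assms by (cases rule: tri_darts_cases) (use assms in \<open>simp_all add: T_other\<close>)
  then show "T (T d) = d" "T d \<in> darts D" by blast+
qed

lemma darts': "darts D' = darts D"
  by (auto simp: dart_in crs')

lemma crot': "d \<in> darts D \<Longrightarrow> crot (hand D') d = crot (hand D) d"
  by (simp add: crot_def hand' dart_in)

text \<open>Each strand now meets its two crossings in the opposite order, so the turned triangle
  fits the same description with all direction flags negated.\<close>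

lemma triangle': "triangle D' A B c i j k (\<not> ox) (\<not> oy) (\<not> oz)"
proof
  show "valid D'" by (rule val')
qed (use mem in \<open>simp_all add: crs' alpha' alpha_inner crot' rot\<close>)

lemma alpha'_T: "d \<in> darts D \<Longrightarrow> alpha D' (T d) = T (alpha D d)"
  by (simp add: alpha' T_in T_T)

lemma T_rim:
  "d \<in> rim \<Longrightarrow> T d \<in> triangle.rim D' A B c i j k (\<not> ox) (\<not> oy) (\<not> oz)"
  "d \<in> triangle.rim D' A B c i j k (\<not> ox) (\<not> oy) (\<not> oz) \<Longrightarrow> T d \<in> rim"
proof -
  interpret t: triangle D' A B c i j k "\<not> ox" "\<not> oy" "\<not> oz" by (rule triangle')
  show "T d \<in> t.rim" if "d \<in> rim"
    using that
    by (cases rule: rim_cases)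
      (use that in \<open>simp_all add: T_other t.rim_mem[simplified] t.rim_other darts' rim_def\<close>)
  show "T d \<in> rim" if "d \<in> t.rim"
    using that
    by (cases rule: t.rim_cases)
      (use that in \<open>simp_all add: T_other rim_mem rim_other t.rim_def darts'\<close>)
qed

lemma T_rim_image: "T ` rim = triangle.rim D' A B c i j k (\<not> ox) (\<not> oy) (\<not> oz)"
proof -
  interpret t: triangle D' A B c i j k "\<not> ox" "\<not> oy" "\<not> oz" by (rule triangle')
  show ?thesis
  proof
    show "T ` rim \<subseteq> t.rim" using T_rim(1) by blast
    show "t.rim \<subseteq> T ` rim"
    proof
      fix d assume d: "d \<in> t.rim"
      then have "T (T d) = d" by (intro T_T) (simp add: t.rim_def darts')
      then show "d \<in> T ` rim" using T_rim(2)[OF d] by (metis image_eqI)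
    qed
  qed
qed

text \<open>The move exchanges the three arrivals that take a detour along a side with the three
  that turn at once, but the exits of the hexagon correspond under \<open>T\<close>.\<close>

lemma rnext_T:
  assumes d: "d \<in> rim"
  shows "triangle.rnext D' A B c i j k (\<not> ox) (\<not> oy) (\<not> oz) (T d) = T (rnext d)"
proof -
  interpret t: triangle D' A B c i j k "\<not> ox" "\<not> oy" "\<not> oz" by (rule triangle')
  have i: "d \<in> darts D" using d by (simp add: rim_def)
  note a = alpha'_T[OF i]
  note tn = t.rnext_alpha[of "T d", simplified]
  from alpha_rim[OF d] show ?thesis
  proof (cases rule: rim_cases)
    case 1
    then have "alpha D' (T d) = alpha D d" using a by (simp add: T_other)
    moreover have "vtx (phi D d) = vtx (alpha D d)" by (simp add: phi_def)
    ultimately show ?thesis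
      using 1 crot'[OF alpha_in[OF i]] t.rnext_other[of "T d"] rnext_other[of d]
      by (simp add: T_other phi_def)
  qed (use a tn in \<open>simp_all add: rnext_alpha\<close>)
qed

lemma card_orbs_r3: "card (orb (phi D') ` darts D') = card (orb (phi D) ` darts D)"
proof -
  interpret t: triangle D' A B c i j k "\<not> ox" "\<not> oy" "\<not> oz" by (rule triangle')
  have "card (orb (phi D) ` darts D) = card (orb rnext ` rim) + 1"
    by (rule card_orbs_rim[of "\<lambda>d. d"]) (simp_all add: rnext_hit)
  moreover have "card (orb (phi D') ` darts D') = card (orb rnext ` rim) + 1"
  proof (rule t.card_orbs_rim[of T])
    show "inj_on T rim" by (rule inj_on_inverseI[of _ T]) (simp add: T_T rim_def)
    show "T ` rim = t.rim" by (rule T_rim_image)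
    show "rnext s \<in> rim \<and> t.rnext (T s) = T (rnext s)" if "s \<in> rim" for s
      using rnext_hit[OF that] rnext_T[OF that] by blast
  qed
  ultimately show ?thesis by simp
qed

definition rest :: "nat set" where
  "rest = rho D ` rim \<union> reg D ` (Circ ` circs D \<times> UNIV)"

lemma regions_rest: "regions D = insert (rho D ((A, i), ox)) rest" "rho D ((A, i), ox) \<notin> rest"
proof -
  show "regions D = insert (rho D ((A, i), ox)) rest" by (simp add: regions_rim rest_def)
  have "rho D ((A, i), ox) \<notin> rho D ` rim"
  proof
    assume "rho D ((A, i), ox) \<in> rho D ` rim"
    then obtain d where d: "d \<in> rim" "rho D d = rho D ((A, i), ox)" by (metis imageE)
    then have "d \<in> inner" using face[of d] by (auto simp: rim_def inner_def)
    then show False using d by (simp add: rim_def)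
  qed
  then show "rho D ((A, i), ox) \<notin> rest" using face_circ by (force simp: rest_def)
qed

text \<open>The face turned upside down cannot merge with another region: the number of
  face cycles is unchanged, so the Euler characteristic would drop.\<close>

lemma regions_rest':
  "regions D' = insert (rho D' ((A, i), \<not> ox)) rest" "rho D' ((A, i), \<not> ox) \<notin> rest"
proof -
  interpret t: triangle D' A B c i j k "\<not> ox" "\<not> oy" "\<not> oz" by (rule triangle')
  have "rho D' ` t.rim = rho D ` rim"
    unfolding T_rim_image[symmetric] image_image by (rule image_cong) (simp_all add: rho')
  moreover have "reg D' ` (Circ ` circs D' \<times> UNIV) = reg D ` (Circ ` circs D \<times> UNIV)"
    unfolding circs' by (rule image_cong) (auto simp: circ')
  ultimately show r: "regions D' = insert (rho D' ((A, i), \<not> ox)) rest"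
    by (simp add: t.regions_rim rest_def)
  have f: "finite rest" using fin_regions regions_rest(1) by simp
  have "echar D = 2" "echar D' = 2"
    using val val' valid_iff t.valid_iff regions_rest(1) r by auto
  then have "card (regions D') = card (regions D)"
    by (simp add: echar_def card_orbs_r3 crs' circs')
  then show "rho D' ((A, i), \<not> ox) \<notin> rest"
    using r regions_rest f by (auto simp: insert_absorb)
qed

lemma zero_rest: "0 \<in> rest"
  using val valid_iff regions_rest face_nz by auto

end

section \<open>The auxiliary R3 move between two R2 constructions\<close>

lemma tsw_tsw:
  assumes "A \<noteq> B" "A \<noteq> c" "B \<noteq> c"
  shows "tsw A B c i j k (tsw A B c i j k d) = d"
proof (cases d)
  case (Pair p b)
  consider "p = (A, i)" | "p = (A, \<not> i)" | "p = (B, j)" | "p = (B, \<not> j)" | "p = (c, k)" | "p = (c, \<not> k)"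
    | "fst p \<noteq> A" "fst p \<noteq> B" "fst p \<noteq> c"
    by (cases p) auto
  then show ?thesis
    by cases (use assms Pair in \<open>auto simp: tsw_def\<close>)
qed

locale r3_step = r3t +
  fixes P Q R' L :: nat
  assumes PQ: "P \<notin> crs D" "Q \<notin> crs D" "P \<noteq> Q"
    and lab: "R' \<notin> regions D" "R' \<notin> regions D'" "R' \<noteq> 0" "L \<notin> regions D" "L \<notin> regions D'" "L \<noteq> 0" "L \<noteq> R'"
begin

sublocale c1: corner D A B P Q i j k ox oy oz R' L
  by unfold_locales (use val mem PQ lab alpha_x rot_A rot_B in auto)

abbreviation "tau \<equiv> rho D ((A, i), ox)"
abbreviation "tau' \<equiv> rho D' ((A, i), \<not> ox)"

definition h :: "nat \<Rightarrow> nat" where "h r = (if r = tau' then L else r)"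

lemma h_rest: "r \<in> rest \<Longrightarrow> h r = r"
  using regions_rest'(2) by (auto simp: h_def)

sublocale e: renaming D' c Q h
proof
  show "inj_on h (regions D')" using lab by (auto simp: h_def inj_on_def)
  show "h 0 = 0" using h_rest zero_rest by blast
qed (use val' mem PQ crs' in auto)

abbreviation "F \<equiv> vswap c Q"
abbreviation "E \<equiv> e.E"

lemma neq' [simp]: "P \<noteq> c" "c \<noteq> P" "Q \<noteq> c" "c \<noteq> Q"
  using mem PQ by auto

lemma F_simps [simp]:
  "F ((A, a), b) = ((A, a), b)" "F ((B, a), b) = ((B, a), b)"
  "F ((c, a), b) = ((Q, a), b)" "F ((Q, a), b) = ((c, a), b)"
  by (simp_all add: vswap_def)

lemma F_other: "vtx d \<noteq> c \<Longrightarrow> vtx d \<noteq> Q \<Longrightarrow> F d = d"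
  by (cases d) (simp add: vswap_def)

lemma regions_E: "regions E = insert L rest"
proof -
  have "h ` rest = rest" using h_rest by force
  then show ?thesis unfolding e.regions_E regions_rest'(1) image_insert by (simp only: h_def simp_thms if_True)
qed

lemma zero_E: "0 \<in> regions D'"
  using zero_rest regions_rest'(1) by simp

lemma dart_E [simp]: "((A, a), b) \<in> darts E" "((B, a), b) \<in> darts E" "((Q, a), b) \<in> darts E"
  using mem by (simp_all add: dart_in crs')

lemma alpha_E:
  "alpha E ((A, i), \<not> ox) = ((B, j), ox)" "alpha E ((B, j), ox) = ((A, i), \<not> ox)"
  "alpha E ((A, \<not> i), oy) = ((Q, k), \<not> oy)" "alpha E ((Q, k), \<not> oy) = ((A, \<not> i), oy)"
  "alpha E ((B, \<not> j), oz) = ((Q, \<not> k), \<not> oz)" "alpha E ((Q, \<not> k), \<not> oz) = ((B, \<not> j), oz)"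
  by (simp_all add: e.E_facts alpha' alpha_inner)

lemma crot_E: "crot (hand E) (F d) = F (crot (hand D') d)"
  by (rule e.crot_f)

text \<open>P is again the crossing near x, but c is now the far one, since Q has taken its place in
  \<open>E\<close>. The label \<open>tau\<close> is free for the bigon because the old triangle was
  the only carrier of it.\<close>

sublocale c2: corner E A B P c i j k "\<not> ox" "\<not> oy" "\<not> oz" R' tau
proof
  show "valid E" by (rule e.valid_E[OF zero_E])
  show "crot (hand E) ((A, \<not> i), \<not> \<not> oy) = ((A, i), \<not> ox)"
    using crot_E[of "((A, \<not> i), oy)"] by (simp add: crot' rot)
  show "crot (hand E) ((B, j), \<not> \<not> ox) = ((B, \<not> j), \<not> \<not> oz)"
    using crot_E[of "((B, j), ox)"] by (simp add: crot' rot)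
  show "alpha E ((A, i), \<not> ox) = ((B, j), \<not> \<not> ox)" by (simp add: alpha_E)
  have "tau \<in> regions D" by (simp add: regions_rest)
  then show "tau \<noteq> R'" "tau \<notin> regions E" "R' \<notin> regions E"
    using lab regions_rest regions_E by auto
qed (use mem PQ crs' face_nz lab in auto)

text \<open>From the other side of x the roles of A and B, and with them those of y and z, are
  exchanged; hence the negated \<open>k\<close>.\<close>

abbreviation "S \<equiv> tsw B A P j i (\<not> k)"

lemma S_simps [simp]:
  "S ((A, i), b) = ((B, j), b)" "S ((B, j), b) = ((A, i), b)"
  "S ((A, \<not> i), b) = ((P, k), b)" "S ((P, k), b) = ((A, \<not> i), b)"
  "S ((B, \<not> j), b) = ((P, \<not> k), b)" "S ((P, \<not> k), b) = ((B, \<not> j), b)"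
  "S ((c, a), b) = ((c, a), b)" "S ((Q, a), b) = ((Q, a), b)"
  by (simp_all add: tsw_def)

lemma S_other: "vtx d \<noteq> A \<Longrightarrow> vtx d \<noteq> B \<Longrightarrow> vtx d \<noteq> P \<Longrightarrow> S d = d"
  by (cases d) (auto simp: tsw_def)

lemma S_S: "S (S d) = d"
  by (rule tsw_tsw) auto

lemma T_E: "d \<in> darts D \<Longrightarrow> F (T d) \<in> darts E"
  using T_in e.f_E darts' by blast

text \<open>The core of the comparison: off the triangle, R2 followed by the auxiliary swap acts on
  darts as the original swap, followed by the renaming of c to Q and the second R2
  construction.\<close>

lemma S_stub:
  assumes d: "d \<in> rim"
  shows "S (c1.stub d) = c2.stub (F (T d))"
  using d
proof (cases rule: rim_cases)
  case 1
  have i: "d \<in> darts D" using d by (simp add: rim_def)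
  then have v: "vtx d \<noteq> P" "vtx d \<noteq> Q" using PQ by (auto simp: dart_in)
  have s: "c1.stub d = d" by (rule c1.stub_other[OF i]) (use 1 in auto)
  have t: "F (T d) = d" using 1 v by (simp add: T_other F_other)
  then have "d \<in> darts E" using T_E[OF i] by simp
  then have "c2.stub d = d" by (rule c2.stub_other) (use 1 in auto)
  then show ?thesis using s t 1 v by (simp add: S_other)
qed (simp_all add: c1.stub_def c2.stub_def)

lemma c2_alpha1_internal:
  "c2.alpha1 ((A, \<not> i), \<not> oy) = ((P, k), oy)" "c2.alpha1 ((P, k), oy) = ((A, \<not> i), \<not> oy)"
  "c2.alpha1 ((P, k), \<not> oy) = ((c, k), oy)" "c2.alpha1 ((c, k), oy) = ((P, k), \<not> oy)"
  "c2.alpha1 ((B, \<not> j), \<not> oz) = ((P, \<not> k), oz)" "c2.alpha1 ((P, \<not> k), oz) = ((B, \<not> j), \<not> oz)"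
  "c2.alpha1 ((P, \<not> k), \<not> oz) = ((c, \<not> k), oz)" "c2.alpha1 ((c, \<not> k), oz) = ((P, \<not> k), \<not> oz)"
  by (simp_all add: c2.alpha1_def)

lemma c2_alpha1_old:
  "c2.alpha1 ((A, i), \<not> ox) = ((B, j), ox)" "c2.alpha1 ((B, j), ox) = ((A, i), \<not> ox)"
  "c2.alpha1 ((A, \<not> i), oy) = ((Q, k), \<not> oy)" "c2.alpha1 ((Q, k), \<not> oy) = ((A, \<not> i), oy)"
  "c2.alpha1 ((B, \<not> j), oz) = ((Q, \<not> k), \<not> oz)" "c2.alpha1 ((Q, \<not> k), \<not> oz) = ((B, \<not> j), oz)"
  by (simp_all add: c2.alpha1_def c2.stub_def alpha_E)

lemma c1_alpha1_old:
  "c1.alpha1 ((A, i), ox) = ((B, j), \<not> ox)" "c1.alpha1 ((B, j), \<not> ox) = ((A, i), ox)"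
  "c1.alpha1 ((A, \<not> i), \<not> oy) = ((c, k), oy)" "c1.alpha1 ((c, k), oy) = ((A, \<not> i), \<not> oy)"
  "c1.alpha1 ((B, \<not> j), \<not> oz) = ((c, \<not> k), oz)" "c1.alpha1 ((c, \<not> k), oz) = ((B, \<not> j), \<not> oz)"
  by (simp_all add: c1.alpha1_def c1.stub_def alpha_inner)

lemma rim_or_inner: "d \<in> darts D \<Longrightarrow> d \<in> rim \<or> d \<in> inner"
  by (auto simp: rim_def)

lemma stub_inner: "d \<in> inner \<Longrightarrow> c1.stub d = d"
  unfolding inner_def by (elim insertE emptyE) (simp_all add: c1.stub_def)

text \<open>For images of rim darts both sides are conjugates of \<open>alpha D\<close>, and
  \<open>S_stub\<close> matches the conjugations. The internal darts and the sides of ABc are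
  finitely many and are compared directly.\<close>

lemma alpha1_S:
  assumes d: "d \<in> darts c1.D1"
  shows "c2.alpha1 (S d) = S (c1.alpha1 d)"
  using d
proof (cases rule: c1.darts1_cases)
  case 1
  then show ?thesis
    unfolding c1.internal_def
    by (elim insertE emptyE) (simp_all add: c1.alpha1_internal c2_alpha1_internal c2_alpha1_old)
next
  case (2 g)
  then consider "g \<in> rim" | "g \<in> inner" using rim_or_inner by blast
  then show ?thesis
  proof cases
    case 1
    have i: "F (T g) \<in> darts E" "T g \<in> darts D'" using T_E T_in 2 darts' by auto
    have "c2.alpha1 (S d) = c2.stub (alpha E (F (T g)))"
      using S_stub[OF 1] c2.stub_old[OF i(1)] 2 by (simp add: c2.alpha1_external c2.stub_stub)
    also have "alpha E (F (T g)) = F (T (alpha D g))"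
      using i 2 alpha'_T by (simp add: e.E_facts)
    also have "c2.stub \<dots> = S (c1.stub (alpha D g))" using S_stub[OF alpha_rim[OF 1]] by simp
    also have "c1.stub (alpha D g) = c1.alpha1 d"
      using c1.stub_old[OF 2(1)] 2 by (simp add: c1.alpha1_external c1.stub_stub)
    finally show ?thesis .
  next
    case 3: 2
    then have "d \<in> inner" using 2 stub_inner by simp
    then show ?thesis
      unfolding inner_def
      by (elim insertE emptyE) (simp_all add: c1_alpha1_old c2_alpha1_internal c2_alpha1_old)
  qed
qed

lemma darts_eq: "darts c2.D1 = darts c1.D1"
  using mem crs' by (auto simp: dart_in)

lemma S_in: "d \<in> darts c1.D1 \<Longrightarrow> S d \<in> darts c1.D1"
  using mem by (auto simp: dart_in tsw_def)

lemma triangle1: "triangle c1.D1 B A P j i (\<not> k) (\<not> ox) (\<not> oz) (\<not> oy)"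
proof
  show "valid c1.D1" by (rule c1.valid_D1)
qed (use mem in \<open>simp_all add: c1.D1_facts c1.dart1_mem c1.alpha1_internal c1_alpha1_old
      c1.rot1_old c1.rot1_new rot\<close>)

lemma rho'_rim:
  "rho D' ((B, j), \<not> ox) = rho D ((A, i), \<not> ox)" "rho D' ((A, i), ox) = rho D ((B, j), ox)"
  "rho D' ((c, k), oy) = rho D ((A, \<not> i), oy)" "rho D' ((A, \<not> i), \<not> oy) = rho D ((c, k), \<not> oy)"
  "rho D' ((c, \<not> k), oz) = rho D ((B, \<not> j), oz)" "rho D' ((B, \<not> j), \<not> oz) = rho D ((c, \<not> k), \<not> oz)"
  using rho'[OF rim_mem(1)] rho'[OF rim_mem(2)] rho'[OF rim_mem(3)]
    rho'[OF rim_mem(4)] rho'[OF rim_mem(5)] rho'[OF rim_mem(6)] by simp_all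

lemma rho_E_rim: "d \<in> rim \<Longrightarrow> rho E (F (T d)) = rho D d"
proof -
  assume d: "d \<in> rim"
  then have i: "F (T d) \<in> darts E" using T_E by (simp add: rim_def)
  have "rho E (F (T d)) = h (rho D d)" using e.E_facts(3)[OF i] rho'[OF d] by simp
  then show ?thesis using h_rest d by (simp add: rest_def)
qed

lemma rho_E_inner:
  "rho E ((A, \<not> i), oy) = rho D ((B, \<not> j), oz)" "rho E ((Q, k), \<not> oy) = L"
  "rho E ((B, \<not> j), oz) = L" "rho E ((Q, \<not> k), \<not> oz) = rho D ((A, i), \<not> ox)"
proof -
  interpret t: triangle D' A B c i j k "\<not> ox" "\<not> oy" "\<not> oz" by (rule triangle')
  note r = t.rho_inner[simplified]
  have m: "rho D d \<in> rest" if "d \<in> rim" for d using that by (simp add: rest_def)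
  show "rho E ((A, \<not> i), oy) = rho D ((B, \<not> j), oz)"
    "rho E ((Q, \<not> k), \<not> oz) = rho D ((A, i), \<not> ox)"
    by (simp_all add: e.E_facts r rho'_rim h_rest m rim_mem)
  show "rho E ((Q, k), \<not> oy) = L" "rho E ((B, \<not> j), oz) = L"
    by (simp_all add: e.E_facts r h_def)
qed

lemma c2_rho1_simps:
  "c2.rho1 ((P, k), \<not> oy) = rho E ((B, \<not> j), \<not> oz)"
  "c2.rho1 ((c, k), oy) = tau" "c2.rho1 ((P, \<not> k), \<not> oz) = tau"
  "c2.rho1 ((c, \<not> k), oz) = rho E ((A, i), ox)"
  "c2.rho1 ((A, \<not> i), oy) = rho E ((A, \<not> i), oy)" "c2.rho1 ((Q, k), \<not> oy) = rho E ((Q, k), \<not> oy)"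
  "c2.rho1 ((B, \<not> j), oz) = rho E ((B, \<not> j), oz)" "c2.rho1 ((Q, \<not> k), \<not> oz) = rho E ((Q, \<not> k), \<not> oz)"
  by (simp_all add: c2.rho1_def)

text \<open>The excluded set consists of the six inner darts of the triangle ABP, where an R3 move
  leaves the labels open.\<close>

lemma rho1_S:
  assumes d: "d \<in> darts c1.D1"
    and ne: "d \<notin> {((B, j), \<not> ox), ((A, i), ox), ((B, \<not> j), oz), ((P, \<not> k), \<not> oz), ((A, \<not> i), oy), ((P, k), \<not> oy)}"
  shows "c2.rho1 (S d) = c1.rho1 d"
  using d
proof (cases rule: c1.darts1_cases)
  case 1
  then show ?thesis
    unfolding c1.internal_def
    by (elim insertE emptyE) (use ne in \<open>simp_all add: c1.rho1_simps c2_rho1_simps rho_E_inner\<close>)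
next
  case (2 g)
  then consider "g \<in> rim" | "g \<in> inner" using rim_or_inner by blast
  then show ?thesis
  proof cases
    case 1
    have "g \<noteq> ((B, j), \<not> ox)" using 1 by (auto simp: rim_def inner_def)
    then have "c1.rho1 d = rho D g" using c1.rho1_stub[OF 2(1)] 2 by simp
    moreover have "F (T g) \<noteq> ((B, j), ox)"
    proof
      assume "F (T g) = ((B, j), ox)"
      then have "F (F (T g)) = ((B, j), ox)" by simp
      then have "T (T g) = ((A, i), ox)" by simp
      then show False using T_T[OF 2(1)] 1 by (simp add: rim_def inner_def)
    qed
    then have "c2.rho1 (S d) = rho E (F (T g))"
      using c2.rho1_stub[OF T_E[OF 2(1)]] S_stub[OF 1] 2 by simp
    ultimately show ?thesis using rho_E_rim[OF 1] by simp
  next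
    case 3: 2
    have E: "rho E ((B, \<not> j), \<not> oz) = rho D ((c, \<not> k), \<not> oz)" "rho E ((A, i), ox) = rho D ((B, j), ox)"
      using rho_E_rim[OF rim_mem(6)] rho_E_rim[OF rim_mem(3)] by simp_all
    have old: "c1.rho1 ((A, \<not> i), \<not> oy) = rho D ((A, \<not> i), \<not> oy)" "c1.rho1 ((c, k), oy) = rho D ((c, k), oy)"
      "c1.rho1 ((B, \<not> j), \<not> oz) = rho D ((B, \<not> j), \<not> oz)" "c1.rho1 ((c, \<not> k), oz) = rho D ((c, \<not> k), oz)"
      by (simp_all add: c1.rho1_def)
    have "d \<in> inner" using 3 2 stub_inner by simp
    then show ?thesis
      unfolding inner_def
      by (elim insertE emptyE) (use ne in \<open>simp_all add: c2_rho1_simps E old rho_inner\<close>)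
  qed
qed

text \<open>Q is a copy of c, whose handedness is forced by \<open>rot_c\<close>. P has the opposite
  one, and its formula is invariant under negating both \<open>oy\<close> and
  \<open>oz\<close>.\<close>

lemma hand_eq: "v \<in> crs c1.D1 \<Longrightarrow> c2.hand1 v = c1.hand1 v"
proof -
  assume v: "v \<in> crs c1.D1"
  have hc: "hand D c = (k \<noteq> (oy \<noteq> oz))" using rot_c by (auto simp: crot_def)
  consider "v = P" | "v = Q" | "v = c" | "v \<in> crs D" "v \<noteq> P" "v \<noteq> Q" "v \<noteq> c" using v by auto
  then show ?thesis
    by cases (use mem in \<open>auto simp: c1.hand1_def c2.hand1_def hand' hc\<close>)
qed

lemma r3t_step: "r3t c1.D1 B A P j i (\<not> k) (\<not> ox) (\<not> oz) (\<not> oy) c2.D1"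
proof -
  interpret t: triangle c1.D1 B A P j i "\<not> k" "\<not> ox" "\<not> oz" "\<not> oy" by (rule triangle1)
  have r: "rho c1.D1 ((B, j), \<not> ox) = R'"
    by (simp add: c1.D1_facts c1.dart1_mem c1.rho1_simps)
  show ?thesis
  proof
    show "valid c2.D1" by (rule c2.valid_D1)
    show "rho c1.D1 ((B, j), \<not> ox) \<noteq> 0" using r lab by simp
    show "d = ((B, j), \<not> ox) \<or> d = ((A, \<not> i), \<not> \<not> oy) \<or> d = ((P, \<not> k), \<not> oz)"
      if "d \<in> darts c1.D1" "rho c1.D1 d = rho c1.D1 ((B, j), \<not> ox)" for d
      using that c1.rho1_fresh(2)[OF that(1)] r by (simp add: c1.D1_facts)
    show "reg c1.D1 (Circ m, b) \<noteq> rho c1.D1 ((B, j), \<not> ox)" if "m \<in> circs c1.D1" for m b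
    proof -
      have "reg D (Circ m, b) \<in> regions D" using that by (auto simp: regions_eq)
      then show ?thesis using r lab by auto
    qed
    show "crs c2.D1 = crs c1.D1" using mem crs' by auto
    show "circs c2.D1 = circs c1.D1" by (simp add: circs')
    show "hand c2.D1 v = hand c1.D1 v" if "v \<in> crs c1.D1" for v
      using hand_eq[OF that] by simp
    show "alpha c2.D1 d = S (alpha c1.D1 (S d))" if d: "d \<in> darts c1.D1" for d
      using alpha1_S[OF S_in[OF d]] S_in[OF d] d
      by (simp add: c1.D1_facts c2.D1_facts darts_eq S_S)
    show "rho c2.D1 (S d) = rho c1.D1 d" if d: "d \<in> t.rim" for d
    proof -
      have i: "d \<in> darts c1.D1" using d by (simp add: t.rim_def)
      have "c2.rho1 (S d) = c1.rho1 d"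
        by (rule rho1_S[OF i]) (use d in \<open>simp add: t.rim_def t.inner_def\<close>)
      then show ?thesis using i S_in[OF i] by (simp add: c1.D1_facts c2.D1_facts darts_eq)
    qed
    show "reg c2.D1 (Circ m, b) = reg c1.D1 (Circ m, b)" if "m \<in> circs c1.D1" for m b
    proof -
      have "reg D (Circ m, b) \<in> rest" using that by (auto simp: rest_def)
      then show ?thesis using that circ'[of m b] h_rest by simp
    qed
  qed
qed

lemma step: "r2 D c1.D1" "r2 E c2.D1" "iso E D'"
  by (rule c1.r2_D1, rule c2.r2_D1, rule e.iso_E[OF zero_E])

end

lemma (in r3t) r3t_neighbour:
  obtains D1 D2 E P where "r2 D D1" "r2 E D2" "iso E D'"
    "r3t D1 B A P j i (\<not> k) (\<not> ox) (\<not> oz) (\<not> oy) D2"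
proof -
  have fr: "finite (insert 0 (regions D \<union> regions D'))"
    using fin_regions valid_pdiag[OF val', THEN pdiag.fin_regions] by simp
  obtain P where P: "P \<notin> crs D" using ex_new_if_finite[OF infinite_UNIV_nat fin] by blast
  obtain Q where Q: "Q \<notin> insert P (crs D)"
    using ex_new_if_finite[OF infinite_UNIV_nat, of "insert P (crs D)"] fin by auto
  obtain R' where R: "R' \<notin> insert 0 (regions D \<union> regions D')"
    using ex_new_if_finite[OF infinite_UNIV_nat fr] by blast
  obtain L where L: "L \<notin> insert R' (insert 0 (regions D \<union> regions D'))"
    using ex_new_if_finite[OF infinite_UNIV_nat, of "insert R' (insert 0 (regions D \<union> regions D'))"] fr by auto
  interpret s: r3_step D A B c i j k ox oy oz D' P Q R' L
    by unfold_locales (use P Q R L in auto)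
  show ?thesis using that s.step s.r3t_step by blast
qed

section \<open>Translation to the arrow encoding\<close>

lemma (in pdiag) strand_iff:
  assumes "p \<in> passages D" "q \<in> passages D"
  shows "psucc D (if b then p else q) = (if b then q else p) \<longleftrightarrow> alpha D (p, b) = (q, \<not> b)"
  using assms ppred_psucc[of q] psucc_ppred[of p] by (cases b) (auto simp: alpha_def)

lemma strand_side:
  assumes "alpha D (p, b) = (q, \<not> b)"
  shows "fst (sd D (p, b)) = Pas (if b then p else q)"
  using assms by (cases b) (auto simp: sd_def alpha_def)

definition dface :: "diag \<Rightarrow> dart \<Rightarrow> dart \<Rightarrow> dart \<Rightarrow> bool" where
  "dface D d e g \<longleftrightarrow> rho D d \<noteq> 0 \<and> rho D e = rho D d \<and> rho D g = rho D d
     \<and> (\<forall>x\<in>darts D. rho D x = rho D d \<longrightarrow> x \<in> {d, e, g})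
     \<and> (\<forall>m\<in>circs D. \<forall>b. reg D (Circ m, b) \<noteq> rho D d)"

lemma (in pdiag) face_iff:
  assumes d: "d \<in> darts D" "e \<in> darts D" "g \<in> darts D"
  shows "reg D (sd D d) \<noteq> 0 \<and> {s \<in> sides D. reg D s = reg D (sd D d)} = {sd D d, sd D e, sd D g}
    \<longleftrightarrow> dface D d e g"
proof -
  define C where "C = Circ ` circs D \<times> (UNIV :: bool set)"
  let ?S = "{s \<in> sides D. reg D s = rho D d}"
  have S: "?S = sd D ` {x \<in> darts D. rho D x = rho D d} \<union> {s \<in> C. reg D s = rho D d}"
    unfolding sides_eq rho_def C_def[symmetric] by blast
  have c: "sd D x \<notin> C" for x by (auto simp: sd_def C_def)
  have "?S = {sd D d, sd D e, sd D g} \<longleftrightarrow>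
      {x \<in> darts D. rho D x = rho D d} = {d, e, g} \<and> {s \<in> C. reg D s = rho D d} = {}"
  proof
    assume eq: "?S = {sd D d, sd D e, sd D g}"
    have "sd D ` {x \<in> darts D. rho D x = rho D d} = ?S - C"
      unfolding S using c by blast
    also have "\<dots> = sd D ` {d, e, g}" unfolding eq using c by blast
    finally have "{x \<in> darts D. rho D x = rho D d} = {d, e, g}"
      by (subst (asm) inj_on_image_eq_iff[OF inj_sd]) (use d in auto)
    moreover have "{s \<in> C. reg D s = rho D d} = {}"
    proof (rule equals0I)
      fix s assume s: "s \<in> {s \<in> C. reg D s = rho D d}"
      then have "s \<in> {sd D d, sd D e, sd D g}" unfolding eq[symmetric] S by (rule UnI2)
      then show False using s c by (elim insertE emptyE) simp_all
    qed
    ultimately show "{x \<in> darts D. rho D x = rho D d} = {d, e, g} \<and>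
      {s \<in> C. reg D s = rho D d} = {}" ..
  next
    assume "{x \<in> darts D. rho D x = rho D d} = {d, e, g} \<and>
      {s \<in> C. reg D s = rho D d} = {}"
    then show "?S = {sd D d, sd D e, sd D g}"
      unfolding S by (elim conjE) (simp only: image_insert image_empty Un_empty_right)
  qed
  also have "{x \<in> darts D. rho D x = rho D d} = {d, e, g} \<longleftrightarrow> rho D e = rho D d \<and> rho D g = rho D d
      \<and> (\<forall>x\<in>darts D. rho D x = rho D d \<longrightarrow> x \<in> {d, e, g})"
    using d by blast
  also have "{s \<in> C. reg D s = rho D d} = {} \<longleftrightarrow>
      (\<forall>m\<in>circs D. \<forall>b. reg D (Circ m, b) \<noteq> rho D d)"
    unfolding C_def by blast
  finally show ?thesis unfolding dface_def rho_def by blast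
qed

definition tsd :: "nat \<Rightarrow> nat \<Rightarrow> nat \<Rightarrow> dart \<Rightarrow> dart" where
  "tsd u v w d = (tswap u v w (fst d), snd d)"

lemma tsd_tsw:
  assumes "u \<noteq> v" "u \<noteq> w" "v \<noteq> w"
  shows "tsd u v w = tsw u v w True True True" "tsd u v w = tsw v u w True True False"
  using assms by (auto simp: tsd_def tsw_def tswap_def fun_eq_iff)

text \<open>The clause for successors is the one for leaving darts. It yields the clause for
  arriving darts because \<open>tswap\<close> is an involution.\<close>

lemma psucc_tswap_iff:
  assumes D: "pdiag D" and D': "pdiag D'" and uvw: "u \<noteq> v" "u \<noteq> w" "v \<noteq> w" "u \<in> crs D" "v \<in> crs D" "w \<in> crs D"
    and crs: "crs D' = crs D"
  shows "(\<forall>y\<in>passages D. psucc D' y = tswap u v w (psucc D (tswap u v w y))) \<longleftrightarrow>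
    (\<forall>d\<in>darts D. alpha D' d = tsd u v w (alpha D (tsd u v w d)))" (is "?L \<longleftrightarrow> ?R")
proof
  interpret pdiag D by fact
  interpret D': pdiag D' by fact
  have tt: "tswap u v w (tswap u v w y) = y" for y using uvw by (auto simp: tswap_def)
  have ti: "tswap u v w y \<in> passages D" if "y \<in> passages D" for y
    using that uvw by (auto simp: tswap_def passages_def)
  have ps: "passages D' = passages D" by (simp add: passages_def crs)
  show ?R if L: ?L
  proof
    fix d assume "d \<in> darts D"
    then obtain p b where d: "d = (p, b)" "p \<in> passages D" by (auto simp: darts_def)
    show "alpha D' d = tsd u v w (alpha D (tsd u v w d))"
    proof (cases b)
      case True
      then show ?thesis using L d by (simp add: alpha_def tsd_def)
    next
      case False
      let ?q = "tswap u v w (ppred D (tswap u v w p))"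
      have q: "?q \<in> passages D" using ti ppred_in d by blast
      have "psucc D' ?q = p" using L q psucc_ppred[OF ti[OF d(2)]] by (simp add: tt)
      then have "ppred D' p = ?q" using D'.ppred_psucc[of ?q] q ps by simp
      then show ?thesis using d False by (simp add: alpha_def tsd_def)
    qed
  qed
  show ?L if R: ?R
  proof
    fix y assume "y \<in> passages D"
    then have "(y, True) \<in> darts D" by (simp add: darts_def)
    from R[rule_format, OF this] show "psucc D' y = tswap u v w (psucc D (tswap u v w y))"
      by (simp add: alpha_def tsd_def)
  qed
qed

text \<open>\<open>I\<close> is closed under \<open>alpha\<close>, hence a union of whole edges, and
  excluding the edges in \<open>X\<close> means excluding its darts. By \<open>al\<close> the swap
  maps edges to edges, so \<open>ren3\<close> on sides becomes \<open>tsd\<close> on darts.\<close>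

lemma reg_tswap_iff:
  assumes D: "pdiag D" and al: "\<forall>d\<in>darts D. alpha D' d = tsd u v w (alpha D (tsd u v w d))"
    and uvw: "u \<noteq> v" "u \<noteq> w" "v \<noteq> w" "u \<in> crs D" "v \<in> crs D" "w \<in> crs D"
    and I: "I \<subseteq> darts D" "\<And>d. d \<in> I \<Longrightarrow> alpha D d \<in> I" "X = (\<lambda>d. fst (sd D d)) ` I"
  shows "(\<forall>e b. (e, b) \<in> sides D \<longrightarrow> e \<notin> X \<longrightarrow> reg D' (ren3 u v w e, b) = reg D (e, b)) \<longleftrightarrow>
    (\<forall>d\<in>darts D - I. rho D' (tsd u v w d) = rho D d) \<and>
    (\<forall>m\<in>circs D. \<forall>b. reg D' (Circ m, b) = reg D (Circ m, b))" (is "?L \<longleftrightarrow> ?R")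
proof -
  interpret pdiag D by fact
  have tt: "tsd u v w (tsd u v w d) = d" for d using uvw by (cases d) (auto simp: tsd_def tswap_def)
  have ti: "tsd u v w d \<in> darts D" if "d \<in> darts D" for d
    using that uvw by (auto simp: tsd_def tswap_def dart_in)
  have X: "fst (sd D d) \<in> X \<longleftrightarrow> d \<in> I" if d: "d \<in> darts D" for d
  proof
    assume "fst (sd D d) \<in> X"
    then obtain e where e: "e \<in> I" "fst (sd D e) = fst (sd D d)" unfolding I(3) by force
    then have "d = e \<or> d = alpha D e" using fst_sd_eq d I(1) by blast
    then show "d \<in> I" using e I(2) by blast
  qed (use I(3) in blast)
  have s: "(ren3 u v w (fst (sd D d)), snd d) = sd D' (tsd u v w d)" if d: "d \<in> darts D" for d
  proof (cases "snd d")
    case True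
    then show ?thesis by (simp add: sd_def tsd_def)
  next
    case False
    have "alpha D' (tsd u v w d) = tsd u v w (alpha D d)" using al ti[OF d] by (simp add: tt)
    then have "ppred D' (tswap u v w (fst d)) = tswap u v w (ppred D (fst d))"
      using False by (simp add: alpha_def tsd_def)
    then show ?thesis using False by (simp add: sd_def tsd_def)
  qed
  have snd_sd: "snd (sd D d) = snd d" for d by (simp add: sd_def)
  have "(\<forall>e b. (e, b) \<in> sides D \<longrightarrow> e \<notin> X \<longrightarrow> reg D' (ren3 u v w e, b) = reg D (e, b)) \<longleftrightarrow>
    (\<forall>s\<in>sides D. fst s \<notin> X \<longrightarrow> reg D' (ren3 u v w (fst s), snd s) = reg D s)"
    by auto
  also have "\<dots> \<longleftrightarrow> (\<forall>s\<in>sd D ` darts D. fst s \<notin> X \<longrightarrow> reg D' (ren3 u v w (fst s), snd s) = reg D s)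
    \<and> (\<forall>s\<in>Circ ` circs D \<times> UNIV. fst s \<notin> X \<longrightarrow> reg D' (ren3 u v w (fst s), snd s) = reg D s)"
    unfolding sides_eq by blast
  also have "(\<forall>s\<in>sd D ` darts D. fst s \<notin> X \<longrightarrow> reg D' (ren3 u v w (fst s), snd s) = reg D s) \<longleftrightarrow>
    (\<forall>d\<in>darts D. d \<notin> I \<longrightarrow> rho D' (tsd u v w d) = rho D d)"
    using X s unfolding rho_def by (simp add: snd_sd del: split_paired_All)
  also have "(\<forall>s\<in>Circ ` circs D \<times> UNIV. fst s \<notin> X \<longrightarrow> reg D' (ren3 u v w (fst s), snd s) = reg D s) \<longleftrightarrow>
    (\<forall>m\<in>circs D. \<forall>b. reg D' (Circ m, b) = reg D (Circ m, b))"
  proof -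
    have "Circ m \<notin> X" for m unfolding I(3) by (auto simp: sd_def)
    then show ?thesis by auto
  qed
  finally show ?thesis by blast
qed

definition r3d :: "diag \<Rightarrow> diag \<Rightarrow> nat \<Rightarrow> nat \<Rightarrow> nat \<Rightarrow> bool \<Rightarrow> bool \<Rightarrow> bool \<Rightarrow> bool" where
  "r3d D D' u v w o1 o2 o3 \<longleftrightarrow> valid D \<and> valid D'
     \<and> u \<noteq> v \<and> u \<noteq> w \<and> v \<noteq> w \<and> u \<in> crs D \<and> v \<in> crs D \<and> w \<in> crs D
     \<and> alpha D ((u, True), o1) = ((v, True), \<not> o1)
     \<and> alpha D ((u, False), o2) = ((w, True), \<not> o2)
     \<and> alpha D ((v, False), o3) = ((w, False), \<not> o3)
     \<and> crs D' = crs D \<and> circs D' = circs D \<and> (\<forall>c\<in>crs D. hand D' c = hand D c)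
     \<and> (\<forall>d\<in>darts D. alpha D' d = tsd u v w (alpha D (tsd u v w d)))
     \<and> (\<forall>d\<in>darts D - {((u, True), o1), ((v, True), \<not> o1), ((u, False), o2), ((w, True), \<not> o2),
            ((v, False), o3), ((w, False), \<not> o3)}. rho D' (tsd u v w d) = rho D d)
     \<and> (\<forall>m\<in>circs D. \<forall>b. reg D' (Circ m, b) = reg D (Circ m, b))"

text \<open>The conditional darts are those with sides \<open>(Pas t1, b1)\<close>,
  \<open>(Pas t2, b2)\<close> and \<open>(Pas t3, b3)\<close>: a left side is seen when leaving
  along the orientation, a right side when leaving against it.\<close>

lemma r3_iff:
  "r3 x D D' \<longleftrightarrow> (\<exists>u v w o1 o2 o3 b1 b2 b3. r3d D D' u v w o1 o2 o3
     \<and> dface D (if b1 = o1 then ((u, True), o1) else ((v, True), \<not> o1))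
               (if b2 = o2 then ((u, False), o2) else ((w, True), \<not> o2))
               (if b3 = o3 then ((v, False), o3) else ((w, False), \<not> o3))
     \<and> x = (if b1 then r3tbl o1 o2 o3 else r3tbl (\<not> o1) (\<not> o2) (\<not> o3)))"
proof (cases "valid D \<and> valid D'")
  case False
  then show ?thesis by (auto simp: r3_def r3d_def)
next
  case True
  then have p: "pdiag D" "pdiag D'" by (auto intro: valid_pdiag)
  interpret pdiag D by (rule p)
  have main: "(let t1 = (if o1 then (u, True) else (v, True));
           t2 = (if o2 then (u, False) else (w, True));
           t3 = (if o3 then (v, False) else (w, False))
       in u \<noteq> v \<and> u \<noteq> w \<and> v \<noteq> w \<and> u \<in> crs D \<and> v \<in> crs D \<and> w \<in> crs D
        \<and> psucc D t1 = (if o1 then (v, True) else (u, True))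
        \<and> psucc D t2 = (if o2 then (w, True) else (u, False))
        \<and> psucc D t3 = (if o3 then (w, False) else (v, False))
        \<and> reg D (Pas t1, b1) \<noteq> 0
        \<and> {s \<in> sides D. reg D s = reg D (Pas t1, b1)} = {(Pas t1, b1), (Pas t2, b2), (Pas t3, b3)}
        \<and> x = (if b1 then r3tbl o1 o2 o3 else r3tbl (\<not> o1) (\<not> o2) (\<not> o3))
        \<and> crs D' = crs D \<and> circs D' = circs D
        \<and> (\<forall>c\<in>crs D. hand D' c = hand D c)
        \<and> (\<forall>y\<in>passages D. psucc D' y = tswap u v w (psucc D (tswap u v w y)))
        \<and> (\<forall>e b. (e, b) \<in> sides D \<longrightarrow> e \<notin> {Pas t1, Pas t2, Pas t3} \<longrightarrow>
              reg D' (ren3 u v w e, b) = reg D (e, b)))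
    \<longleftrightarrow> r3d D D' u v w o1 o2 o3
     \<and> dface D (if b1 = o1 then ((u, True), o1) else ((v, True), \<not> o1))
               (if b2 = o2 then ((u, False), o2) else ((w, True), \<not> o2))
               (if b3 = o3 then ((v, False), o3) else ((w, False), \<not> o3))
     \<and> x = (if b1 then r3tbl o1 o2 o3 else r3tbl (\<not> o1) (\<not> o2) (\<not> o3))" (is "?lhs \<longleftrightarrow> ?rhs")
    for u v w o1 o2 o3 b1 b2 b3
  \<comment> \<open>Both sides imply this condition, and it provides the side conditions for
    translating the face and label clauses.\<close>
  proof (cases "u \<noteq> v \<and> u \<noteq> w \<and> v \<noteq> w \<and> u \<in> crs D \<and> v \<in> crs D \<and> w \<in> crs D
      \<and> crs D' = crs D \<and> alpha D ((u, True), o1) = ((v, True), \<not> o1)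
      \<and> alpha D ((u, False), o2) = ((w, True), \<not> o2) \<and> alpha D ((v, False), o3) = ((w, False), \<not> o3)")
    case c: True
    then have mem: "(u, b) \<in> passages D" "(v, b) \<in> passages D" "(w, b) \<in> passages D" for b
      by (auto simp: passages_def)
    then have dm: "((u, b), b') \<in> darts D" "((v, b), b') \<in> darts D" "((w, b), b') \<in> darts D" for b b'
      by (auto simp: darts_def)
    let ?t1 = "if o1 then (u, True) else (v, True)"
    let ?t2 = "if o2 then (u, False) else (w, True)"
    let ?t3 = "if o3 then (v, False) else (w, False)"
    let ?d1 = "if b1 = o1 then ((u, True), o1) else ((v, True), \<not> o1)"
    let ?d2 = "if b2 = o2 then ((u, False), o2) else ((w, True), \<not> o2)"
    let ?d3 = "if b3 = o3 then ((v, False), o3) else ((w, False), \<not> o3)"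
    let ?I = "{((u, True), o1), ((v, True), \<not> o1), ((u, False), o2), ((w, True), \<not> o2),
            ((v, False), o3), ((w, False), \<not> o3)}"
    have a: "alpha D ((u, True), o1) = ((v, True), \<not> o1)" "alpha D ((u, False), o2) = ((w, True), \<not> o2)"
      "alpha D ((v, False), o3) = ((w, False), \<not> o3)" using c by auto
    then have a': "alpha D ((v, True), \<not> o1) = ((u, True), o1)" "alpha D ((w, True), \<not> o2) = ((u, False), o2)"
      "alpha D ((w, False), \<not> o3) = ((v, False), o3)"
      using alpha_alpha dm by metis+
    have f: "fst (sd D ((u, True), o1)) = Pas ?t1" "fst (sd D ((u, False), o2)) = Pas ?t2"
      "fst (sd D ((v, False), o3)) = Pas ?t3"
      using strand_side[OF a(1)] strand_side[OF a(2)] strand_side[OF a(3)] by simp_all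
    then have f': "fst (sd D ((v, True), \<not> o1)) = Pas ?t1" "fst (sd D ((w, True), \<not> o2)) = Pas ?t2"
      "fst (sd D ((w, False), \<not> o3)) = Pas ?t3"
      using fst_sd_alpha[OF dm(1), of True o1] fst_sd_alpha[OF dm(1), of False o2]
        fst_sd_alpha[OF dm(2), of False o3] unfolding a by simp_all
    have sn: "snd (sd D d) = snd d" for d by (simp add: sd_def)
    have s: "sd D ?d1 = (Pas ?t1, b1)" "sd D ?d2 = (Pas ?t2, b2)" "sd D ?d3 = (Pas ?t3, b3)"
      using f f' by (auto simp: prod_eq_iff sn simp del: split_paired_All)
    have face: "(reg D (Pas ?t1, b1) \<noteq> 0
        \<and> {s \<in> sides D. reg D s = reg D (Pas ?t1, b1)} = {(Pas ?t1, b1), (Pas ?t2, b2), (Pas ?t3, b3)})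
        \<longleftrightarrow> dface D ?d1 ?d2 ?d3"
      unfolding s[symmetric] by (rule face_iff) (use dm in auto)
    have X: "{Pas ?t1, Pas ?t2, Pas ?t3} = (\<lambda>d. fst (sd D d)) ` ?I"
      unfolding image_insert image_empty f f' by blast
    have ps: "(\<forall>y\<in>passages D. psucc D' y = tswap u v w (psucc D (tswap u v w y))) \<longleftrightarrow>
      (\<forall>d\<in>darts D. alpha D' d = tsd u v w (alpha D (tsd u v w d)))"
      by (rule psucc_tswap_iff[OF p]) (use c in auto)
    have rg: "(\<forall>e b. (e, b) \<in> sides D \<longrightarrow> e \<notin> {Pas ?t1, Pas ?t2, Pas ?t3} \<longrightarrow>
              reg D' (ren3 u v w e, b) = reg D (e, b)) \<longleftrightarrow>
       (\<forall>d\<in>darts D - ?I. rho D' (tsd u v w d) = rho D d) \<and>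
       (\<forall>m\<in>circs D. \<forall>b. reg D' (Circ m, b) = reg D (Circ m, b))"
      if "\<forall>d\<in>darts D. alpha D' d = tsd u v w (alpha D (tsd u v w d))"
    proof (rule reg_tswap_iff[OF p(1) that])
      show "?I \<subseteq> darts D" using dm by blast
      show "alpha D d \<in> ?I" if "d \<in> ?I" for d
        using that a a' by (elim insertE emptyE) simp_all
      show "{Pas ?t1, Pas ?t2, Pas ?t3} = (\<lambda>d. fst (sd D d)) ` ?I" by (rule X)
    qed (use c in auto)
    have str: "psucc D ?t1 = (if o1 then (v, True) else (u, True))"
      "psucc D ?t2 = (if o2 then (w, True) else (u, False))"
      "psucc D ?t3 = (if o3 then (w, False) else (v, False))"
      using strand_iff[OF mem(1)[of True] mem(2)[of True], of o1] strand_iff[OF mem(1)[of False] mem(3)[of True], of o2]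
        strand_iff[OF mem(2)[of False] mem(3)[of False], of o3] a by blast+
    have face': "(reg D (Pas ?t1, b1) \<noteq> 0
        \<and> {s \<in> sides D. reg D s = reg D (Pas ?t1, b1)} = {(Pas ?t1, b1), (Pas ?t2, b2), (Pas ?t3, b3)} \<and> R)
        \<longleftrightarrow> dface D ?d1 ?d2 ?d3 \<and> R" for R
      by (simp only: face[symmetric] conj_assoc)
    have psrg: "(\<forall>y\<in>passages D. psucc D' y = tswap u v w (psucc D (tswap u v w y))) \<and>
        (\<forall>e b. (e, b) \<in> sides D \<longrightarrow> e \<notin> {Pas ?t1, Pas ?t2, Pas ?t3} \<longrightarrow>
              reg D' (ren3 u v w e, b) = reg D (e, b)) \<longleftrightarrow>
        (\<forall>d\<in>darts D. alpha D' d = tsd u v w (alpha D (tsd u v w d))) \<and>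
        (\<forall>d\<in>darts D - ?I. rho D' (tsd u v w d) = rho D d) \<and>
        (\<forall>m\<in>circs D. \<forall>b. reg D' (Circ m, b) = reg D (Circ m, b))"
      unfolding ps by (rule conj_cong[OF refl]) (rule rg)
    have c': "u \<noteq> v" "u \<noteq> w" "v \<noteq> w" "u \<in> crs D" "v \<in> crs D" "w \<in> crs D" "crs D' = crs D"
      "valid D" "valid D'"
      using c True by blast+
    show ?thesis
      unfolding Let_def r3d_def str face' psrg
      by (rule iffI; elim conjE; intro conjI; (assumption | rule c' a refl))
  next
    case c: False
    have "\<not> ?rhs" using c unfolding r3d_def by blast
    moreover have "\<not> ?lhs"
    proof
      assume l: ?lhs
      then have mem: "(u, b) \<in> passages D" "(v, b) \<in> passages D" "(w, b) \<in> passages D" for b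
        unfolding Let_def by (auto simp: passages_def)
      show False
        using l c strand_iff[OF mem(1)[of True] mem(2)[of True], of o1] strand_iff[OF mem(1)[of False] mem(3)[of True], of o2]
          strand_iff[OF mem(2)[of False] mem(3)[of False], of o3]
        unfolding Let_def by blast
    qed
    ultimately show ?thesis by blast
  qed
  show ?thesis unfolding r3_def main using True by simp
qed

text \<open>The move type of a triangle whose strand x is the top strand.\<close>

definition btype :: "bool \<Rightarrow> bool \<Rightarrow> bool \<Rightarrow> bool \<Rightarrow> r3move" where
  "btype k ox oy oz = (if k then r3tbl True (oy \<noteq> ox) (oz \<noteq> ox) else r3tbl False (oz \<noteq> ox) (oy \<noteq> ox))"

lemma dface_commute: "dface D d e g \<Longrightarrow> dface D d g e"
  unfolding dface_def insert_iff by blast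

lemma r3tI:
  assumes t: "triangle D A B c i j k ox oy oz" and v: "valid D'"
    and f: "dface D ((A, i), ox) ((B, \<not> j), \<not> oz) ((c, k), oy)"
    and "crs D' = crs D" "circs D' = circs D" "\<forall>v\<in>crs D. hand D' v = hand D v"
    and "\<forall>d\<in>darts D. alpha D' d = tsw A B c i j k (alpha D (tsw A B c i j k d))"
    and r: "\<forall>d\<in>darts D - I. rho D' (tsw A B c i j k d) = rho D d"
    and I: "I \<subseteq> {((A, i), ox), ((B, j), \<not> ox), ((A, \<not> i), \<not> oy), ((c, k), oy), ((B, \<not> j), \<not> oz), ((c, \<not> k), oz)}"
    and "\<forall>m\<in>circs D. \<forall>b. reg D' (Circ m, b) = reg D (Circ m, b)"
  shows "r3t D A B c i j k ox oy oz D'"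
proof -
  interpret triangle D A B c i j k ox oy oz by (rule t)
  show ?thesis
  proof
    have "I \<subseteq> inner" using I by (simp only: inner_def)
    then show "rho D' (tsw A B c i j k d) = rho D d" if "d \<in> rim" for d
      using that r unfolding rim_def by blast
    show "d = ((A, i), ox) \<or> d = ((B, \<not> j), \<not> oz) \<or> d = ((c, k), oy)"
      if "d \<in> darts D" "rho D d = rho D ((A, i), ox)" for d
      using that f unfolding dface_def by blast
    show "reg D (Circ m, b) \<noteq> rho D ((A, i), ox)" if "m \<in> circs D" for m b
      using that f unfolding dface_def by blast
    show "rho D ((A, i), ox) \<noteq> 0" using f unfolding dface_def by blast
  qed (use assms in auto)
qed

text \<open>The description of a triangle starts at an arbitrary side. The flags change because y is
  traversed towards A in the cyclic order but described as leaving A.\<close>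

lemma (in r3t) r3t_rotate: "r3t D B c A (\<not> j) (\<not> k) i (\<not> oz) ox (\<not> oy) D'"
proof -
  have T: "tsw A B c i j k d = tsw B c A (\<not> j) (\<not> k) i d" for d
    by (cases d) (auto simp: tsw_def)
  have t: "triangle D B c A (\<not> j) (\<not> k) i (\<not> oz) ox (\<not> oy)"
    by unfold_locales (use mem in \<open>simp_all add: val alpha_inner rot\<close>)
  show ?thesis
  proof (rule r3tI[OF t val', where I = inner])
    show "dface D ((B, \<not> j), \<not> oz) ((c, \<not> \<not> k), \<not> \<not> oy) ((A, i), ox)"
      unfolding dface_def using face face_circ face_nz by (simp add: rho_inner, blast)
    show "\<forall>d\<in>darts D - inner. rho D' (tsw B c A (\<not> j) (\<not> k) i d) = rho D d"
      unfolding T[symmetric] using rho' by (simp add: rim_def)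
    show "\<forall>d\<in>darts D. alpha D' d = tsw B c A (\<not> j) (\<not> k) i (alpha D (tsw B c A (\<not> j) (\<not> k) i d))"
      unfolding T[symmetric] using alpha' by blast
  qed (auto simp: crs' circs' hand' circ' inner_def)
qed

text \<open>The sides \<open>b2\<close>, \<open>b3\<close> and the rotations at the crossings are
  not prescribed by \<open>r3\<close>; they are forced because the face is closed under
  \<open>phi\<close>.\<close>

lemma r3_imp_r3t:
  assumes "r3 x D D'"
  obtains A B c k ox oy oz where "r3t D A B c True True k ox oy oz D'" "x = btype k ox oy oz"
proof -
  from assms obtain u v w o1 o2 o3 b1 b2 b3 where r: "r3d D D' u v w o1 o2 o3"
    and f: "dface D (if b1 = o1 then ((u, True), o1) else ((v, True), \<not> o1))
               (if b2 = o2 then ((u, False), o2) else ((w, True), \<not> o2))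
               (if b3 = o3 then ((v, False), o3) else ((w, False), \<not> o3))" (is "dface D ?d1 ?d2 ?d3")
    and x: "x = (if b1 then r3tbl o1 o2 o3 else r3tbl (\<not> o1) (\<not> o2) (\<not> o3))"
    unfolding r3_iff by blast
  have val: "valid D" "valid D'" and uvw: "u \<noteq> v" "u \<noteq> w" "v \<noteq> w" "u \<in> crs D" "v \<in> crs D" "w \<in> crs D"
    and a: "alpha D ((u, True), o1) = ((v, True), \<not> o1)" "alpha D ((u, False), o2) = ((w, True), \<not> o2)"
      "alpha D ((v, False), o3) = ((w, False), \<not> o3)"
    using r unfolding r3d_def by blast+
  interpret pdiag D by (rule valid_pdiag[OF val(1)])
  have dm: "((u, b), b') \<in> darts D" "((v, b), b') \<in> darts D" "((w, b), b') \<in> darts D" for b b'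
    using uvw by (simp_all add: dart_in)
  have a': "alpha D ((v, True), \<not> o1) = ((u, True), o1)" "alpha D ((w, True), \<not> o2) = ((u, False), o2)"
    "alpha D ((w, False), \<not> o3) = ((v, False), o3)"
    using alpha_alpha a dm by metis+
  have rp: "rho D (phi D d) = rho D d" if "d \<in> darts D" for d
    using val valid_iff that by (auto simp: dreg_def)
  \<comment> \<open>The face has no darts besides the three listed ones and \<open>phi\<close>
    preserves labels, so \<open>phi\<close> maps the set of these three into itself.\<close>
  have nx: "crot (hand D) (alpha D d) \<in> {?d1, ?d2, ?d3}" if "d \<in> {?d1, ?d2, ?d3}" for d
  proof -
    have i: "d \<in> darts D" using that dm by (auto split: if_splits)
    have "rho D d = rho D ?d1" using that f unfolding dface_def by blast
    then have "rho D (phi D d) = rho D ?d1" using rp[OF i] by simp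
    then have "phi D d \<in> {?d1, ?d2, ?d3}" using f phi_in[OF i] unfolding dface_def by blast
    then show ?thesis by (simp add: phi_def)
  qed
  have nx': "crot (hand D) (alpha D ?d1) \<in> {?d1, ?d2, ?d3}" "crot (hand D) (alpha D ?d2) \<in> {?d1, ?d2, ?d3}"
    "crot (hand D) (alpha D ?d3) \<in> {?d1, ?d2, ?d3}"
    by (rule nx, blast)+
  have T: "tsd u v w = tsw u v w True True True" "tsd u v w = tsw v u w True True False"
    by (rule tsd_tsw; use uvw in blast)+
  show ?thesis
  \<comment> \<open>The two cyclic orders. If the dart of the top strand starts at u, then
    \<open>phi\<close> takes it to v, where only the third strand can follow, and so on around the
    triangle; otherwise u and v are exchanged.\<close>
  proof (cases "b1 = o1")
    case d1: True
    have d3: "b3 = o3" and c1: "crot (hand D) ((v, True), \<not> o1) = ((v, False), o3)"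
      using nx'(1) d1 uvw by (auto simp: a crot_eq split: if_splits)
    have d2: "b2 \<noteq> o2" and c3: "crot (hand D) ((w, False), \<not> o3) = ((w, True), \<not> o2)"
      using nx'(3) d1 d3 uvw by (auto simp: a crot_eq split: if_splits)
    have c2: "crot (hand D) ((u, False), o2) = ((u, True), o1)"
      using nx'(2) d1 d2 d3 uvw by (auto simp: a' crot_eq split: if_splits)
    have t: "triangle D u v w True True True o1 (\<not> o2) (\<not> o3)"
      by unfold_locales (use val uvw a c1 c2 c3 in simp_all)
    have "r3t D u v w True True True o1 (\<not> o2) (\<not> o3) D'"
    proof (rule r3tI[OF t val(2)])
      show "dface D ((u, True), o1) ((v, \<not> True), \<not> \<not> o3) ((w, True), \<not> o2)"
        using dface_commute[OF f] d1 d2 d3 by simp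
      show "\<forall>d\<in>darts D - {((u, True), o1), ((v, True), \<not> o1), ((u, False), o2), ((w, True), \<not> o2),
            ((v, False), o3), ((w, False), \<not> o3)}. rho D' (tsw u v w True True True d) = rho D d"
        using r unfolding r3d_def T(1) by blast
      show "\<forall>d\<in>darts D. alpha D' d = tsw u v w True True True (alpha D (tsw u v w True True True d))"
        using r unfolding r3d_def T(1) by blast
    qed (use r in \<open>auto simp: r3d_def\<close>)
    moreover have "x = btype True o1 (\<not> o2) (\<not> o3)"
      unfolding x btype_def using d1 by (cases o1) auto
    ultimately show ?thesis by (rule that)
  next
    case d1: False
    have d2: "b2 = o2" and c1: "crot (hand D) ((u, True), o1) = ((u, False), o2)"
      using nx'(1) d1 uvw by (auto simp: a' crot_eq split: if_splits)
    have d3: "b3 \<noteq> o3" and c2: "crot (hand D) ((w, True), \<not> o2) = ((w, False), \<not> o3)"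
      using nx'(2) d1 d2 uvw by (auto simp: a crot_eq split: if_splits)
    have c3: "crot (hand D) ((v, False), o3) = ((v, True), \<not> o1)"
      using nx'(3) d1 d2 d3 uvw by (auto simp: a' crot_eq split: if_splits)
    have t: "triangle D v u w True True False (\<not> o1) (\<not> o3) (\<not> o2)"
      by unfold_locales (use val uvw a a' c1 c2 c3 in simp_all)
    have "r3t D v u w True True False (\<not> o1) (\<not> o3) (\<not> o2) D'"
    proof (rule r3tI[OF t val(2)])
      show "dface D ((v, True), \<not> o1) ((u, \<not> True), \<not> \<not> o2) ((w, False), \<not> o3)"
        using f d1 d2 d3 by simp
      show "\<forall>d\<in>darts D - {((u, True), o1), ((v, True), \<not> o1), ((u, False), o2), ((w, True), \<not> o2),
            ((v, False), o3), ((w, False), \<not> o3)}. rho D' (tsw v u w True True False d) = rho D d"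
        using r unfolding r3d_def T(2) by blast
      show "\<forall>d\<in>darts D. alpha D' d = tsw v u w True True False (alpha D (tsw v u w True True False d))"
        using r unfolding r3d_def T(2) by blast
    qed (use r in \<open>auto simp: r3d_def\<close>)
    moreover have "x = btype False (\<not> o1) (\<not> o3) (\<not> o2)"
      unfolding x btype_def using d1 by (cases o1) auto
    ultimately show ?thesis by (rule that)
  qed
qed

lemma r3I:
  assumes "r3d D D' u v w o1 o2 o3"
    and "dface D (if b1 = o1 then ((u, True), o1) else ((v, True), \<not> o1))
               (if b2 = o2 then ((u, False), o2) else ((w, True), \<not> o2))
               (if b3 = o3 then ((v, False), o3) else ((w, False), \<not> o3))"
    and "x = (if b1 then r3tbl o1 o2 o3 else r3tbl (\<not> o1) (\<not> o2) (\<not> o3))"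
  shows "r3 x D D'"
  unfolding r3_iff using assms by blast

text \<open>If \<open>k\<close> holds, y is over at c and hence the second strand, which meets the
  top strand at A, so u = A; otherwise z is second and u = B. The triangle lies to the left of x
  from A to B, whence \<open>b1 = ox\<close>.\<close>

lemma r3t_imp_r3:
  assumes "r3t D A B c True True k ox oy oz D'"
  shows "r3 (btype k ox oy oz) D D'"
proof -
  interpret r3t D A B c True True k ox oy oz D' by (rule assms)
  have hand_all: "\<forall>v\<in>crs D. hand D' v = hand D v" using hand' by blast
  have circ_all: "\<forall>m\<in>circs D. \<forall>b. reg D' (Circ m, b) = reg D (Circ m, b)" using circ' by blast
  have alpha_all: "\<forall>d\<in>darts D. alpha D' d = T (alpha D (T d))" using alpha' by blast
  have rho_all: "\<forall>d\<in>darts D - inner. rho D' (T d) = rho D d" using rho' by (simp add: rim_def)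
  have fc: "\<forall>d\<in>darts D. rho D d = rho D ((A, True), ox) \<longrightarrow>
      d \<in> {((A, True), ox), ((B, False), \<not> oz), ((c, k), oy)}"
    using face by auto
  have fr: "rho D ((B, False), \<not> oz) = rho D ((A, True), ox)" "rho D ((c, k), oy) = rho D ((A, True), ox)"
    using rho_inner(1,2) by simp_all
  have fcirc: "\<forall>m\<in>circs D. \<forall>b. reg D (Circ m, b) \<noteq> rho D ((A, True), ox)" using face_circ by blast
  have df: "dface D ((A, True), ox) ((B, False), \<not> oz) ((c, k), oy)"
    unfolding dface_def using face_nz fc fr fcirc by blast
  show ?thesis
  proof (cases k)
    case k: True
    have T: "tsd A B c = T" using k tsd_tsw(1)[of A B c] by simp
    have I: "inner = {((A, True), ox), ((B, True), \<not> ox), ((A, False), \<not> oy), ((c, True), \<not> \<not> oy),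
        ((B, False), \<not> oz), ((c, False), \<not> \<not> oz)}"
      unfolding inner_def by (simp add: k)
    have "r3d D D' A B c ox (\<not> oy) (\<not> oz)"
      unfolding r3d_def T I[symmetric]
      using val val' dist mem crs' circs' hand_all alpha_all rho_all circ_all alpha_inner k by simp
    moreover have "dface D ((A, True), ox) ((c, True), \<not> \<not> oy) ((B, False), \<not> oz)"
      using dface_commute[OF df] k by simp
    moreover have "btype k ox oy oz = (if ox then r3tbl ox (\<not> oy) (\<not> oz) else r3tbl (\<not> ox) (\<not> \<not> oy) (\<not> \<not> oz))"
      by (cases ox) (simp_all add: btype_def k)
    ultimately show ?thesis
      using r3I[of D D' A B c ox "\<not> oy" "\<not> oz" ox oy "\<not> oz" "btype k ox oy oz"] by simp
  next
    case k: False
    have T: "tsd B A c = T" using k tsd_tsw(2)[of B A c] by simp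
    have I: "inner = {((B, True), \<not> ox), ((A, True), \<not> \<not> ox), ((B, False), \<not> oz), ((c, True), \<not> \<not> oz),
        ((A, False), \<not> oy), ((c, False), \<not> \<not> oy)}"
      unfolding inner_def by (auto simp: k)
    have "r3d D D' B A c (\<not> ox) (\<not> oz) (\<not> oy)"
      unfolding r3d_def T I[symmetric]
      using val val' dist mem crs' circs' hand_all alpha_all rho_all circ_all alpha_inner k by simp
    moreover have "dface D ((A, True), \<not> \<not> ox) ((B, False), \<not> oz) ((c, False), \<not> \<not> oy)"
      using df k by simp
    moreover have "btype k ox oy oz =
        (if ox then r3tbl (\<not> ox) (\<not> oz) (\<not> oy) else r3tbl (\<not> \<not> ox) (\<not> \<not> oz) (\<not> \<not> oy))"
      by (cases ox) (simp_all add: btype_def k)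
    ultimately show ?thesis
      using r3I[of D D' B A c "\<not> ox" "\<not> oz" "\<not> oy" ox "\<not> oz" oy "btype k ox oy oz"] by simp
  qed
qed

section \<open>The graph on the eight move types\<close>

definition r3_via :: "r3move \<Rightarrow> diag \<Rightarrow> diag \<Rightarrow> bool" where
  "r3_via y D D' \<longleftrightarrow> (\<exists>D1 D2 E. r2 D D1 \<and> r3 y D1 D2 \<and> r2 E D2 \<and> iso E D')"

text \<open>The given triangle is rotated so that x, z or y is the strand to be pushed. The
  auxiliary triangle is then rotated until its top strand comes first, as \<open>btype\<close>
  requires.\<close>

lemma (in r3t) r3_via_neighbours:
  assumes "i" "j"
  shows "r3_via (btype (\<not> k) (\<not> ox) (\<not> oz) (\<not> oy)) D D'"
    and "r3_via (btype (\<not> k) ox oz (\<not> oy)) D D'"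
    and "r3_via (btype (\<not> k) ox (\<not> oz) oy) D D'"
proof -
  have ij: "i = True" "j = True" using assms by simp_all
  note r0 = r3t_axioms[unfolded ij]
  note r1 = r3t.r3t_rotate[OF r0]
  note r2' = r3t.r3t_rotate[OF r1]
  show "r3_via (btype (\<not> k) (\<not> ox) (\<not> oz) (\<not> oy)) D D'"
    using r3t.r3t_neighbour[OF r0] r3t_imp_r3 unfolding r3_via_def by metis
  obtain D1 D2 E P where c1: "r2 D D1" "r2 E D2" "iso E D'"
    and n1: "r3t D1 c B P (\<not> k) False False oz oy (\<not> ox) D2"
    using r3t.r3t_neighbour[OF r1] by simp metis
  show "r3_via (btype (\<not> k) ox oz (\<not> oy)) D D'"
    using c1 r3t_imp_r3 r3t.r3t_rotate[OF n1, simplified] unfolding r3_via_def by metis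
  obtain D1 D2 E P where c2: "r2 D D1" "r2 E D2" "iso E D'"
    and n2: "r3t D1 A c P False k True (\<not> oy) ox oz D2"
    using r3t.r3t_neighbour[OF r2'] by simp metis
  show "r3_via (btype (\<not> k) ox (\<not> oz) oy) D D'"
    using c2 r3t_imp_r3 r3t.r3t_rotate[OF r3t.r3t_rotate[OF n2], simplified] unfolding r3_via_def by metis
qed

text \<open>Pushing the top strand changes only \<open>l\<close>, as the table is normalized by the
  direction of that strand. Pushing the third strand also flips \<open>p\<close>, pushing the second
  also flips \<open>q\<close>. Only the type with both bits flipped is out of reach: the graph is
  the complete bipartite graph on 4 + 4 types minus a perfect matching, that is, a cube.\<close>

lemma r3_via_r3tbl:
  assumes "r3 (r3tbl l p q) D D'" and "p' = p \<or> q' = q"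
  shows "r3_via (r3tbl (\<not> l) p' q') D D'"
proof -
  obtain A B c k ox oy oz where r: "r3t D A B c True True k ox oy oz D'"
    and x: "r3tbl l p q = btype k ox oy oz"
    using assms(1) by (rule r3_imp_r3t)
  have inj: "r3tbl a b c = r3tbl a' b' c' \<longleftrightarrow> a = a' \<and> b = b' \<and> c = c'" for a b c a' b' c'
    by (cases a; cases b; cases c; cases a'; cases b'; cases c') simp_all
  note n = r3t.r3_via_neighbours[OF r TrueI TrueI]
  show ?thesis
    using n x assms(2) by (cases k; cases "p' = p"; cases "q' = q") (auto simp: btype_def inj)
qed

lemma r3tbl_exhaust: obtains l p q where "x = r3tbl l p q"
  by (cases x) (metis r3tbl.simps)+

theorem mainTheorem1:
  fixes m x :: r3move and D D' :: diag
  assumes "x \<noteq> m" and "r3 x D D'"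
  shows "(mstep m)\<^sup>*\<^sup>* D D'"
proof -
  let ?R = "\<lambda>y. \<forall>D D'. r3 y D D' \<longrightarrow> (mstep m)\<^sup>*\<^sup>* D D'"
  obtain l p q where m: "m = r3tbl l p q" by (rule r3tbl_exhaust)
  have start: "?R (r3tbl l p q)" by (auto simp: mstep_def m)
  have step: "?R (r3tbl a b c)" if y: "?R (r3tbl (\<not> a) b' c')" and e: "b' = b \<or> c' = c" for a b c b' c'
  proof (intro allI impI)
    fix D D' assume "r3 (r3tbl a b c) D D'"
    then obtain D1 D2 E where "r2 D D1" "r3 (r3tbl (\<not> a) b' c') D1 D2" "r2 E D2" "iso E D'"
      using r3_via_r3tbl[OF _ e] unfolding r3_via_def by blast
    then have "mstep m D D1" "(mstep m)\<^sup>*\<^sup>* D1 D2" "mstep m D2 E" "mstep m E D'"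
      using y by (auto simp: mstep_def)
    then show "(mstep m)\<^sup>*\<^sup>* D D'"
      by (meson converse_rtranclp_into_rtranclp rtranclp.rtrancl_into_rtrancl)
  qed
  \<comment> \<open>Distances 1, 2 and 3 from \<open>m\<close> in the cube; the intermediate type in
    \<open>same\<close> agrees with each end in one of the two bits.\<close>
  have far: "?R (r3tbl (\<not> l) b c)" if "b = p \<or> c = q" for b c
    by (rule step[where b' = p and c' = q]) (use start that in auto)
  have same: "?R (r3tbl l b c)" for b c
    by (rule step[where b' = b and c' = q]) (use far in auto)
  have opposite: "?R (r3tbl (\<not> l) b c)" for b c
    by (rule step[where b' = b and c' = c]) (use same in auto)
  obtain a b c where "x = r3tbl a b c" by (rule r3tbl_exhaust)
  then have "?R x" using same opposite by (cases "a = l") auto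
  then show ?thesis using assms(2) by blast
qed

end
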